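(* Let $M$ be a smooth manifold of dimension $2n$ endowed with a generalized metric $E$ of signature $(n,n)$, let $D'$, $D''$ be metric connections on $E'=E$ and $E''=E^\perp$, and let $\mathcal{K}_\varepsilon$, $\varepsilon\in\{1,2,3,4\}$, be the generalized almost paracomplex structures on the generalized reflector space $\mathcal{G}=\mathcal G(E)$ defined by means of $D=D'\oplus D''$. Then $\mathcal{K}_\varepsilon$ is not a $B$-transform of the trivial generalized almost paracomplex structure $\mathcal{K}$ on $\mathcal G$, nor of any of the generalized almost paracomplex structures $\mathcal{K}_{\omega}$, $\mathcal{K}_{\pi}$, $\mathcal{K}_{P}$ yielded, respectively, by a pre-symplectic form $\omega$, a field of $2$-vectors $\pi$, or a product structure $P$ on $\mathcal{G}$.
   Context: **Linear notions.** A metric is a nondegenerate symmetric bilinear form. A bilinear form $\varphi$ on a vector space $T$ also denotes the map $T\to T^*$, $\varphi(X)(Y)=\varphi(X,Y)$. On $T\oplus T^*$ put $\langle X+\alpha,Y+\beta\rangle=\frac12[\alpha(Y)+\beta(X)]$. A generalized paracomplex structure on $T$ is an endomorphism $K$ of $T\oplus T^*$ with $K^2=Id$ and $\langle KA,B\rangle+\langle A,KB\rangle=0$. A generalized almost paracomplex structure on a manifold $N$ is an endomorphism of $TN\oplus T^*N$ which is such a structure at each point. **Special structures and $B$-transforms.** On a manifold $N$: the trivial structure is $\mathcal K(X+\alpha)=X-\alpha$; for a pre-symplectic form $\omega$ (a nondegenerate $2$-form, not necessarily closed), $\mathcal K_\omega(X+\alpha)=\omega^{-1}(\alpha)+\omega(X)$;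 for a field $\pi$ of $2$-vectors, $\mathcal K_\pi(X+\alpha)=(X-\imath_\alpha\pi)-\alpha$, where $\beta(\imath_\alpha\pi)=(\alpha\wedge\beta)(\pi)$ for every $\beta\in T^*N$; for a product structure $P$ on $N$ (an endomorphism of $TN$ with $P^2=Id$, $P\neq\pm Id$ at every point), $\mathcal K_P(X+\alpha)=PX-P^*\alpha$. For a $2$-form $B$ on $N$, $e^B(X+\alpha)=X+\alpha+\imath_XB$, and the $B$-transform of a generalized almost paracomplex structure $\mathcal K$ is $e^B\mathcal Ke^{-B}$. **Generalized metrics.** A generalized metric of signature $(n,n)$ on $M$, $\dim M=2n$, is a subbundle $E\subset TM\oplus T^*M$ of rank $2n$ on which $\langle\cdot,\cdot\rangle$ has signature $(n,n)$ and with $E_p\cap T^*_pM=\{0\}$ for all $p$. Then $E=\{X+g(X)+\Theta(X):X\in TM\}$ for a unique metric $g$ of signature $(n,n)$ and a unique $2$-form $\Theta$ on $M$. Put $E'=E$, $E''=E^{\perp}$ (orthogonal complement for $\langle\cdot,\cdot\rangle$), $g'=\langle\cdot,\cdot\rangle|E'$, $g''=-\langle\cdot,\cdot\rangle|E''$. A generalized paracomplex structure $K$ on $T_pM$ is compatible with $E_p$ if $KE_p\subset E_p$; then $K$ preserves $E'_p$ and $E''_p$. **Generalized reflector space.** $\mathcal G=\mathcal G(E)\to M$ (projection denoted here by $q$) is the bundle whose fibre at $p$ consists of all generalized paracomplex structures on $T_pM$ compatible with $E_p$. Let $A(E')$, $A(E'')$ be the bundles of $g'$-, resp. $g''$-skew-symmetric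 endomorphisms; via $K\mapsto(K|E',K|E'')$, $\mathcal G$ is a subbundle of $A(E')\oplus A(E'')$. Given connections $D'$ on $E'$ with $D'g'=0$ and $D''$ on $E''$ with $D''g''=0$, let $D=D'\oplus D''$ on $TM\oplus T^*M$; the induced connection on $A(E')\oplus A(E'')$ is also denoted by $D$. Its horizontal spaces at points of $\mathcal G$ are tangent to $\mathcal G$, so $T\mathcal G=\mathcal V\oplus\mathcal H$ (vertical and horizontal). Elements of $\mathcal H_K^*$, $\mathcal V_K^*$ are considered as $1$-forms on $T_K\mathcal G$ vanishing on $\mathcal V_K$, resp. $\mathcal H_K$. For $A=X+\alpha\in T_pM\oplus T_p^*M$, $p=q(K)$, let $A^h_K=X^h_K+\alpha^h_K$, where $X^h_K\in\mathcal H_K$ is the horizontal lift and $\alpha^h_K\in\mathcal H_K^*$ satisfies $\alpha^h_K(Y^h_K)=\alpha(Y)$. **The structures $\mathcal K_\varepsilon$.** The space $\mathcal V_K$ consists of the $\langle\cdot,\cdot\rangle$-skew-symmetric endomorphisms $V$ of $T_pM\oplus T_p^*M$ preserving $E'_p$ and $E''_p$ and anticommuting with $K$; write $V=(V',V'')=(V|E',V|E'')$, $K'=K|E'$, $K''=K|E''$. Define on $\mathcal V_K$: $\mathcal P_1(V',V'')=(K'V',K''V'')$, $\mathcal P_2(V',V'')=(K'V',-K''V'')$, $\mathcal P_3=-\mathcal P_2$, $\mathcal P_4=-\mathcal P_1$. For $\varepsilon=1,\dots,4$, $\mathcal K_\varepsilon$ is the endomorphism of $T\mathcal G\oplus T^*\mathcal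 G$ with $\mathcal K_\varepsilon A^h_K=(KA)^h_K$, $\mathcal K_\varepsilon V=\mathcal P_\varepsilon V$ for $V\in\mathcal V_K$, and $\mathcal K_\varepsilon\varphi=-\varphi\circ\mathcal P_\varepsilon$ for $\varphi\in\mathcal V_K^*$. *)

theory Defs
  imports "HOL-Analysis.Analysis"
begin

section \<open>Smooth maps and smooth manifolds\<close>

text \<open>
  Only used on open sets of finite-dimensional spaces, where ``differentiable with all
  directional derivatives of class \<open>C\<^sup>k\<close>'' is the usual class \<open>C\<^sup>k\<^sup>+\<^sup>1\<close>.
\<close>

primrec Ck_on :: "nat \<Rightarrow> 'a::real_normed_vector set \<Rightarrow> ('a \<Rightarrow> 'b::real_normed_vector) \<Rightarrow> bool" where
  "Ck_on 0 U f \<longleftrightarrow> continuous_on U f"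
| "Ck_on (Suc k) U f \<longleftrightarrow>
     (\<forall>x\<in>U. f differentiable (at x)) \<and> (\<forall>v. Ck_on k U (\<lambda>x. frechet_derivative f (at x) v))"

definition smooth_on :: "'a::real_normed_vector set \<Rightarrow> ('a \<Rightarrow> 'b::real_normed_vector) \<Rightarrow> bool" where
  "smooth_on U f \<longleftrightarrow> (\<forall>k. Ck_on k U f)"

text \<open>A chart is a domain together with the coordinate map.\<close>

type_synonym ('m, 'e) chart = "'m set \<times> ('m \<Rightarrow> 'e)"

definition chart_inv :: "('m, 'e) chart \<Rightarrow> 'e \<Rightarrow> 'm" where
  "chart_inv c = inv_into (fst c) (snd c)"

text \<open>
  The underlying space of the manifold is a whole type whose topology is Hausdorff and second
  countable; the dimension is the dimension of the model space \<open>'e\<close>.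
\<close>

definition smooth_manifold ::
  "('m::{t2_space, second_countable_topology}, 'e::euclidean_space) chart set \<Rightarrow> bool" where
  "smooth_manifold \<A> \<longleftrightarrow>
     (\<Union>c\<in>\<A>. fst c) = UNIV \<and>
     (\<forall>c\<in>\<A>. open (fst c) \<and> open (snd c ` fst c) \<and>
        homeomorphism (fst c) (snd c ` fst c) (snd c) (chart_inv c)) \<and>
     (\<forall>c\<in>\<A>. \<forall>d\<in>\<A>. smooth_on (snd c ` (fst c \<inter> fst d)) (snd d \<circ> chart_inv c))"

definition chart_at :: "('m, 'e) chart set \<Rightarrow> 'm \<Rightarrow> ('m, 'e) chart" where
  "chart_at \<A> p = (SOME c. c \<in> \<A> \<and> p \<in> fst c)"

text \<open>
  Differential at \<open>p\<close> of the change of coordinates from the chart \<open>c\<close> to the chart \<open>d\<close>.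

  The tangent space at \<open>p\<close> is the model space, a vector being given by its coordinates in the
  preferred chart \<open>chart_at \<A> p\<close>; its coordinates in another chart \<open>c\<close> are obtained
  by applying \<open>jac (chart_at \<A> p) c p\<close>.
\<close>

definition jac ::
  "('m, 'e::real_normed_vector) chart \<Rightarrow> ('m, 'e) chart \<Rightarrow> 'm \<Rightarrow> ('e \<Rightarrow>\<^sub>L 'e)" where
  "jac c d p = Blinfun (frechet_derivative (snd d \<circ> chart_inv c) (at (snd c p)))"

definition smooth_near ::
  "('m, 'e::real_normed_vector) chart \<Rightarrow> 'm \<Rightarrow> ('m \<Rightarrow> 'b::real_normed_vector) \<Rightarrow> bool" where
  "smooth_near c p F \<longleftrightarrow>
     (\<exists>W. open W \<and> snd c p \<in> W \<and> W \<subseteq> snd c ` fst c \<and> smooth_on W (F \<circ> chart_inv c))"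

definition dir_deriv ::
  "('m, 'e::real_normed_vector) chart \<Rightarrow> 'm \<Rightarrow> 'e \<Rightarrow> ('m \<Rightarrow> 'b::real_normed_vector) \<Rightarrow> 'b" where
  "dir_deriv c p X F = frechet_derivative (F \<circ> chart_inv c) (at (snd c p)) X"


section \<open>The generalized tangent bundle of \<open>M\<close>\<close>

text \<open>Elements of $T_pM\oplus T_p^*M$ and endomorphisms of this space, in the preferred chart.\<close>

type_synonym 'e gtv = "'e \<times> ('e \<Rightarrow>\<^sub>L real)"
type_synonym 'e gend = "'e gtv \<Rightarrow>\<^sub>L 'e gtv"

definition pairing :: "'e::real_normed_vector gtv \<Rightarrow> 'e gtv \<Rightarrow> real" where
  "pairing a b = (blinfun_apply (snd a) (fst b) + blinfun_apply (snd b) (fst a)) / 2"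

definition skew_end :: "'e::real_normed_vector gend \<Rightarrow> bool" where
  "skew_end L \<longleftrightarrow> (\<forall>a b. pairing (L a) b + pairing a (L b) = 0)"

definition gen_paracomplex :: "'e::real_normed_vector gend \<Rightarrow> bool" where
  "gen_paracomplex K \<longleftrightarrow> K o\<^sub>L K = id_blinfun \<and> skew_end K"

text \<open>Coordinates in the chart \<open>d\<close> from coordinates in the chart \<open>c\<close>.\<close>

definition gchange ::
  "('m, 'e::real_normed_vector) chart \<Rightarrow> ('m, 'e) chart \<Rightarrow> 'm \<Rightarrow> 'e gtv \<Rightarrow> 'e gtv" where
  "gchange c d p a = (jac c d p (fst a), snd a o\<^sub>L jac d c p)"

definition echange ::
  "('m, 'e::real_normed_vector) chart \<Rightarrow> ('m, 'e) chart \<Rightarrow> 'm \<Rightarrow> 'e gend \<Rightarrow> 'e gend" where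
  "echange c d p L = Blinfun (\<lambda>a. gchange c d p (L (gchange d c p a)))"

text \<open>
  Functions, vector fields, sections of $TM\oplus T^*M$ and sections of its endomorphism bundle
  which are smooth on some neighbourhood of \<open>p\<close> (their values elsewhere are irrelevant).
\<close>

definition smooth_fun_near :: "('m, 'e::euclidean_space) chart set \<Rightarrow> 'm \<Rightarrow> ('m \<Rightarrow> real) \<Rightarrow> bool" where
  "smooth_fun_near \<A> p f \<longleftrightarrow> smooth_near (chart_at \<A> p) p f"

definition smooth_vf_near :: "('m, 'e::euclidean_space) chart set \<Rightarrow> 'm \<Rightarrow> ('m \<Rightarrow> 'e) \<Rightarrow> bool" where
  "smooth_vf_near \<A> p X \<longleftrightarrow>
     smooth_near (chart_at \<A> p) p (\<lambda>r. jac (chart_at \<A> r) (chart_at \<A> p) r (X r))"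

definition smooth_sec_near :: "('m, 'e::euclidean_space) chart set \<Rightarrow> 'm \<Rightarrow> ('m \<Rightarrow> 'e gtv) \<Rightarrow> bool" where
  "smooth_sec_near \<A> p s \<longleftrightarrow>
     smooth_near (chart_at \<A> p) p (\<lambda>r. gchange (chart_at \<A> r) (chart_at \<A> p) r (s r))"

definition end_coord :: "('m, 'e::euclidean_space) chart set \<Rightarrow> 'm \<Rightarrow> ('m \<Rightarrow> 'e gend) \<Rightarrow> 'm \<Rightarrow> 'e gend" where
  "end_coord \<A> p \<sigma> r = echange (chart_at \<A> r) (chart_at \<A> p) r (\<sigma> r)"

definition smooth_end_near :: "('m, 'e::euclidean_space) chart set \<Rightarrow> 'm \<Rightarrow> ('m \<Rightarrow> 'e gend) \<Rightarrow> bool" where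
  "smooth_end_near \<A> p \<sigma> \<longleftrightarrow> smooth_near (chart_at \<A> p) p (end_coord \<A> p \<sigma>)"


section \<open>Generalized metrics and metric connections\<close>

definition smooth_subbundle ::
  "('m::topological_space, 'e::euclidean_space) chart set \<Rightarrow> nat \<Rightarrow> ('m \<Rightarrow> 'e gtv set) \<Rightarrow> bool" where
  "smooth_subbundle \<A> k E \<longleftrightarrow>
     (\<forall>p. subspace (E p) \<and> dim (E p) = k) \<and>
     (\<forall>p. \<exists>s. (\<forall>i<k. smooth_sec_near \<A> p (s i)) \<and>
              (\<forall>\<^sub>F r in nhds p. E r = span ((\<lambda>i. s i r) ` {..<k})))"

definition has_signature ::
  "('v::real_vector \<Rightarrow> 'v \<Rightarrow> real) \<Rightarrow> 'v set \<Rightarrow> nat \<Rightarrow> nat \<Rightarrow> bool" where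
  "has_signature h S k l \<longleftrightarrow>
     (\<exists>P N. subspace P \<and> subspace N \<and> dim P = k \<and> dim N = l \<and> S = span (P \<union> N) \<and>
        (\<forall>u\<in>P. u \<noteq> 0 \<longrightarrow> h u u > 0) \<and> (\<forall>v\<in>N. v \<noteq> 0 \<longrightarrow> h v v < 0) \<and>
        (\<forall>u\<in>P. \<forall>v\<in>N. h u v = 0))"

definition generalized_metric ::
  "('m::topological_space, 'e::euclidean_space) chart set \<Rightarrow> nat \<Rightarrow> ('m \<Rightarrow> 'e gtv set) \<Rightarrow> bool" where
  "generalized_metric \<A> n E \<longleftrightarrow>
     smooth_subbundle \<A> (2 * n) E \<and>
     (\<forall>p. has_signature pairing (E p) n n) \<and>
     (\<forall>p. E p \<inter> {a. fst a = 0} = {0})"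

definition orth :: "('m \<Rightarrow> 'e::real_normed_vector gtv set) \<Rightarrow> 'm \<Rightarrow> 'e gtv set" where
  "orth E p = {b. \<forall>a\<in>E p. pairing a b = 0}"

definition local_section ::
  "('m::topological_space, 'e::euclidean_space) chart set \<Rightarrow> ('m \<Rightarrow> 'e gtv set) \<Rightarrow> 'm \<Rightarrow>
   ('m \<Rightarrow> 'e gtv) \<Rightarrow> bool" where
  "local_section \<A> F p s \<longleftrightarrow> smooth_sec_near \<A> p s \<and> (\<forall>\<^sub>F r in nhds p. s r \<in> F r)"

text \<open>
  A connection on the subbundle \<open>F\<close>: \<open>D p X s\<close> is the covariant derivative at \<open>p\<close> in the
  direction \<open>X\<close> of a section \<open>s\<close> of \<open>F\<close> defined near \<open>p\<close>.  That it depends only on the germ of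
  \<open>s\<close> follows from the Leibniz rule, applied to functions which are locally constant near \<open>p\<close>.
\<close>

type_synonym ('m, 'e) conn = "'m \<Rightarrow> 'e \<Rightarrow> ('m \<Rightarrow> 'e gtv) \<Rightarrow> 'e gtv"

definition connection ::
  "('m::topological_space, 'e::euclidean_space) chart set \<Rightarrow> ('m \<Rightarrow> 'e gtv set) \<Rightarrow> ('m, 'e) conn \<Rightarrow> bool" where
  "connection \<A> F D \<longleftrightarrow>
     (\<forall>p s. local_section \<A> F p s \<longrightarrow>
        linear (\<lambda>X. D p X s) \<and> (\<forall>X. D p X s \<in> F p)) \<and>
     (\<forall>p s t X. local_section \<A> F p s \<longrightarrow> local_section \<A> F p t \<longrightarrow>
        D p X (\<lambda>r. s r + t r) = D p X s + D p X t) \<and>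
     (\<forall>p f s X. smooth_fun_near \<A> p f \<longrightarrow> local_section \<A> F p s \<longrightarrow>
        D p X (\<lambda>r. f r *\<^sub>R s r) = dir_deriv (chart_at \<A> p) p X f *\<^sub>R s p + f p *\<^sub>R D p X s) \<and>
     (\<forall>p X s. smooth_vf_near \<A> p X \<longrightarrow> local_section \<A> F p s \<longrightarrow>
        smooth_sec_near \<A> p (\<lambda>r. D r (X r) s))"

definition metric_connection ::
  "('m::topological_space, 'e::euclidean_space) chart set \<Rightarrow> ('m \<Rightarrow> 'e gtv set) \<Rightarrow>
   ('e gtv \<Rightarrow> 'e gtv \<Rightarrow> real) \<Rightarrow> ('m, 'e) conn \<Rightarrow> bool" where
  "metric_connection \<A> F h D \<longleftrightarrow>
     connection \<A> F D \<and>
     (\<forall>p s t X. local_section \<A> F p s \<longrightarrow> local_section \<A> F p t \<longrightarrow>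
        dir_deriv (chart_at \<A> p) p X (\<lambda>r. h (s r) (t r)) = h (D p X s) (t p) + h (s p) (D p X t))"

text \<open>The component in $E'=E$ for the decomposition $TM\oplus T^*M=E\oplus E^\perp$.\<close>

definition pr1 :: "('m \<Rightarrow> 'e::real_normed_vector gtv set) \<Rightarrow> 'm \<Rightarrow> 'e gtv \<Rightarrow> 'e gtv" where
  "pr1 E p a = (THE b. b \<in> E p \<and> a - b \<in> orth E p)"

definition sum_conn ::
  "('m \<Rightarrow> 'e::real_normed_vector gtv set) \<Rightarrow> ('m, 'e) conn \<Rightarrow> ('m, 'e) conn \<Rightarrow> ('m, 'e) conn" where
  "sum_conn E D' D'' p X s = D' p X (\<lambda>r. pr1 E r (s r)) + D'' p X (\<lambda>r. s r - pr1 E r (s r))"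


section \<open>The generalized reflector space\<close>

text \<open>
  The total space of the bundle of endomorphisms of $TM\oplus T^*M$ is the set of pairs \<open>(p, L)\<close>,
  with the charts induced by those of \<open>M\<close>.  In such a chart a tangent vector is a pair whose
  first component is its projection to $TM$; the vertical vectors are the pairs \<open>(0, V)\<close>.
\<close>

definition end_chart_at ::
  "('m, 'e::euclidean_space) chart set \<Rightarrow> 'm \<times> 'e gend \<Rightarrow> ('m \<times> 'e gend, 'e \<times> 'e gend) chart" where
  "end_chart_at \<A> x = (let c = chart_at \<A> (fst x) in
     (fst c \<times> UNIV, \<lambda>(p, L). (snd c p, echange (chart_at \<A> p) c p L)))"

text \<open>The fibres of the bundle $A(E')\oplus A(E'')$ and the generalized reflector space.\<close>

definition adjoint_fibre :: "('m \<Rightarrow> 'e::real_normed_vector gtv set) \<Rightarrow> 'm \<Rightarrow> 'e gend set" where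
  "adjoint_fibre E p =
     {L. skew_end L \<and> blinfun_apply L ` E p \<subseteq> E p \<and> blinfun_apply L ` orth E p \<subseteq> orth E p}"

definition reflector_space :: "('m \<Rightarrow> 'e::real_normed_vector gtv set) \<Rightarrow> ('m \<times> 'e gend) set" where
  "reflector_space E = {(p, K). gen_paracomplex K \<and> blinfun_apply K ` E p \<subseteq> E p}"

definition adjoint_section ::
  "('m::topological_space, 'e::euclidean_space) chart set \<Rightarrow> ('m \<Rightarrow> 'e gtv set) \<Rightarrow> 'm \<Rightarrow>
   ('m \<Rightarrow> 'e gend) \<Rightarrow> bool" where
  "adjoint_section \<A> E p \<sigma> \<longleftrightarrow>
     smooth_end_near \<A> p \<sigma> \<and> (\<forall>\<^sub>F r in nhds p. \<sigma> r \<in> adjoint_fibre E r)"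

text \<open>The induced connection: $(D_X\sigma)(s)=D_X(\sigma s)-\sigma(D_Xs)$ for all sections $s$.\<close>

definition end_conn ::
  "('m, 'e::euclidean_space) chart set \<Rightarrow> ('m, 'e) conn \<Rightarrow> 'm \<Rightarrow> 'e \<Rightarrow> ('m \<Rightarrow> 'e gend) \<Rightarrow> 'e gend" where
  "end_conn \<A> D p X \<sigma> =
     (THE L. \<forall>s. smooth_sec_near \<A> p s \<longrightarrow> blinfun_apply L (s p) = D p X (\<lambda>r. \<sigma> r (s r)) - \<sigma> p (D p X s))"

text \<open>
  Horizontal lift: $X^h_K=\sigma_*X-D_X\sigma$ for every local section $\sigma$ of
  $A(E')\oplus A(E'')$ with $\sigma(p)=K$, where $D_X\sigma$ is regarded as a vertical vector.
\<close>

definition hlift ::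
  "('m::topological_space, 'e::euclidean_space) chart set \<Rightarrow> ('m \<Rightarrow> 'e gtv set) \<Rightarrow> ('m, 'e) conn \<Rightarrow>
   'm \<times> 'e gend \<Rightarrow> 'e \<Rightarrow> 'e \<times> 'e gend" where
  "hlift \<A> E D x X =
     (THE w. \<exists>\<sigma>. adjoint_section \<A> E (fst x) \<sigma> \<and> \<sigma> (fst x) = snd x \<and>
        w = (X, dir_deriv (chart_at \<A> (fst x)) (fst x) X (end_coord \<A> (fst x) \<sigma>)
                - end_conn \<A> D (fst x) X \<sigma>))"


section \<open>Generalized geometry on submanifolds of a manifold\<close>

text \<open>
  The ambient manifold has points of type \<open>'x\<close> and preferred charts \<open>ch\<close> with values in \<open>'w\<close>;
  tangent vectors of the submanifold \<open>S\<close> are those ambient ones which are velocities of smooth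
  curves in \<open>S\<close>.  Smooth tensor fields on \<open>S\<close> are those which, in ambient charts, extend
  locally to smooth tensor fields of the ambient manifold.
\<close>

definition tangent ::
  "('x \<Rightarrow> ('x, 'w::real_normed_vector) chart) \<Rightarrow> 'x set \<Rightarrow> 'x \<Rightarrow> 'w set" where
  "tangent ch S x =
     {vector_derivative (snd (ch x) \<circ> \<gamma>) (at 0) |\<gamma> e.
        \<gamma> (0::real) = x \<and> e > 0 \<and> (\<forall>t\<in>{-e<..<e}. \<gamma> t \<in> S \<inter> fst (ch x)) \<and>
        smooth_on {-e<..<e} (snd (ch x) \<circ> \<gamma>)}"

text \<open>
  Linear forms on a subspace \<open>T\<close>, as functions which are \<open>undefined\<close> outside \<open>T\<close>.
\<close>

definition dual_space :: "'w::real_normed_vector set \<Rightarrow> ('w \<Rightarrow> real) set" where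
  "dual_space T = {restrict f T |f. linear f}"

type_synonym 'w gvec = "'w \<times> ('w \<Rightarrow> real)"

definition gen_tangent ::
  "('x \<Rightarrow> ('x, 'w::real_normed_vector) chart) \<Rightarrow> 'x set \<Rightarrow> 'x \<Rightarrow> 'w gvec set" where
  "gen_tangent ch S x = tangent ch S x \<times> dual_space (tangent ch S x)"

definition two_form ::
  "('x \<Rightarrow> ('x, 'w::real_normed_vector) chart) \<Rightarrow> 'x set \<Rightarrow> ('x \<Rightarrow> 'w \<Rightarrow> 'w \<Rightarrow> real) \<Rightarrow> bool" where
  "two_form ch S B \<longleftrightarrow>
     (\<forall>x\<in>S. \<forall>u\<in>tangent ch S x. B x u u = 0) \<and>
     (\<forall>x\<in>S. \<exists>W (b :: 'w \<Rightarrow> ('w \<Rightarrow>\<^sub>L 'w \<Rightarrow>\<^sub>L real)). open W \<and> snd (ch x) x \<in> W \<and> smooth_on W b \<and>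
        (\<forall>y\<in>S \<inter> fst (ch x). snd (ch x) y \<in> W \<longrightarrow>
           (\<forall>u\<in>tangent ch S y. \<forall>v\<in>tangent ch S y.
              B y u v = blinfun_apply (blinfun_apply (b (snd (ch x) y)) (jac (ch y) (ch x) y u))
                (jac (ch y) (ch x) y v))))"

definition pre_symplectic ::
  "('x \<Rightarrow> ('x, 'w::real_normed_vector) chart) \<Rightarrow> 'x set \<Rightarrow> ('x \<Rightarrow> 'w \<Rightarrow> 'w \<Rightarrow> real) \<Rightarrow> bool" where
  "pre_symplectic ch S \<omega> \<longleftrightarrow>
     two_form ch S \<omega> \<and>
     (\<forall>x\<in>S. \<forall>u\<in>tangent ch S x. (\<forall>v\<in>tangent ch S x. \<omega> x u v = 0) \<longrightarrow> u = 0)"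

text \<open>
  A 2-vector on \<open>T\<close> is given as an alternating bilinear form on the dual of \<open>T\<close>, its value at
  \<open>(\<alpha>, \<beta>)\<close> being \<open>(\<alpha> \<and> \<beta>)(\<pi>)\<close>.
\<close>

definition two_vector_field ::
  "('x \<Rightarrow> ('x, 'w::real_normed_vector) chart) \<Rightarrow> 'x set \<Rightarrow>
   ('x \<Rightarrow> ('w \<Rightarrow> real) \<Rightarrow> ('w \<Rightarrow> real) \<Rightarrow> real) \<Rightarrow> bool" where
  "two_vector_field ch S \<pi> \<longleftrightarrow>
     (\<forall>x\<in>S. \<forall>\<alpha>\<in>dual_space (tangent ch S x). \<pi> x \<alpha> \<alpha> = 0) \<and>
     (\<forall>x\<in>S. \<exists>W (b :: 'w \<Rightarrow> (('w \<Rightarrow>\<^sub>L real) \<Rightarrow>\<^sub>L ('w \<Rightarrow>\<^sub>L real) \<Rightarrow>\<^sub>L real)).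
        open W \<and> snd (ch x) x \<in> W \<and> smooth_on W b \<and>
        (\<forall>y\<in>S \<inter> fst (ch x). snd (ch x) y \<in> W \<longrightarrow>
           (\<forall>\<alpha> \<beta>. \<pi> y (restrict (blinfun_apply (\<alpha> o\<^sub>L jac (ch y) (ch x) y)) (tangent ch S y))
                       (restrict (blinfun_apply (\<beta> o\<^sub>L jac (ch y) (ch x) y)) (tangent ch S y))
                   = blinfun_apply (blinfun_apply (b (snd (ch x) y)) \<alpha>) \<beta>)))"

definition product_structure ::
  "('x \<Rightarrow> ('x, 'w::real_normed_vector) chart) \<Rightarrow> 'x set \<Rightarrow> ('x \<Rightarrow> 'w \<Rightarrow> 'w) \<Rightarrow> bool" where
  "product_structure ch S P \<longleftrightarrow>
     (\<forall>x\<in>S. (\<forall>u\<in>tangent ch S x. P x u \<in> tangent ch S x \<and> P x (P x u) = u) \<and>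
        (\<exists>u\<in>tangent ch S x. P x u \<noteq> u) \<and> (\<exists>u\<in>tangent ch S x. P x u \<noteq> - u)) \<and>
     (\<forall>x\<in>S. \<exists>W (b :: 'w \<Rightarrow> ('w \<Rightarrow>\<^sub>L 'w)). open W \<and> snd (ch x) x \<in> W \<and> smooth_on W b \<and>
        (\<forall>y\<in>S \<inter> fst (ch x). snd (ch x) y \<in> W \<longrightarrow>
           (\<forall>u\<in>tangent ch S y.
              jac (ch y) (ch x) y (P y u) = blinfun_apply (b (snd (ch x) y)) (jac (ch y) (ch x) y u))))"

text \<open>The special structures and $e^B$ on $T\oplus T^*$.\<close>

definition K_triv :: "'w set \<Rightarrow> 'w gvec \<Rightarrow> 'w gvec" where
  "K_triv T = (\<lambda>(X, \<alpha>). (X, \<lambda>v\<in>T. - \<alpha> v))"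

definition K_omega :: "'w set \<Rightarrow> ('w \<Rightarrow> 'w \<Rightarrow> real) \<Rightarrow> 'w gvec \<Rightarrow> 'w gvec" where
  "K_omega T \<omega> = (\<lambda>(X, \<alpha>). (THE Y. Y \<in> T \<and> (\<forall>v\<in>T. \<omega> Y v = \<alpha> v), \<lambda>v\<in>T. \<omega> X v))"

definition contr :: "'w::real_normed_vector set \<Rightarrow> (('w \<Rightarrow> real) \<Rightarrow> ('w \<Rightarrow> real) \<Rightarrow> real) \<Rightarrow>
    ('w \<Rightarrow> real) \<Rightarrow> 'w" where
  "contr T \<pi> \<alpha> = (THE Y. Y \<in> T \<and> (\<forall>\<beta>\<in>dual_space T. \<beta> Y = \<pi> \<alpha> \<beta>))"

definition K_pi :: "'w::real_normed_vector set \<Rightarrow> (('w \<Rightarrow> real) \<Rightarrow> ('w \<Rightarrow> real) \<Rightarrow> real) \<Rightarrow>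
    'w gvec \<Rightarrow> 'w gvec" where
  "K_pi T \<pi> = (\<lambda>(X, \<alpha>). (X - contr T \<pi> \<alpha>, \<lambda>v\<in>T. - \<alpha> v))"

definition K_prod :: "'w set \<Rightarrow> ('w \<Rightarrow> 'w) \<Rightarrow> 'w gvec \<Rightarrow> 'w gvec" where
  "K_prod T P = (\<lambda>(X, \<alpha>). (P X, \<lambda>v\<in>T. - \<alpha> (P v)))"

definition exp_form :: "'w set \<Rightarrow> ('w \<Rightarrow> 'w \<Rightarrow> real) \<Rightarrow> 'w gvec \<Rightarrow> 'w gvec" where
  "exp_form T B = (\<lambda>(X, \<alpha>). (X, \<lambda>v\<in>T. \<alpha> v + B X v))"

definition B_transform_of ::
  "('x \<Rightarrow> ('x, 'w::real_normed_vector) chart) \<Rightarrow> 'x set \<Rightarrow>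
   ('x \<Rightarrow> 'w gvec \<Rightarrow> 'w gvec) \<Rightarrow> ('x \<Rightarrow> 'w gvec \<Rightarrow> 'w gvec) \<Rightarrow> bool" where
  "B_transform_of ch S \<K> \<K>\<^sub>0 \<longleftrightarrow>
     (\<exists>B. two_form ch S B \<and>
        (\<forall>x\<in>S. \<forall>a\<in>gen_tangent ch S x.
           \<K> x a = exp_form (tangent ch S x) (B x)
             (\<K>\<^sub>0 x (exp_form (tangent ch S x) (\<lambda>u v. - B x u v) a))))"


section \<open>The structures \<open>\<K>\<^sub>\<epsilon>\<close>\<close>

definition P_eps ::
  "('m \<Rightarrow> 'e::real_normed_vector gtv set) \<Rightarrow> nat \<Rightarrow> 'm \<times> 'e gend \<Rightarrow> 'e gend \<Rightarrow> 'e gend" where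
  "P_eps E \<epsilon> x V =
     (let K = snd x;
          P1 = K o\<^sub>L V;
          P2 = Blinfun (\<lambda>a. K (V (pr1 E (fst x) a)) - K (V (a - pr1 E (fst x) a)))
      in if \<epsilon> = 1 then P1 else if \<epsilon> = 2 then P2 else if \<epsilon> = 3 then - P2 else - P1)"

text \<open>
  A tangent vector of the reflector space decomposes as \<open>w = X\<^sup>h + (0, V)\<close> with \<open>X = fst w\<close>, and a
  1-form as \<open>\<xi> = \<alpha>\<^sup>h + \<phi>\<close> with $\alpha(Y)=\xi(Y^h)$ and \<open>\<phi>\<close> vanishing on horizontal vectors.
  The structure maps the sum of these to $(K(X+\alpha))^h+\mathcal P_\varepsilon V-\varphi\circ\mathcal P_\varepsilon$;
  on vertical vectors \<open>\<phi>\<close> coincides with \<open>\<xi>\<close>.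
\<close>

definition K_eps ::
  "('m::topological_space, 'e::euclidean_space) chart set \<Rightarrow> ('m \<Rightarrow> 'e gtv set) \<Rightarrow> ('m, 'e) conn \<Rightarrow>
   nat \<Rightarrow> 'm \<times> 'e gend \<Rightarrow> ('e \<times> 'e gend) gvec \<Rightarrow> ('e \<times> 'e gend) gvec" where
  "K_eps \<A> E D \<epsilon> x = (\<lambda>(w, \<xi>).
     let hl = hlift \<A> E D x;
         vert = (\<lambda>u. snd u - snd (hl (fst u)));
         a = blinfun_apply (snd x) (fst w, Blinfun (\<lambda>Y. \<xi> (hl Y)))
     in (hl (fst a) + (0, P_eps E \<epsilon> x (vert w)),
         \<lambda>u\<in>tangent (end_chart_at \<A>) (reflector_space E) x.
            blinfun_apply (snd a) (fst u) - \<xi> (0, P_eps E \<epsilon> x (vert u))))"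

end

theory Submission
  imports Defs
begin

text \<open>
  The map \<open>e\<^sup>B\<close> fixes all 1-forms and preserves vector parts, and the obstructions to a \<open>B\<close>-transform are
  visible on horizontal vectors and on 1-forms evaluated on horizontal vectors. On horizontal vectors and horizontal 1-forms \<open>\<K>\<^sub>\<epsilon>\<close> at the point \<open>K\<close> of \<open>\<G>\<close> is just \<open>K\<close>,
  whatever \<open>\<epsilon>\<close> is, and \<open>K\<close> can be chosen in the fibre over one point \<open>p\<close>.

  Write \<open>E\<^sub>p = {X + g(X) + \<Theta>(X)}\<close>, so that \<open>E\<^sub>p\<^sup>\<bottom> = {X - g(X) + \<Theta>(X)}\<close>, and let \<open>J : E\<^sub>p \<rightarrow> E\<^sub>p\<^sup>\<bottom>\<close>
  be the bijection which preserves the vector part; it reverses the sign of the pairing. A skew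
  involution \<open>k\<close> of \<open>E\<^sub>p\<close> yields two points of the fibre, equal to \<open>k\<close> on \<open>E\<^sub>p\<close> and to \<open>\<plusminus> J k J\<^sup>-\<^sup>1\<close> on
  \<open>E\<^sub>p\<^sup>\<bottom>\<close> (\<open>paracomplex_pair\<close>). The covectors are the elements \<open>a - J a\<close>, hence the point with the
  plus sign preserves \<open>T\<^sub>p\<^sup>*M\<close> and fixes a nonzero covector, while the one with the minus sign maps
  some covector to an element with nonzero vector part. This is compared with the special
  structures.

  \<^item> For \<open>\<K>\<close> and \<open>\<K>\<^sub>P\<close>, and their \<open>B\<close>-transforms, the vector part of the image of a 1-form is \<open>0\<close>;
    this excludes them at the second point (\<open>not_covector_independent\<close>).
  \<^item> A \<open>B\<close>-transform of \<open>\<K>\<^sub>\<omega>\<close> maps \<open>X + \<iota>\<^sub>X B\<close> to the 1-form \<open>\<omega>(X)\<close>. For a horizontal \<open>X \<noteq> 0\<close> the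
    involution at the first point would map an element outside \<open>T\<^sub>p\<^sup>*M\<close> into \<open>T\<^sub>p\<^sup>*M\<close>, although it
    preserves \<open>T\<^sub>p\<^sup>*M\<close> (\<open>not_symplectic\<close>).
  \<^item> A \<open>B\<close>-transform of \<open>\<K>\<^sub>\<pi>\<close> maps a 1-form whose image is again a 1-form to its negative, but
    the first point fixes a nonzero covector (\<open>not_bivector\<close>).

  What remains is to show that the horizontal lifts exist, are linear, and are tangent to \<open>\<G>\<close>. In a
  chart at \<open>p\<close>, an orthonormal frame adapted to \<open>E \<oplus> E\<^sup>\<bottom>\<close> gives isometries \<open>\<Phi> y\<close> from the generalized
  tangent space at \<open>p\<close> to those at nearby points, which map \<open>E\<^sub>p\<close> to \<open>E\<close> (\<open>adapted_frame\<close>). Relative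
  to it \<open>D = d + A\<close> with \<open>A\<close> skew and preserving \<open>E\<^sub>p\<close> (\<open>D_formula\<close>, \<open>A_skew\<close>, \<open>A_E\<close>), and the lift
  of \<open>X\<close> at \<open>K\<close> is \<open>(X, [d\<Phi>(X) - A(X), K])\<close> (\<open>hlift_formula\<close>). This is the velocity of
  \<open>t \<mapsto> \<Phi> k(t) \<Phi>\<^sup>-\<^sup>1\<close> over a coordinate line, where \<open>k\<close> is a curve in the fibre over \<open>p\<close> with
  velocity \<open>-[A(X), K]\<close>; the curve \<open>k\<close> can be chosen polynomial, by splitting the infinitesimal
  isometry into two summands of square zero (\<open>commutator_nilpotent_split\<close>, \<open>hlift_tangent\<close>).
\<close>

section \<open>Smoothness of germs\<close>

lemma Ck_on_cong:
  "open U \<Longrightarrow> (\<And>x. x \<in> U \<Longrightarrow> f x = g x) \<Longrightarrow> Ck_on k U f \<Longrightarrow> Ck_on k U g"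
proof (induction k arbitrary: f g)
  case 0
  then show ?case using continuous_on_cong by (metis Ck_on.simps(1))
next
  case (Suc k)
  have d: "g differentiable (at x)"
    and e: "frechet_derivative g (at x) = frechet_derivative f (at x)" if "x \<in> U" for x
  proof -
    have f: "f differentiable (at x)" using Suc.prems(3) that by simp
    show "frechet_derivative g (at x) = frechet_derivative f (at x)"
      using frechet_derivative_transform_within_open[OF f Suc.prems(1) that, of g] Suc.prems(2) by simp
    show "g differentiable (at x)"
      using f has_derivative_transform_within_open[OF _ Suc.prems(1) that, of f _ _ g] Suc.prems(2)
      unfolding differentiable_def by blast
  qed
  have "Ck_on k U (\<lambda>x. frechet_derivative g (at x) v)" for v
  proof (rule Suc.IH[OF Suc.prems(1)])
    show "Ck_on k U (\<lambda>x. frechet_derivative f (at x) v)" using Suc.prems(3) by simp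
  qed (simp add: e)
  then show ?case using d by simp
qed

lemma Ck_on_subset: "Ck_on k U f \<Longrightarrow> V \<subseteq> U \<Longrightarrow> Ck_on k V f"
  by (induction k arbitrary: f) (auto intro: continuous_on_subset)

lemma Ck_on_Suc_imp: "Ck_on (Suc k) U f \<Longrightarrow> Ck_on k U f"
proof (induction k arbitrary: f)
  case 0
  then show ?case
    by (auto intro!: continuous_at_imp_continuous_on differentiable_imp_continuous_within)
next
  case (Suc k)
  have "Ck_on k U (\<lambda>x. frechet_derivative f (at x) v)" for v
    using Suc.IH[of "\<lambda>x. frechet_derivative f (at x) v"] Suc.prems by (metis Ck_on.simps(2))
  then show ?case using Suc.prems by simp
qed

lemma Ck_on_has_derivative:
  "Ck_on (Suc k) U f \<Longrightarrow> x \<in> U \<Longrightarrow> (f has_derivative frechet_derivative f (at x)) (at x)"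
  using frechet_derivative_works by auto

lemma Ck_on_SucI:
  assumes "open U" "\<And>x. x \<in> U \<Longrightarrow> (f has_derivative f' x) (at x)"
    and "\<And>v. Ck_on k U (\<lambda>x. f' x v)"
  shows "Ck_on (Suc k) U f"
proof -
  have "f differentiable (at x)" if "x \<in> U" for x
    using assms(2)[OF that] unfolding differentiable_def by blast
  moreover have "Ck_on k U (\<lambda>x. frechet_derivative f (at x) v)" for v
    by (rule Ck_on_cong[OF assms(1) _ assms(3)[of v]])
       (use frechet_derivative_at[OF assms(2)] in simp)
  ultimately show ?thesis by simp
qed

lemma Ck_on_const: "Ck_on k U (\<lambda>x. c)"
  by (induction k arbitrary: c) auto

lemma Ck_on_linear_compose:
  assumes "bounded_linear L" "open U"
  shows "Ck_on k U f \<Longrightarrow> Ck_on k U (\<lambda>x. L (f x))"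
proof (induction k arbitrary: f)
  case 0
  then show ?case using bounded_linear.continuous_on[OF assms(1)] by simp
next
  case (Suc k)
  show ?case
  proof (rule Ck_on_SucI[OF assms(2)])
    show "((\<lambda>x. L (f x)) has_derivative (\<lambda>v. L (frechet_derivative f (at x) v))) (at x)" if "x \<in> U" for x
      using bounded_linear.has_derivative[OF assms(1)] Ck_on_has_derivative[OF Suc.prems that] by blast
    show "Ck_on k U (\<lambda>x. L (frechet_derivative f (at x) v))" for v
      using Suc by simp
  qed
qed

lemma Ck_on_ident: "open U \<Longrightarrow> Ck_on k U (\<lambda>x. x)"
proof (cases k)
  case (Suc j)
  assume U: "open U"
  show ?thesis unfolding Suc
    by (rule Ck_on_SucI[OF U, of _ "\<lambda>x v. v"]) (auto intro: Ck_on_const)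
qed (simp add: continuous_on_id)

lemma Ck_on_add:
  assumes "open U"
  shows "Ck_on k U f \<Longrightarrow> Ck_on k U g \<Longrightarrow> Ck_on k U (\<lambda>x. f x + g x)"
proof (induction k arbitrary: f g)
  case (Suc k)
  show ?case
  proof (rule Ck_on_SucI[OF assms])
    show "((\<lambda>x. f x + g x) has_derivative
        (\<lambda>v. frechet_derivative f (at x) v + frechet_derivative g (at x) v)) (at x)" if "x \<in> U" for x
      by (rule has_derivative_add[OF Ck_on_has_derivative[OF Suc.prems(1) that]
            Ck_on_has_derivative[OF Suc.prems(2) that]])
    show "Ck_on k U (\<lambda>x. frechet_derivative f (at x) v + frechet_derivative g (at x) v)" for v
      using Suc by simp
  qed
qed (simp add: continuous_on_add)

lemma Ck_on_bilinear:
  assumes "bounded_bilinear h" "open U"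
  shows "Ck_on k U f \<Longrightarrow> Ck_on k U g \<Longrightarrow> Ck_on k U (\<lambda>x. h (f x) (g x))"
proof (induction k arbitrary: f g)
  case 0
  then show ?case using bounded_bilinear.continuous_on[OF assms(1)] by simp
next
  case (Suc k)
  show ?case
  proof (rule Ck_on_SucI[OF assms(2)])
    show "((\<lambda>x. h (f x) (g x)) has_derivative
        (\<lambda>v. h (f x) (frechet_derivative g (at x) v) + h (frechet_derivative f (at x) v) (g x))) (at x)"
      if "x \<in> U" for x
      by (rule bounded_bilinear.FDERIV[OF assms(1) Ck_on_has_derivative[OF Suc.prems(1) that]
            Ck_on_has_derivative[OF Suc.prems(2) that]])
    show "Ck_on k U (\<lambda>x. h (f x) (frechet_derivative g (at x) v)
        + h (frechet_derivative f (at x) v) (g x))" for v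
      using Suc.prems Suc.prems[THEN Ck_on_Suc_imp] by (intro Ck_on_add[OF assms(2)] Suc.IH) simp_all
  qed
qed

text \<open>The derivative of \<open>\<phi>(f)\<close> for \<open>\<phi>(z) = z\<^sup>-\<^sup>1\<^sup>/\<^sup>2\<close> is \<open>-1/2 \<phi>(f)\<^sup>3 df\<close>, a polynomial in \<open>\<phi>(f)\<close>
  and \<open>df\<close>, so one induction on the order suffices. With sums and products this one function covers all that
  the normalization of frames requires.\<close>

lemma Ck_on_inverse_sqrt:
  assumes "open U"
  shows "Ck_on k U f \<Longrightarrow> (\<And>x. x \<in> U \<Longrightarrow> f x > 0) \<Longrightarrow> Ck_on k U (\<lambda>x. inverse (sqrt (f x)))"
proof (induction k arbitrary: f)
  case 0
  then have "\<forall>x\<in>U. sqrt (f x) \<noteq> 0" by (metis less_irrefl real_sqrt_eq_zero_cancel_iff)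
  with 0 show ?case by (simp add: continuous_on_inverse continuous_on_real_sqrt)
next
  case (Suc k)
  let ?g = "\<lambda>x. inverse (sqrt (f x))"
  have IH: "Ck_on k U ?g" by (rule Suc.IH[OF Ck_on_Suc_imp[OF Suc.prems(1)] Suc.prems(2)])
  show ?case
  proof (rule Ck_on_SucI[OF assms])
    fix x assume x: "x \<in> U"
    have pos: "f x > 0" using Suc.prems(2)[OF x] .
    have "((\<lambda>z. inverse (sqrt z)) has_real_derivative
        - (?g x * (?g x / 2) * ?g x)) (at (f x))"
      using DERIV_inverse'[OF DERIV_real_sqrt[OF pos]] pos by simp
    from DERIV_compose_FDERIV[OF this Ck_on_has_derivative[OF Suc.prems(1) x]]
    show "(?g has_derivative (\<lambda>v. (- 1 / 2) *
        (frechet_derivative f (at x) v * (?g x * (?g x * ?g x))))) (at x)"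
      by (rule has_derivative_eq_rhs) (simp add: fun_eq_iff)
  next
    fix v
    show "Ck_on k U (\<lambda>x. (- 1 / 2) * (frechet_derivative f (at x) v * (?g x * (?g x * ?g x))))"
      using Suc.prems(1)
      by (intro Ck_on_bilinear[OF bounded_bilinear_mult assms] Ck_on_const IH) simp
  qed
qed

lemma Ck_on_line:
  fixes z w :: "'a::real_normed_vector"
  assumes "open W"
  shows "Ck_on k W f \<Longrightarrow> Ck_on k ((\<lambda>t::real. z + t *\<^sub>R w) -` W) (\<lambda>t. f (z + t *\<^sub>R w))"
proof (induction k arbitrary: f)
  case 0
  have "continuous_on ((\<lambda>t::real. z + t *\<^sub>R w) -` W) (f \<circ> (\<lambda>t. z + t *\<^sub>R w))"
    by (rule continuous_on_compose) (use 0 in \<open>auto intro!: continuous_intros elim: continuous_on_subset\<close>)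
  then show ?case by (simp add: o_def)
next
  case (Suc k)
  let ?l = "\<lambda>t::real. z + t *\<^sub>R w"
  have op: "open (?l -` W)" by (rule open_vimage[OF assms]) (intro continuous_intros)
  show ?case
  proof (rule Ck_on_SucI[OF op])
    fix t assume t: "t \<in> ?l -` W"
    have d: "(f has_derivative frechet_derivative f (at (?l t))) (at (?l t))"
      using Ck_on_has_derivative[OF Suc.prems] t by simp
    have "(?l has_derivative (\<lambda>s. s *\<^sub>R w)) (at t)" by (auto intro!: derivative_eq_intros)
    from has_derivative_compose[OF this d]
    show "((\<lambda>t. f (?l t)) has_derivative (\<lambda>s. s *\<^sub>R frechet_derivative f (at (?l t)) w)) (at t)"
      using has_derivative_linear[OF d] by (simp add: linear_cmul)
  next
    fix s :: real
    show "Ck_on k (?l -` W) (\<lambda>t. s *\<^sub>R frechet_derivative f (at (?l t)) w)"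
      using Ck_on_linear_compose[OF bounded_linear_scaleR_right op]
        Suc.IH[of "\<lambda>x. frechet_derivative f (at x) w"] Suc.prems by simp
  qed
qed

text \<open>Frames and sections exist only near a point and the size of the neighbourhood never matters;
  speaking of germs avoids shrinking neighbourhoods by hand.\<close>

definition smooth_at :: "'a::real_normed_vector \<Rightarrow> ('a \<Rightarrow> 'b::real_normed_vector) \<Rightarrow> bool" where
  "smooth_at z f \<longleftrightarrow> (\<exists>W. open W \<and> z \<in> W \<and> smooth_on W f)"

lemma smooth_at_cong:
  assumes "smooth_at z f" "eventually (\<lambda>x. f x = g x) (nhds z)"
  shows "smooth_at z g"
proof -
  obtain W V where W: "open W" "z \<in> W" "smooth_on W f" and V: "open V" "z \<in> V" "\<And>x. x \<in> V \<Longrightarrow> f x = g x"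
    using assms unfolding smooth_at_def eventually_nhds by blast
  have "Ck_on k (W \<inter> V) g" for k
  proof (rule Ck_on_cong[of _ f])
    show "open (W \<inter> V)" using W V by blast
    show "Ck_on k (W \<inter> V) f" using W(3) Ck_on_subset unfolding smooth_on_def by blast
  qed (use V in auto)
  then show ?thesis
    unfolding smooth_at_def smooth_on_def
    using W(1,2) V(1,2) by (intro exI[of _ "W \<inter> V"]) (simp add: open_Int)
qed

lemma smooth_at_unary:
  assumes "smooth_at z f"
    and "\<And>U k. open U \<Longrightarrow> Ck_on k U f \<Longrightarrow> Ck_on k U g"
  shows "smooth_at z g"
proof -
  obtain U where "open U" "z \<in> U" "smooth_on U f" using assms(1) unfolding smooth_at_def by blast
  then show ?thesis
    using assms(2)[of U] unfolding smooth_at_def smooth_on_def by (intro exI[of _ U]) simp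
qed

lemma smooth_at_binary:
  assumes "smooth_at z f" "smooth_at z g"
    and "\<And>U k. open U \<Longrightarrow> Ck_on k U f \<Longrightarrow> Ck_on k U g \<Longrightarrow> Ck_on k U h"
  shows "smooth_at z h"
proof -
  obtain U V where *: "open U" "z \<in> U" "smooth_on U f" "open V" "z \<in> V" "smooth_on V g"
    using assms(1,2) unfolding smooth_at_def by blast
  have "Ck_on k (U \<inter> V) h" for k
  proof (rule assms(3))
    show "Ck_on k (U \<inter> V) f" "Ck_on k (U \<inter> V) g"
      using *(3,6) Ck_on_subset[of k U f "U \<inter> V"] Ck_on_subset[of k V g "U \<inter> V"]
      unfolding smooth_on_def by simp_all
  qed (use * in auto)
  then have "smooth_on (U \<inter> V) h" unfolding smooth_on_def by blast
  then show ?thesis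
    unfolding smooth_at_def using *(1,2,4,5) by (intro exI[of _ "U \<inter> V"]) (simp add: open_Int)
qed

lemma smooth_at_const: "smooth_at z (\<lambda>x. c)"
  unfolding smooth_at_def smooth_on_def by (auto intro!: exI[of _ UNIV] Ck_on_const)

lemma smooth_at_ident: "smooth_at z (\<lambda>x. x)"
  unfolding smooth_at_def smooth_on_def by (auto intro!: exI[of _ UNIV] Ck_on_ident)

lemma smooth_at_add: "smooth_at z f \<Longrightarrow> smooth_at z g \<Longrightarrow> smooth_at z (\<lambda>x. f x + g x)"
  by (erule smooth_at_binary, assumption) (rule Ck_on_add)

lemma smooth_at_bilinear:
  "bounded_bilinear h \<Longrightarrow> smooth_at z f \<Longrightarrow> smooth_at z g \<Longrightarrow> smooth_at z (\<lambda>x. h (f x) (g x))"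
  by (erule (1) smooth_at_binary) (rule Ck_on_bilinear)

lemma smooth_at_linear: "bounded_linear L \<Longrightarrow> smooth_at z f \<Longrightarrow> smooth_at z (\<lambda>x. L (f x))"
  by (erule smooth_at_unary) (rule Ck_on_linear_compose)

lemma smooth_at_scaleR:
  "smooth_at z f \<Longrightarrow> smooth_at z g \<Longrightarrow> smooth_at z (\<lambda>x. f x *\<^sub>R g x)"
  by (rule smooth_at_bilinear[OF bounded_bilinear_scaleR])

lemma smooth_at_diff: "smooth_at z f \<Longrightarrow> smooth_at z g \<Longrightarrow> smooth_at z (\<lambda>x. f x - g x)"
  using smooth_at_add[OF _ smooth_at_linear[OF bounded_linear_minus[OF bounded_linear_ident]], of z f g]
  by simp

lemma smooth_at_sum:
  "(\<And>i. i \<in> I \<Longrightarrow> smooth_at z (f i)) \<Longrightarrow> smooth_at z (\<lambda>x. \<Sum>i\<in>I. f i x)"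
  by (induction I rule: infinite_finite_induct) (simp_all add: smooth_at_const smooth_at_add)

lemma smooth_at_has_derivative:
  "smooth_at z f \<Longrightarrow> (f has_derivative frechet_derivative f (at z)) (at z)"
  unfolding smooth_at_def smooth_on_def by (elim exE conjE) (rule Ck_on_has_derivative[of 0], blast)

lemma smooth_at_tendsto: "smooth_at z f \<Longrightarrow> (f \<longlongrightarrow> f z) (nhds z)"
  using has_derivative_continuous[OF smooth_at_has_derivative, of z f]
  unfolding isCont_def tendsto_at_iff_tendsto_nhds by blast

lemma smooth_at_inverse_sqrt:
  assumes "smooth_at z f" "f z > 0"
  shows "smooth_at z (\<lambda>x. inverse (sqrt (f x)))"
proof -
  obtain U where U: "open U" "z \<in> U" "smooth_on U f" using assms(1) unfolding smooth_at_def by blast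
  have "eventually (\<lambda>x. f x > 0) (nhds z)"
    using order_tendstoD(1)[OF smooth_at_tendsto[OF assms(1)] assms(2)] .
  then obtain V where V: "open V" "z \<in> V" "\<And>x. x \<in> V \<Longrightarrow> f x > 0"
    unfolding eventually_nhds by blast
  have "smooth_on (U \<inter> V) (\<lambda>x. inverse (sqrt (f x)))"
    unfolding smooth_on_def
  proof (intro allI Ck_on_inverse_sqrt)
    show "Ck_on k (U \<inter> V) f" for k
      using U(3) Ck_on_subset unfolding smooth_on_def by blast
  qed (use U V in auto)
  then show ?thesis
    unfolding smooth_at_def using U(1,2) V(1,2) by (intro exI[of _ "U \<inter> V"]) (simp add: open_Int)
qed

lemma smooth_at_line:
  assumes "smooth_at z f"
  shows "smooth_at 0 (\<lambda>t::real. f (z + t *\<^sub>R w))"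
proof -
  obtain U where U: "open U" "z \<in> U" "smooth_on U f" using assms(1) unfolding smooth_at_def by blast
  have "open ((\<lambda>t::real. z + t *\<^sub>R w) -` U)"
    by (rule open_vimage[OF U(1)]) (intro continuous_intros)
  then show ?thesis
    using U(2,3) unfolding smooth_at_def smooth_on_def
    by (intro exI[of _ "(\<lambda>t::real. z + t *\<^sub>R w) -` U"] conjI allI Ck_on_line[OF U(1)]) simp_all
qed

lemma smooth_at_Pair:
  assumes "smooth_at z f" "smooth_at z g"
  shows "smooth_at z (\<lambda>x. (f x, g x))"
proof -
  have "bounded_linear (\<lambda>a. (a, 0))" "bounded_linear (\<lambda>b. (0, b))"
    by (intro bounded_linear_Pair bounded_linear_ident bounded_linear_zero)+
  from smooth_at_add[OF smooth_at_linear[OF this(1) assms(1)] smooth_at_linear[OF this(2) assms(2)]]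
  show ?thesis by simp
qed

lemma frechet_derivative_transform_eventually:
  assumes "eventually (\<lambda>x. f x = g x) (nhds z)"
  shows "frechet_derivative f (at z) = frechet_derivative g (at z)"
proof -
  have f: "f z = g z" and e: "eventually (\<lambda>x. f x = g x) (at z)"
    using assms unfolding eventually_nhds_conv_at by blast+
  have e': "eventually (\<lambda>x. g x = f x) (at z)" using e by (rule eventually_mono) simp
  have "(f has_derivative D) (at z) \<longleftrightarrow> (g has_derivative D) (at z)" for D
    using has_derivative_transform_eventually[OF _ e f UNIV_I, of D]
      has_derivative_transform_eventually[OF _ e' f[symmetric] UNIV_I, of D] by blast
  then show ?thesis unfolding frechet_derivative_def by simp
qed

section \<open>Orthonormal families for indefinite forms\<close>

lemma in_span_image_imp_sum:
  assumes "finite I" "x \<in> span (f ` I)"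
  obtains c where "x = (\<Sum>i\<in>I. c i *\<^sub>R f i)"
proof -
  obtain u where u: "x = (\<Sum>v\<in>f ` I. u v *\<^sub>R v)"
    using assms span_finite[of "f ` I"] by auto
  define g where "g v = (SOME i. i \<in> I \<and> f i = v)" for v
  have g: "g v \<in> I \<and> f (g v) = v" if "v \<in> f ` I" for v
    unfolding g_def by (rule someI_ex) (use that in auto)
  have inj: "inj_on g (f ` I)" by (metis g inj_onI)
  have "(\<Sum>v\<in>f ` I. u v *\<^sub>R v) = (\<Sum>v\<in>f ` I. u (f (g v)) *\<^sub>R f (g v))"
    by (rule sum.cong) (simp_all add: g)
  also have "\<dots> = (\<Sum>i\<in>g ` f ` I. u (f i) *\<^sub>R f i)" by (simp add: sum.reindex[OF inj])
  also have "\<dots> = (\<Sum>i\<in>I. (if i \<in> g ` f ` I then u (f i) else 0) *\<^sub>R f i)"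
    by (rule sum.mono_neutral_cong_left[OF assms(1)]) (use g in blast, simp_all)
  finally have "x = (\<Sum>i\<in>I. (if i \<in> g ` f ` I then u (f i) else 0) *\<^sub>R f i)" unfolding u .
  then show thesis by (rule that)
qed

text \<open>The form may be indefinite. Families are indexed by an initial segment of the naturals because
  Gram-Schmidt orthonormalization proceeds in that order.\<close>

locale symmetric_form = bounded_bilinear h
  for h :: "'v::real_normed_vector \<Rightarrow> 'v \<Rightarrow> real" +
  assumes sym: "h a b = h b a"
begin

text \<open>The signs \<open>\<epsilon> i = \<plusminus>1\<close> are characterized by \<open>\<epsilon> i * \<epsilon> i = 1\<close>, which is the form in which they cancel
  in computations.\<close>

definition orthonormal :: "(nat \<Rightarrow> real) \<Rightarrow> nat \<Rightarrow> (nat \<Rightarrow> 'v) \<Rightarrow> bool" where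
  "orthonormal \<epsilon> m b \<longleftrightarrow>
     (\<forall>i<m. \<epsilon> i * \<epsilon> i = 1) \<and> (\<forall>i<m. \<forall>j<m. h (b i) (b j) = (if i = j then \<epsilon> i else 0))"

lemma orthonormal_sign: "orthonormal \<epsilon> m b \<Longrightarrow> i < m \<Longrightarrow> \<epsilon> i * \<epsilon> i = 1"
  unfolding orthonormal_def by blast

lemma orthonormal_form:
  "orthonormal \<epsilon> m b \<Longrightarrow> i < m \<Longrightarrow> j < m \<Longrightarrow> h (b i) (b j) = (if i = j then \<epsilon> i else 0)"
  unfolding orthonormal_def by blast

lemma orthonormal_sum:
  assumes "orthonormal \<epsilon> m b" "j < m"
  shows "h (\<Sum>i<m. c i *\<^sub>R b i) (b j) = c j * \<epsilon> j"
proof -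
  have "h (\<Sum>i<m. c i *\<^sub>R b i) (b j) = (\<Sum>i<m. c i * (if i = j then \<epsilon> i else 0))"
    by (simp add: sum_left scaleR_left orthonormal_form[OF assms(1) _ assms(2)])
  also have "\<dots> = (\<Sum>i<m. if i = j then c i * \<epsilon> i else 0)" by (intro sum.cong) auto
  finally show ?thesis using assms(2) by simp
qed

lemma orthonormal_expand:
  assumes "orthonormal \<epsilon> m b" "a \<in> span (b ` {..<m})"
  shows "a = (\<Sum>i<m. (\<epsilon> i * h a (b i)) *\<^sub>R b i)"
proof -
  obtain c where c: "a = (\<Sum>i<m. c i *\<^sub>R b i)"
    using in_span_image_imp_sum[OF finite_lessThan assms(2)] by blast
  have "\<epsilon> i * h a (b i) = c i" if "i < m" for i
  proof -
    have "\<epsilon> i * \<epsilon> i = 1" by (rule orthonormal_sign[OF assms(1) that])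
    then show ?thesis using orthonormal_sum[OF assms(1) that, of c] unfolding c[symmetric] by simp
  qed
  then show ?thesis using c by simp
qed

lemma orthonormal_inj:
  assumes "orthonormal \<epsilon> m b"
  shows "inj_on b {..<m}"
proof (rule inj_onI)
  fix i j assume ij: "i \<in> {..<m}" "j \<in> {..<m}" "b i = b j"
  have "h (b i) (b i) = (if i = j then \<epsilon> i else 0)"
    using orthonormal_form[OF assms, of i j] ij by simp
  moreover have "h (b i) (b i) = \<epsilon> i" using orthonormal_form[OF assms, of i i] ij by simp
  moreover have "\<epsilon> i * \<epsilon> i = 1" using orthonormal_sign[OF assms, of i] ij by simp
  ultimately show "i = j" by (cases "i = j") auto
qed

lemma orthonormal_card:
  "orthonormal \<epsilon> m b \<Longrightarrow> card (b ` {..<m}) = m"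
  using card_image[OF orthonormal_inj] by fastforce

lemma orthonormal_independent:
  assumes "orthonormal \<epsilon> m b"
  shows "independent (b ` {..<m})"
proof (rule independent_if_scalars_zero)
  fix f v assume s: "(\<Sum>v\<in>b ` {..<m}. f v *\<^sub>R v) = 0" and v: "v \<in> b ` {..<m}"
  then obtain j where j: "j < m" "v = b j" by blast
  have "(\<Sum>i<m. f (b i) *\<^sub>R b i) = 0" using s unfolding sum.reindex[OF orthonormal_inj[OF assms]] o_def .
  then have "f v * \<epsilon> j = 0" using orthonormal_sum[OF assms j(1), of "\<lambda>i. f (b i)"] j zero_left by simp
  moreover have "\<epsilon> j * \<epsilon> j = 1" by (rule orthonormal_sign[OF assms j(1)])
  ultimately show "f v = 0" by auto
qed simp

text \<open>An orthonormal family is independent, so it spans as soon as it has as many members as a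
  spanning set; this passes spanning properties from one point of a family to nearby points.\<close>

lemma orthonormal_spans:
  assumes "orthonormal \<epsilon> m b" "finite T" "card T \<le> m" "b ` {..<m} \<subseteq> span T"
  shows "span (b ` {..<m}) = span T"
proof -
  have indep: "independent (b ` {..<m})" using orthonormal_independent[OF assms(1)] .
  have "T \<subseteq> span (b ` {..<m})"
  proof
    fix x assume x: "x \<in> T"
    show "x \<in> span (b ` {..<m})"
    proof (rule ccontr)
      assume n: "x \<notin> span (b ` {..<m})"
      then have "independent (insert x (b ` {..<m}))" using independent_insertI indep by blast
      moreover have "insert x (b ` {..<m}) \<subseteq> span T" using x assms(4) span_base by blast
      ultimately have "card (insert x (b ` {..<m})) \<le> card T"
        by (rule independent_span_bound[OF assms(2), THEN conjunct2])
      moreover have "x \<notin> b ` {..<m}" by (rule contra_subsetD[OF span_superset n])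
      ultimately show False using assms(3) orthonormal_card[OF assms(1)] by simp
    qed
  qed
  then show ?thesis
    using span_minimal[OF assms(4) subspace_span] span_minimal[OF _ subspace_span] by (intro equalityI)
qed

lemma orthonormal_cong:
  assumes "orthonormal \<epsilon> m b" "\<And>i. i < m \<Longrightarrow> b i = b' i" "\<And>i. i < m \<Longrightarrow> \<epsilon> i = \<epsilon>' i"
  shows "orthonormal \<epsilon>' m b'"
  using assms unfolding orthonormal_def by metis

lemma orthonormal_append:
  assumes "orthonormal \<epsilon> m b" "orthonormal \<epsilon>' k b'"
    and perp: "\<And>i j. i < m \<Longrightarrow> j < k \<Longrightarrow> h (b i) (b' j) = 0"
  shows "orthonormal (\<lambda>i. if i < m then \<epsilon> i else \<epsilon>' (i - m)) (m + k)
           (\<lambda>i. if i < m then b i else b' (i - m))"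
  unfolding orthonormal_def
proof (intro conjI allI impI)
  fix i j assume ij: "i < m + k" "j < m + k"
  then have i: "i < m \<or> m \<le> i \<and> i - m < k" and j: "j < m \<or> m \<le> j \<and> j - m < k" by auto
  have perp': "h (b' j) (b i) = 0" if "i < m" "j < k" for i j using perp[OF that] sym by metis
  show "h (if i < m then b i else b' (i - m)) (if j < m then b j else b' (j - m)) =
      (if i = j then if i < m then \<epsilon> i else \<epsilon>' (i - m) else 0)"
    using i j orthonormal_form[OF assms(1)] orthonormal_form[OF assms(2)] perp perp' by auto
next
  fix i assume "i < m + k"
  then show "(if i < m then \<epsilon> i else \<epsilon>' (i - m)) * (if i < m then \<epsilon> i else \<epsilon>' (i - m)) = 1"
    using orthonormal_sign[OF assms(1), of i] orthonormal_sign[OF assms(2), of "i - m"] by auto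
qed

lemma orthonormal_SucI:
  assumes "orthonormal \<epsilon> m b" "\<epsilon> m * \<epsilon> m = 1" "h (b m) (b m) = \<epsilon> m"
    and "\<And>j. j < m \<Longrightarrow> h (b m) (b j) = 0"
  shows "orthonormal \<epsilon> (Suc m) b"
proof -
  have "h (b j) (b m) = 0" if "j < m" for j using assms(4)[OF that] sym by metis
  then show ?thesis using assms unfolding orthonormal_def by (auto simp: less_Suc_eq)
qed

lemma orthogonal_residue:
  assumes "orthonormal \<epsilon> m b" "j < m"
  shows "h (a - (\<Sum>i<m. (\<epsilon> i * h a (b i)) *\<^sub>R b i)) (b j) = 0"
proof -
  have "\<epsilon> j * \<epsilon> j = 1" by (rule orthonormal_sign[OF assms])
  then show ?thesis
    using orthonormal_sum[OF assms, of "\<lambda>i. \<epsilon> i * h a (b i)"] by (simp add: diff_left algebra_simps)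
qed

lemma normalized:
  assumes "\<epsilon> * \<epsilon> = 1" "\<epsilon> * h v v > 0"
  shows "h (inverse (sqrt (\<epsilon> * h v v)) *\<^sub>R v) (inverse (sqrt (\<epsilon> * h v v)) *\<^sub>R v) = \<epsilon>"
proof -
  let ?q = "\<epsilon> * h v v"
  have "h (inverse (sqrt ?q) *\<^sub>R v) (inverse (sqrt ?q) *\<^sub>R v)
      = inverse (sqrt ?q) * inverse (sqrt ?q) * (\<epsilon> * ?q)"
    using assms(1) by (simp add: scaleR_left scaleR_right mult.assoc[symmetric])
  also have "inverse (sqrt ?q) * inverse (sqrt ?q) = inverse ?q"
    using assms(2) by (metis inverse_mult_distrib less_imp_le real_sqrt_mult_self abs_of_pos)
  also have "inverse ?q * (\<epsilon> * ?q) = \<epsilon>"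
    using assms(2) by (metis left_inverse less_irrefl mult.left_commute mult.right_neutral)
  finally show ?thesis .
qed

text \<open>Gram-Schmidt, adding one vector at a time as long as the dimension is not exhausted. The sign
  \<open>c\<close> covers both the positive and the negative definite case.\<close>

lemma definite_orthonormal_basis:
  assumes P: "subspace P" and c: "c * c = 1" and def: "\<And>u. u \<in> P \<Longrightarrow> u \<noteq> 0 \<Longrightarrow> c * h u u > 0"
    and fin: "dim P > 0"
  obtains b where "orthonormal (\<lambda>_. c) (dim P) b" "span (b ` {..<dim P}) = P"
proof -
  have "\<exists>b. orthonormal (\<lambda>_. c) m b \<and> b ` {..<m} \<subseteq> P" if "m \<le> dim P" for m
    using that
  proof (induction m)
    case 0
    then show ?case unfolding orthonormal_def by simp
  next
    case (Suc m)
    then obtain b where b: "orthonormal (\<lambda>_. c) m b" "b ` {..<m} \<subseteq> P" by auto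
    \<comment> \<open>fewer than \<open>dim P\<close> vectors cannot span, so there is a vector whose residue is nonzero\<close>
    have "\<not> P \<subseteq> span (b ` {..<m})"
      using dim_le_card[of P "b ` {..<m}"] Suc.prems orthonormal_card[OF b(1)] by auto
    then obtain a where a: "a \<in> P" "a \<notin> span (b ` {..<m})" by blast
    define v where "v = a - (\<Sum>i<m. (c * h a (b i)) *\<^sub>R b i)"
    have "(\<Sum>i<m. (c * h a (b i)) *\<^sub>R b i) \<in> span (b ` {..<m})"
      by (intro span_sum span_scale span_base) auto
    then have "v \<noteq> 0" using a(2) unfolding v_def by auto
    have "v \<in> P" unfolding v_def using a(1) b(2) P
      by (intro subspace_diff subspace_sum subspace_scale) auto
    then have pos: "c * h v v > 0" using def \<open>v \<noteq> 0\<close> by blast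
    define u where "u = inverse (sqrt (c * h v v)) *\<^sub>R v"
    have "h u (b j) = 0" if "j < m" for j
      using orthogonal_residue[OF b(1) that, of a] unfolding u_def v_def by (simp add: scaleR_left)
    moreover have "h u u = c" unfolding u_def by (rule normalized[OF c pos])
    moreover have "orthonormal (\<lambda>_. c) m (b(m := u))" by (rule orthonormal_cong[OF b(1)]) auto
    ultimately have "orthonormal (\<lambda>_. c) (Suc m) (b(m := u))"
      using c by (intro orthonormal_SucI) auto
    moreover have "u \<in> P" unfolding u_def using P \<open>v \<in> P\<close> by (rule subspace_scale)
    then have "(b(m := u)) ` {..<Suc m} \<subseteq> P" using b(2) by (auto simp: less_Suc_eq)
    ultimately show ?case by blast
  qed
  then obtain b where b: "orthonormal (\<lambda>_. c) (dim P) b" "b ` {..<dim P} \<subseteq> P" by blast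
  obtain B where B: "B \<subseteq> P" "independent B" "P \<subseteq> span B" "card B = dim P" by (rule basis_exists)
  have "finite B" using B(4) fin by (metis card.infinite less_irrefl)
  have "span (b ` {..<dim P}) = span B"
    by (rule orthonormal_spans[OF b(1) \<open>finite B\<close>]) (use B b in auto)
  moreover have "span B = P" using B P span_minimal by blast
  ultimately show thesis using b(1) that by simp
qed

text \<open>Gram-Schmidt depends smoothly on its input. For an indefinite form the procedure may break down
  at null vectors, but the family is orthonormal at the base point: there the residue \<open>v\<close> is a unit
  vector with sign \<open>\<epsilon> m\<close>, so \<open>\<epsilon> m * h v v\<close>, whose root is divided by, is positive nearby.\<close>

lemma smooth_orthonormalization:
  fixes w :: "nat \<Rightarrow> 'x::real_normed_vector \<Rightarrow> 'v"
  assumes "orthonormal \<epsilon> m (\<lambda>i. w i z)" "\<And>i. i < m \<Longrightarrow> smooth_at z (w i)"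
  shows "\<exists>u. (\<forall>i<m. smooth_at z (u i) \<and> u i z = w i z) \<and>
     (\<forall>\<^sub>F y in nhds z. orthonormal \<epsilon> m (\<lambda>i. u i y) \<and>
        (\<forall>i<m. u i y \<in> span ((\<lambda>j. w j y) ` {..i})))"
  using assms
proof (induction m)
  case 0
  then show ?case by (auto simp: orthonormal_def)
next
  case (Suc m)
  have o: "orthonormal \<epsilon> m (\<lambda>i. w i z)" using Suc.prems(1) unfolding orthonormal_def by simp
  obtain u where u: "\<And>i. i < m \<Longrightarrow> smooth_at z (u i)" "\<And>i. i < m \<Longrightarrow> u i z = w i z"
    and ev: "\<forall>\<^sub>F y in nhds z. orthonormal \<epsilon> m (\<lambda>i. u i y) \<and>
        (\<forall>i<m. u i y \<in> span ((\<lambda>j. w j y) ` {..i}))"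
    using Suc.IH[OF o] Suc.prems(2) by auto
  have em: "\<epsilon> m * \<epsilon> m = 1" "h (w m z) (w m z) = \<epsilon> m" "\<And>i. i < m \<Longrightarrow> h (w m z) (w i z) = 0"
    using Suc.prems(1) unfolding orthonormal_def by auto
  define v where "v y = w m y - (\<Sum>i<m. (\<epsilon> i * h (w m y) (u i y)) *\<^sub>R u i y)" for y
  define q where "q y = \<epsilon> m * h (v y) (v y)" for y
  define e where "e y = inverse (sqrt (q y)) *\<^sub>R v y" for y
  have vz: "v z = w m z" unfolding v_def using u(2) em(3) by simp
  have qz: "q z = 1" unfolding q_def vz using em by simp
  have sv: "smooth_at z v"
    unfolding v_def using u(1) Suc.prems(2) bounded_bilinear_axioms
    by (intro smooth_at_diff smooth_at_sum smooth_at_scaleR smooth_at_bilinear[OF bounded_bilinear_mult]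
        smooth_at_const smooth_at_bilinear[of h]) auto
  have sq: "smooth_at z q"
    unfolding q_def
    by (intro smooth_at_bilinear[OF bounded_bilinear_mult] smooth_at_const
        smooth_at_bilinear[OF bounded_bilinear_axioms] sv)
  have se: "smooth_at z e"
    unfolding e_def by (intro smooth_at_scaleR smooth_at_inverse_sqrt sq sv) (simp add: qz)
  have qpos: "\<forall>\<^sub>F y in nhds z. q y > 0"
    using order_tendstoD(1)[OF smooth_at_tendsto[OF sq], of 0] qz by simp
  let ?u = "u(m := e)"
  have "\<forall>\<^sub>F y in nhds z. orthonormal \<epsilon> (Suc m) (\<lambda>i. ?u i y) \<and>
        (\<forall>i<Suc m. ?u i y \<in> span ((\<lambda>j. w j y) ` {..i}))"
    using ev qpos
  proof eventually_elim
    case (elim y)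
    then have ou: "orthonormal \<epsilon> m (\<lambda>i. u i y)" and q: "q y > 0"
      and sp: "\<And>i. i < m \<Longrightarrow> u i y \<in> span ((\<lambda>j. w j y) ` {..i})" by auto
    have "h (e y) (u j y) = 0" if "j < m" for j
      using orthogonal_residue[OF ou that, of "w m y"] unfolding e_def v_def by (simp add: scaleR_left)
    moreover have "h (e y) (e y) = \<epsilon> m"
      using normalized[OF em(1), of "v y"] q unfolding e_def q_def by simp
    moreover have "orthonormal \<epsilon> m (\<lambda>i. ?u i y)" by (rule orthonormal_cong[OF ou]) auto
    ultimately have "orthonormal \<epsilon> (Suc m) (\<lambda>i. ?u i y)"
      using em(1) by (intro orthonormal_SucI) auto
    moreover have "e y \<in> span ((\<lambda>j. w j y) ` {..m})"
      unfolding e_def v_def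
    proof (intro span_scale span_diff span_sum)
      show "w m y \<in> span ((\<lambda>j. w j y) ` {..m})" by (rule span_base) auto
      show "u i y \<in> span ((\<lambda>j. w j y) ` {..m})" if "i \<in> {..<m}" for i
      proof (rule subsetD[OF span_mono sp])
        show "(\<lambda>j. w j y) ` {..i} \<subseteq> (\<lambda>j. w j y) ` {..m}" using that by (intro image_mono) auto
      qed (use that in simp)
    qed
    ultimately show ?case using sp by (auto simp: less_Suc_eq)
  qed
  moreover have "\<forall>i<Suc m. smooth_at z (?u i) \<and> ?u i z = w i z"
    using u se qz vz by (auto simp: less_Suc_eq e_def)
  ultimately show ?case by blast
qed

definition rank_one :: "'v \<Rightarrow> 'v \<Rightarrow> 'v \<Rightarrow>\<^sub>L 'v" where
  "rank_one u v = blinfun_scaleR_left u o\<^sub>L prod_left v"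

lemma rank_one_apply [simp]: "blinfun_apply (rank_one u v) a = h a v *\<^sub>R u"
  by (simp add: rank_one_def)

lemma smooth_at_rank_one:
  "smooth_at z u \<Longrightarrow> smooth_at z v \<Longrightarrow> smooth_at z (\<lambda>y. rank_one (u y) (v y))"
  unfolding rank_one_def
  by (intro smooth_at_bilinear[OF bounded_bilinear_blinfun_compose]
      smooth_at_linear[OF bounded_linear_blinfun_scaleR_left] smooth_at_linear[OF bounded_linear_prod_left])

text \<open>The isometry which sends the orthonormal family \<open>b\<close> to \<open>u\<close>; its adjoint is the same
  expression with \<open>b\<close> and \<open>u\<close> exchanged.\<close>

definition transport :: "(nat \<Rightarrow> real) \<Rightarrow> nat \<Rightarrow> (nat \<Rightarrow> 'v) \<Rightarrow> (nat \<Rightarrow> 'v) \<Rightarrow> 'v \<Rightarrow>\<^sub>L 'v" where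
  "transport \<epsilon> m b u = (\<Sum>i<m. \<epsilon> i *\<^sub>R rank_one (u i) (b i))"

lemma transport_apply:
  "blinfun_apply (transport \<epsilon> m b u) a = (\<Sum>i<m. (\<epsilon> i * h a (b i)) *\<^sub>R u i)"
  by (simp add: transport_def blinfun.sum_left blinfun.scaleR_left)

lemma transport_adjoint: "h (transport \<epsilon> m b u a) c = h a (transport \<epsilon> m u b c)"
  unfolding transport_apply sum_left sum_right scaleR_left scaleR_right
  by (intro sum.cong) (auto simp: sym[of _ c] mult_ac)

lemma transport_basis:
  assumes "orthonormal \<epsilon> m b" "j < m"
  shows "transport \<epsilon> m b u (b j) = u j"
proof -
  have "transport \<epsilon> m b u (b j) = (\<Sum>i<m. if i = j then (\<epsilon> j * \<epsilon> j) *\<^sub>R u j else 0)"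
    unfolding transport_apply using orthonormal_form[OF assms(1) assms(2)] sym[of "b j"]
    by (intro sum.cong) (simp_all add: orthonormal_form[OF assms])
  also have "\<dots> = u j" using assms(2) by (simp add: orthonormal_sign[OF assms])
  finally show ?thesis .
qed

lemma transport_inverse:
  assumes "orthonormal \<epsilon> m b" "orthonormal \<epsilon> m u" "span (b ` {..<m}) = UNIV"
  shows "transport \<epsilon> m u b o\<^sub>L transport \<epsilon> m b u = id_blinfun"
proof (rule blinfun_eqI)
  fix a
  have "transport \<epsilon> m u b (transport \<epsilon> m b u a) = (\<Sum>i<m. (\<epsilon> i * h a (b i)) *\<^sub>R b i)"
    unfolding transport_apply[of _ _ b u] blinfun.sum_right blinfun.scaleR_right
    by (intro sum.cong) (auto simp: transport_basis[OF assms(2)])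
  also have "\<dots> = a" using orthonormal_expand[OF assms(1), of a] assms(3) by simp
  finally show "blinfun_apply (transport \<epsilon> m u b o\<^sub>L transport \<epsilon> m b u) a = id_blinfun a" by simp
qed

lemma smooth_at_transport:
  assumes "\<And>i. i < m \<Longrightarrow> smooth_at z (b i)" "\<And>i. i < m \<Longrightarrow> smooth_at z (u i)"
  shows "smooth_at z (\<lambda>y. transport \<epsilon> m (\<lambda>i. b i y) (\<lambda>i. u i y))"
  unfolding transport_def using assms
  by (intro smooth_at_sum smooth_at_scaleR smooth_at_const smooth_at_rank_one) auto

end

section \<open>Linear algebra of one fibre\<close>

lemma image_append:
  fixes m k :: nat
  shows "(\<lambda>i. if i < m then b i else b' (i - m)) ` {..<m + k} = b ` {..<m} \<union> b' ` {..<k}"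
proof (intro equalityI subsetI)
  fix x assume "x \<in> (\<lambda>i. if i < m then b i else b' (i - m)) ` {..<m + k}"
  then obtain i where "i < m + k" "x = (if i < m then b i else b' (i - m))" by blast
  then show "x \<in> b ` {..<m} \<union> b' ` {..<k}" by (cases "i < m") auto
next
  fix x assume "x \<in> b ` {..<m} \<union> b' ` {..<k}"
  then consider i where "i < m" "x = b i" | i where "i < k" "x = b' i" by blast
  then show "x \<in> (\<lambda>i. if i < m then b i else b' (i - m)) ` {..<m + k}"
  proof cases
    case (1 i)
    then show ?thesis by (intro image_eqI[of _ _ i]) auto
  next
    case (2 i)
    then show ?thesis by (intro image_eqI[of _ _ "m + i"]) auto
  qed
qed

lemma bounded_bilinear_add:
  assumes "bounded_bilinear f" "bounded_bilinear g"
  shows "bounded_bilinear (\<lambda>a b. f a b + g a b)"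
proof -
  interpret f: bounded_bilinear f by (rule assms(1))
  interpret g: bounded_bilinear g by (rule assms(2))
  obtain K L where K: "\<And>a b. norm (f a b) \<le> norm a * norm b * K"
    and L: "\<And>a b. norm (g a b) \<le> norm a * norm b * L"
    using f.bounded g.bounded by metis
  have "norm (f a b + g a b) \<le> norm a * norm b * (K + L)" for a b
    using norm_triangle_le[OF add_mono[OF K[of a b] L[of a b]]] by (simp add: distrib_left)
  then have "\<exists>K. \<forall>a b. norm (f a b + g a b) \<le> norm a * norm b * K" by blast
  then show ?thesis
    by unfold_locales (simp_all add: f.add_left g.add_left f.add_right g.add_right
        f.scaleR_left g.scaleR_left f.scaleR_right g.scaleR_right scaleR_right_distrib ac_simps)
qed

lemma bounded_bilinear_pairing:
  "bounded_bilinear (pairing :: 'e::real_normed_vector gtv \<Rightarrow> 'e gtv \<Rightarrow> real)"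
proof -
  have b: "bounded_bilinear (\<lambda>a b :: 'e gtv. blinfun_apply ((1/2) *\<^sub>R snd a) (fst b))"
    by (rule bounded_bilinear.comp[OF bounded_bilinear_blinfun_apply])
      (intro bounded_linear_compose[OF bounded_linear_scaleR_right] bounded_linear_snd bounded_linear_fst)+
  have "pairing = (\<lambda>a b :: 'e gtv. blinfun_apply ((1/2) *\<^sub>R snd a) (fst b)
      + blinfun_apply ((1/2) *\<^sub>R snd b) (fst a))"
    by (intro ext) (simp add: pairing_def blinfun.scaleR_left add_divide_distrib)
  then show ?thesis using bounded_bilinear_add[OF b bounded_bilinear.flip[OF b]] by simp
qed

interpretation pairing: symmetric_form "pairing :: 'e::real_normed_vector gtv \<Rightarrow> 'e gtv \<Rightarrow> real"
proof -
  interpret bounded_bilinear "pairing :: 'e gtv \<Rightarrow> 'e gtv \<Rightarrow> real" by (rule bounded_bilinear_pairing)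
  show "symmetric_form (pairing :: 'e gtv \<Rightarrow> 'e gtv \<Rightarrow> real)"
    by unfold_locales (simp add: pairing_def)
qed

lemma skew_endD: "skew_end L \<Longrightarrow> pairing (L a) b = - pairing a (L b)"
  unfolding skew_end_def by (metis eq_neg_iff_add_eq_0)

lemma skew_endI: "(\<And>a b. pairing (blinfun_apply L a) b = - pairing a (blinfun_apply L b)) \<Longrightarrow> skew_end L"
  unfolding skew_end_def by (metis eq_neg_iff_add_eq_0)

lemma skew_end_add:
  assumes "skew_end L" "skew_end M"
  shows "skew_end (L + M)"
  by (rule skew_endI) (simp add: blinfun.add_left pairing.add_left pairing.add_right
      skew_endD[OF assms(1)] skew_endD[OF assms(2)])

lemma skew_end_sum: "(\<And>i. i \<in> I \<Longrightarrow> skew_end (L i)) \<Longrightarrow> skew_end (\<Sum>i\<in>I. L i)"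
proof (induction I rule: infinite_finite_induct)
  case (insert i I)
  then show ?case by (simp add: skew_end_add)
qed (simp_all add: skew_end_def pairing.zero_left pairing.zero_right)

text \<open>This is the endomorphism given by the 2-vector \<open>u \<and> v\<close>; sums of such endomorphisms serve to write down members of the fibre which are skew by construction.\<close>

lemma skew_end_wedge: "skew_end (pairing.rank_one u v - pairing.rank_one v u)"
  by (rule skew_endI) (simp add: blinfun.diff_left pairing.diff_left pairing.diff_right
      pairing.scaleR_left pairing.scaleR_right pairing.sym[of u] pairing.sym[of v])

lemma skew_end_perp:
  assumes "skew_end L" "blinfun_apply L ` S \<subseteq> S" "\<forall>a\<in>S. pairing a b = 0" "a \<in> S"
  shows "pairing a (L b) = 0"
proof -
  have "L a \<in> S" using assms(2,4) by blast
  then show ?thesis using skew_endD[OF assms(1), of a b] assms(3) by simp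
qed

text \<open>A curve in the fibre with velocity \<open>[K, A]\<close> at \<open>K\<close> is needed. Let \<open>W\<close> be the negative of the part of \<open>A\<close>
  which anticommutes with \<open>K\<close>. Then \<open>[W, K] = [K, A]\<close>, and \<open>W\<close> maps each eigenspace \<open>L\<^sub>\<plusminus>\<close> of \<open>K\<close> to the other
  one. Its two components \<open>L\<^sub>+ \<rightarrow> L\<^sub>-\<close> and \<open>L\<^sub>- \<rightarrow> L\<^sub>+\<close> have square zero, so that \<open>1 + t W\<^sub>i\<close> is,
  for each component \<open>W\<^sub>i\<close>, a one-parameter group of isometries. Conjugation by these moves \<open>K\<close> polynomially in
  \<open>t\<close>, without exponentials.\<close>

lemma commutator_nilpotent_split:
  fixes K A :: "'e::real_normed_vector gend"
  assumes K: "gen_paracomplex K" "blinfun_apply K ` S \<subseteq> S"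
    and A: "skew_end A" "blinfun_apply A ` S \<subseteq> S" and S: "subspace S"
  obtains W1 W2 where "skew_end W1" "skew_end W2" "W1 o\<^sub>L W1 = 0" "W2 o\<^sub>L W2 = 0"
    "blinfun_apply W1 ` S \<subseteq> S" "blinfun_apply W2 ` S \<subseteq> S"
    "((W1 + W2) o\<^sub>L K) - (K o\<^sub>L (W1 + W2)) = (K o\<^sub>L A) - (A o\<^sub>L K)"
proof -
  have KK: "K (K a) = a" for a
    using K(1) unfolding gen_paracomplex_def by (metis blinfun_apply_blinfun_compose blinfun_apply_id_blinfun)
  note skew = skew_endD[OF K(1)[unfolded gen_paracomplex_def, THEN conjunct2]] skew_endD[OF A(1)]
  note lin = blinfun.add_left blinfun.diff_left blinfun.scaleR_left blinfun.minus_left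
    blinfun.add_right blinfun.diff_right blinfun.scaleR_right blinfun.minus_right
  \<comment> \<open>\<open>1 \<plusminus> K\<close> are twice the projections to the eigenspaces; \<open>s = \<plusminus>1\<close> selects the component\<close>
  define W :: "real \<Rightarrow> 'e gend" where
    "W s = (- (1/4)) *\<^sub>R ((id_blinfun - s *\<^sub>R K) o\<^sub>L A o\<^sub>L (id_blinfun + s *\<^sub>R K))" for s
  have W: "W s a = (- (1/4)) *\<^sub>R (A a + s *\<^sub>R A (K a) - s *\<^sub>R K (A a) - (s * s) *\<^sub>R K (A (K a)))" for s a
    unfolding W_def by (simp add: lin algebra_simps)
  have sk: "skew_end (W s)" for s
    by (rule skew_endI) (simp add: W pairing.add_left pairing.diff_left pairing.scaleR_left
        pairing.minus_left pairing.add_right pairing.diff_right pairing.scaleR_right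
        pairing.minus_right skew algebra_simps)
  have pres: "blinfun_apply (W s) ` S \<subseteq> S" for s
  proof
    fix x assume "x \<in> blinfun_apply (W s) ` S"
    then obtain a where a: "a \<in> S" "x = W s a" by blast
    have "A a \<in> S" "K (A a) \<in> S" "A (K a) \<in> S" "K (A (K a)) \<in> S" using a(1) K(2) A(2) by blast+
    then show "x \<in> S" unfolding a(2) W using S by (intro subspace_scale subspace_diff subspace_add)
  qed
  have sq: "W s o\<^sub>L W s = 0" if "s * s = 1" for s
  proof -
    have z: "(id_blinfun + s *\<^sub>R K) ((id_blinfun - s *\<^sub>R K) a) = 0" for a
    proof -
      have "(id_blinfun + s *\<^sub>R K) ((id_blinfun - s *\<^sub>R K) a) = (a + s *\<^sub>R K a) - s *\<^sub>R (K a + s *\<^sub>R K (K a))"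
        by (simp only: lin blinfun_apply_id_blinfun)
      also have "\<dots> = 0" by (simp only: KK scaleR_add_right scaleR_scaleR \<open>s * s = 1\<close>) simp
      finally show ?thesis .
    qed
    have "W s (W s a) = 0" for a
    proof -
      have "W s (W s a) = (- (1/4)) *\<^sub>R (id_blinfun - s *\<^sub>R K) (A ((- (1/4)) *\<^sub>R
          ((id_blinfun + s *\<^sub>R K) ((id_blinfun - s *\<^sub>R K) (A ((id_blinfun + s *\<^sub>R K) a))))))"
        by (simp only: W_def blinfun.scaleR_left blinfun.scaleR_right blinfun_apply_blinfun_compose)
      then show ?thesis by (simp only: z scaleR_zero_right blinfun.zero_right)
    qed
    then show ?thesis by (intro blinfun_eqI) (simp only: blinfun_apply_blinfun_compose zero_blinfun.rep_eq)
  qed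
  have "((W 1 + W (- 1)) o\<^sub>L K) - (K o\<^sub>L (W 1 + W (- 1))) = (K o\<^sub>L A) - (A o\<^sub>L K)"
  proof (rule blinfun_eqI)
    fix a
    have sum: "W 1 a + W (- 1) a = (- (1/2)) *\<^sub>R (A a - K (A (K a)))" for a
      unfolding W by (simp add: algebra_simps scaleR_2[symmetric])
    have half: "(- (1/2)) *\<^sub>R (x - y) - (- (1/2)) *\<^sub>R (y - x) = y - x" for x y :: "'e gtv"
    proof -
      have "(- (1/2)) *\<^sub>R (x - y) - (- (1/2)) *\<^sub>R (y - x) = (1/2) *\<^sub>R ((y - x) + (y - x))"
        by (simp only: scaleR_minus_left scaleR_add_right minus_diff_eq[of x y, symmetric]
            scaleR_minus_right minus_minus) simp
      then show ?thesis by (simp only: scaleR_half_double)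
    qed
    have "(((W 1 + W (- 1)) o\<^sub>L K) - (K o\<^sub>L (W 1 + W (- 1)))) a
        = (W 1 (K a) + W (- 1) (K a)) - K (W 1 a + W (- 1) a)"
      by (simp only: blinfun.diff_left blinfun.add_left blinfun_apply_blinfun_compose)
    also have "\<dots> = (- (1/2)) *\<^sub>R (A (K a) - K (A a)) - (- (1/2)) *\<^sub>R (K (A a) - A (K a))"
      by (simp only: sum KK blinfun.scaleR_right blinfun.diff_right)
    also have "\<dots> = ((K o\<^sub>L A) - (A o\<^sub>L K)) a"
      unfolding half by (simp only: blinfun.diff_left blinfun_apply_blinfun_compose)
    finally show "(((W 1 + W (- 1)) o\<^sub>L K) - (K o\<^sub>L (W 1 + W (- 1)))) a = ((K o\<^sub>L A) - (A o\<^sub>L K)) a" .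
  qed
  then show thesis by (intro that[of "W 1" "W (- 1)"] sk pres sq) simp_all
qed

text \<open>The conditions which a generalized metric imposes on its fibre \<open>S = E\<^sub>p\<close> at one point.\<close>

locale metric_fibre =
  fixes S :: "'e::euclidean_space gtv set" and n :: nat
  assumes subspace: "subspace S" and dim: "dim S = 2 * n" and dim_base: "DIM('e) = 2 * n"
    and signature: "has_signature pairing S n n"
    and transversal: "S \<inter> {a. fst a = 0} = {0}"
begin

definition perp :: "'e gtv set" where "perp = {b. \<forall>a\<in>S. pairing a b = 0}"

definition sg :: "nat \<Rightarrow> real" where "sg i = (if i < n then 1 else - 1)"

lemma n_pos: "n > 0"
  using dim_base DIM_positive[where 'a='e] by simp

lemma signature_basis:
  obtains b where "pairing.orthonormal sg (2 * n) b" "span (b ` {..<2 * n}) = S"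
proof -
  obtain P N where P: "subspace P" "dim P = n" "\<And>u. u \<in> P \<Longrightarrow> u \<noteq> 0 \<Longrightarrow> 1 * pairing u u > 0"
    and N: "subspace N" "dim N = n" "\<And>u. u \<in> N \<Longrightarrow> u \<noteq> 0 \<Longrightarrow> - 1 * pairing u u > 0"
    and S: "S = span (P \<union> N)" and PN: "\<And>u v. u \<in> P \<Longrightarrow> v \<in> N \<Longrightarrow> pairing u v = 0"
    using signature unfolding has_signature_def by auto
  obtain b where b: "pairing.orthonormal (\<lambda>_. 1) n b" "span (b ` {..<n}) = P"
    using pairing.definite_orthonormal_basis[OF P(1) _ P(3)] n_pos unfolding P(2) by auto
  obtain b' where b': "pairing.orthonormal (\<lambda>_. - 1) n b'" "span (b' ` {..<n}) = N"
    using pairing.definite_orthonormal_basis[OF N(1) _ N(3)] n_pos unfolding N(2) by auto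
  let ?b = "\<lambda>i. if i < n then b i else b' (i - n)"
  have "pairing.orthonormal (\<lambda>i. if i < n then 1 else - 1) (n + n) ?b"
  proof (rule pairing.orthonormal_append[OF b(1) b'(1)])
    have "b ` {..<n} \<subseteq> P" "b' ` {..<n} \<subseteq> N"
      using b(2) b'(2) span_superset[of "b ` {..<n}"] span_superset[of "b' ` {..<n}"] by simp_all
    then show "pairing (b i) (b' j) = 0" if "i < n" "j < n" for i j using that by (intro PN) auto
  qed
  then have "pairing.orthonormal sg (2 * n) ?b" unfolding sg_def by (simp add: mult_2)
  moreover have "?b ` {..<2 * n} = b ` {..<n} \<union> b' ` {..<n}"
    unfolding mult_2 by (rule image_append)
  moreover have "span (b ` {..<n} \<union> b' ` {..<n}) = span (P \<union> N)"
    unfolding span_Un b(2) b'(2) span_eq_iff[THEN iffD2, OF P(1)] span_eq_iff[THEN iffD2, OF N(1)] ..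
  ultimately show thesis using that S by simp
qed

lemma inj_fst: "inj_on fst S"
proof (rule inj_onI)
  fix a b assume ab: "a \<in> S" "b \<in> S" "fst a = fst b"
  then have "a - b \<in> S \<inter> {a. fst a = 0}" using subspace by (simp add: subspace_diff)
  then show "a = b" using transversal by simp
qed

text \<open>A subspace of dimension \<open>2n\<close> transversal to the covectors is the graph of a map from the vectors to
  the covectors; \<open>G\<close> is its parametrization \<open>X \<mapsto> X + g(X) + \<Theta>(X)\<close>.\<close>

lemma lift_exists:
  obtains G :: "'e \<Rightarrow>\<^sub>L 'e gtv" where
    "\<And>Y. G Y \<in> S" "\<And>a. a \<in> S \<Longrightarrow> G (fst a) = a" "\<And>Y. fst (G Y) = Y"
proof -
  obtain b where b: "pairing.orthonormal sg (2 * n) b" "span (b ` {..<2 * n}) = S"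
    by (rule signature_basis)
  have lin: "linear (fst :: 'e gtv \<Rightarrow> 'e)" by (simp add: linear_fst)
  have inj: "inj_on fst (span S)" using inj_fst subspace by (metis span_eq_iff)
  obtain g where g: "range g \<subseteq> span S" "linear g" "\<forall>a\<in>span S. g (fst a) = a"
    using linear_inj_on_left_inverse[OF lin inj] by blast
  have span: "span S = S" using subspace by (metis span_eq_iff)
  have "independent (fst ` b ` {..<2 * n})"
    by (rule linear_independent_injective_image[OF lin pairing.orthonormal_independent[OF b(1)]])
      (simp add: b(2) inj_fst)
  moreover have "card (fst ` b ` {..<2 * n}) = DIM('e)"
  proof -
    have "inj_on fst (b ` {..<2 * n})"
      using inj_on_subset[OF inj_fst] span_superset[of "b ` {..<2 * n}"] b(2) by simp
    then show ?thesis using card_image pairing.orthonormal_card[OF b(1)] dim_base by metis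
  qed
  ultimately have "UNIV \<subseteq> span (fst ` b ` {..<2 * n})"
    by (intro card_ge_dim_independent) simp_all
  also have "span (fst ` b ` {..<2 * n}) = fst ` S" by (simp add: linear_span_image[OF lin] b(2))
  finally have surj: "\<exists>a\<in>S. Y = fst a" for Y :: 'e by blast
  have G: "blinfun_apply (Blinfun g) = g"
    using g(2) by (simp add: bounded_linear_Blinfun_apply linear_conv_bounded_linear)
  show thesis
  proof (rule that[of "Blinfun g"]; unfold G)
    show "g Y \<in> S" for Y using g(1) span by blast
    show "g (fst a) = a" if "a \<in> S" for a using g(3) span that by blast
    then show "fst (g Y) = Y" for Y using surj[of Y] by auto
  qed
qed

text \<open>With \<open>S = {X + g(X) + \<Theta>(X)}\<close>, the isometry of \<open>S\<close> onto its orthogonal complement is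
  \<open>X + g(X) + \<Theta>(X) \<mapsto> X - g(X) + \<Theta>(X)\<close>, that is \<open>J a = a - 2 g(X)\<close> for \<open>X = fst a\<close>; the covector
  \<open>2 g(X)\<close> is obtained here as \<open>Y \<mapsto> 2 \<langle>a, A\<rangle>\<close> where \<open>A \<in> S\<close> lies over \<open>Y\<close>.\<close>

lemma reflection_exists:
  obtains J :: "'e gtv \<Rightarrow> 'e gtv" where
    "linear J"
    "\<And>a. fst (J a) = fst a"
    "\<And>a. J a \<in> perp"
    "\<And>a b. a \<in> S \<Longrightarrow> b \<in> S \<Longrightarrow> pairing (J a) (J b) = - pairing a b"
    "\<And>y. y \<in> perp \<Longrightarrow> \<exists>c\<in>S. y = J c"
    "\<And>a. a \<in> S \<Longrightarrow> J a = a \<Longrightarrow> a = 0"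
proof -
  obtain G :: "'e \<Rightarrow>\<^sub>L 'e gtv" where G: "\<And>Y. G Y \<in> S" "\<And>a. a \<in> S \<Longrightarrow> G (fst a) = a" "\<And>Y. fst (G Y) = Y"
    by (rule lift_exists) blast
  define \<alpha> where "\<alpha> a = 2 *\<^sub>R (pairing.prod_left a o\<^sub>L G)" for a
  have \<alpha>: "blinfun_apply (\<alpha> a) (fst c) = 2 * pairing c a" if "c \<in> S" for a c
    unfolding \<alpha>_def by (simp add: blinfun.scaleR_left G(2)[OF that])
  define J :: "'e gtv \<Rightarrow> 'e gtv" where "J a = a - (0, \<alpha> a)" for a
  have lin\<alpha>: "linear \<alpha>"
    unfolding \<alpha>_def
    by (rule linearI; rule blinfun_eqI)
      (simp_all add: blinfun.scaleR_left blinfun.add_left pairing.add_right pairing.scaleR_right scaleR_add_right)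
  have cov: "pairing c (0, \<beta>) = blinfun_apply \<beta> (fst c) / 2" for c :: "'e gtv" and \<beta>
    by (simp add: pairing_def)
  have perp: "J a \<in> perp" for a
    unfolding perp_def J_def by (simp add: pairing.diff_right cov \<alpha>)
  show thesis
  proof (rule that[of J])
    show "linear J"
      by (rule linearI) (simp_all add: J_def linear_add[OF lin\<alpha>] linear_scale[OF lin\<alpha>] prod_eq_iff algebra_simps)
    show "fst (J a) = fst a" for a by (simp add: J_def)
    show "J a \<in> perp" for a by (rule perp)
    show "pairing (J a) (J b) = - pairing a b" if ab: "a \<in> S" "b \<in> S" for a b
    proof -
      have "pairing (J a) (J b) = pairing (J a) b - pairing (J a) (0, \<alpha> b)"
        unfolding J_def[of b] by (simp add: pairing.diff_right)
      also have "pairing (J a) b = 0" using perp[of a] ab(2) pairing.sym[of "J a" b] unfolding perp_def by simp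
      also have "pairing (J a) (0, \<alpha> b) = pairing a b" unfolding cov using \<alpha>[OF ab(1)] by (simp add: J_def)
      finally show ?thesis by simp
    qed
    show "\<exists>c\<in>S. y = J c" if y: "y \<in> perp" for y
    proof
      define c where "c = G (fst y)"
      show c: "c \<in> S" unfolding c_def by (rule G(1))
      have fst: "fst (y - J c) = 0" by (simp add: J_def c_def G(3))
      have "blinfun_apply (snd (y - J c)) (fst a) = 0" if a: "a \<in> S" for a
      proof -
        have "pairing a (y - J c) = 0" using y perp[of c] a unfolding perp_def by (simp add: pairing.diff_right)
        then show ?thesis using cov[of a "snd (y - J c)"] fst by (metis prod.collapse divide_eq_0_iff zero_neq_numeral)
      qed
      then have "snd (y - J c) = 0" using G(1,3) by (metis blinfun_eqI zero_blinfun.rep_eq)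
      then have "y - J c = 0" using fst by (simp add: prod_eq_iff)
      then show "y = J c" by simp
    qed
    show "a = 0" if a: "a \<in> S" "J a = a" for a
    proof -
      have "\<alpha> a = 0" using a(2) unfolding J_def by (simp add: prod_eq_iff)
      then have "pairing b a = 0" if "b \<in> S" for b using \<alpha>[OF that, of a] by simp
      moreover obtain b where b: "pairing.orthonormal sg (2 * n) b" "span (b ` {..<2 * n}) = S"
        by (rule signature_basis)
      moreover have "b i \<in> S" if "i < 2 * n" for i
        using span_base[of "b i" "b ` {..<2 * n}"] b(2) that by simp
      ultimately show "a = 0"
        using pairing.orthonormal_expand[OF b(1), of a] a(1) pairing.sym[of a] by simp
    qed
  qed
qed

text \<open>The form is nondegenerate on \<open>S\<close>, so there is an orthogonal projection to \<open>S\<close> although the form is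
  indefinite.\<close>

lemma split_exists:
  obtains a c where "a \<in> S" "c \<in> perp" "x = a + c"
proof -
  obtain b where b: "pairing.orthonormal sg (2 * n) b" "span (b ` {..<2 * n}) = S"
    by (rule signature_basis)
  define a where "a = (\<Sum>i<2 * n. (sg i * pairing x (b i)) *\<^sub>R b i)"
  have "a \<in> S" unfolding a_def b(2)[symmetric] by (intro span_sum span_scale span_base) auto
  moreover have "x - a \<in> perp"
    unfolding perp_def
  proof (intro CollectI ballI)
    fix s assume "s \<in> S"
    then have "pairing (x - a) s = pairing (x - a) (\<Sum>i<2 * n. (sg i * pairing s (b i)) *\<^sub>R b i)"
      using pairing.orthonormal_expand[OF b(1), of s] b(2) by simp
    also have "\<dots> = 0"
      using pairing.orthogonal_residue[OF b(1), of _ x] unfolding a_def[symmetric]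
      by (simp add: pairing.sum_right pairing.scaleR_right)
    finally show "pairing s (x - a) = 0" using pairing.sym by metis
  qed
  ultimately show thesis using that[of a "x - a"] by simp
qed

lemma subspace_perp: "subspace perp"
  unfolding perp_def by (rule subspaceI) (simp_all add: pairing.zero_right pairing.add_right pairing.scaleR_right)

lemma disjoint_perp: "a \<in> S \<Longrightarrow> a \<in> perp \<Longrightarrow> a = 0"
proof -
  assume a: "a \<in> S" "a \<in> perp"
  obtain b where b: "pairing.orthonormal sg (2 * n) b" "span (b ` {..<2 * n}) = S"
    by (rule signature_basis)
  have "b i \<in> S" if "i < 2 * n" for i
    using span_base[of "b i" "b ` {..<2 * n}"] b(2) that by simp
  then show ?thesis
    using pairing.orthonormal_expand[OF b(1), of a] a b(2) pairing.sym[of a] unfolding perp_def by simp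
qed

text \<open>An orthonormal basis of \<open>S\<close> followed by its image under \<open>J\<close>, with opposite signs.\<close>

lemma adapted_basis:
  obtains \<epsilon> b where "pairing.orthonormal \<epsilon> (2 * n + 2 * n) b" "span (b ` {..<2 * n}) = S"
    "span (b ` {..<2 * n + 2 * n}) = UNIV"
proof -
  obtain b where b: "pairing.orthonormal sg (2 * n) b" "span (b ` {..<2 * n}) = S"
    by (rule signature_basis)
  obtain J where J: "linear J" "\<And>a. J a \<in> perp" "\<And>y. y \<in> perp \<Longrightarrow> \<exists>c\<in>S. y = J c"
    "\<And>a b. a \<in> S \<Longrightarrow> b \<in> S \<Longrightarrow> pairing (J a) (J b) = - pairing a b"
    by (rule reflection_exists) blast
  have bS: "b i \<in> S" if "i < 2 * n" for i
    using span_base[of "b i" "b ` {..<2 * n}"] b(2) that by simp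
  have oJ: "pairing.orthonormal (\<lambda>i. - sg i) (2 * n) (\<lambda>i. J (b i))"
    unfolding pairing.orthonormal_def
    using pairing.orthonormal_sign[OF b(1)] pairing.orthonormal_form[OF b(1)] J(4)[OF bS bS] by simp
  let ?b = "\<lambda>i. if i < 2 * n then b i else J (b (i - 2 * n))"
  have o: "pairing.orthonormal (\<lambda>i. if i < 2 * n then sg i else - sg (i - 2 * n)) (2 * n + 2 * n) ?b"
    by (rule pairing.orthonormal_append[OF b(1) oJ]) (use J(2) bS in \<open>auto simp: perp_def\<close>)
  have "span (?b ` {..<2 * n}) = S"
  proof -
    have "?b ` {..<2 * n} = b ` {..<2 * n}" by (rule image_cong) simp_all
    then show ?thesis using b(2) by metis
  qed
  moreover have "UNIV \<subseteq> span (?b ` {..<2 * n + 2 * n})"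
  proof
    fix x
    obtain a y where "a \<in> S" "y \<in> perp" "x = a + y" by (rule split_exists)
    then obtain c where ac: "a \<in> S" "c \<in> S" "x = a + J c" using J(3) by blast
    have "J c \<in> span (J ` b ` {..<2 * n})" using ac(2) unfolding linear_span_image[OF J(1)] b(2) by blast
    moreover have "a \<in> span (b ` {..<2 * n})" using ac(1) b(2) by simp
    moreover have "span (b ` {..<2 * n} \<union> (\<lambda>i. J (b i)) ` {..<2 * n})
        = {x + y |x y. x \<in> span (b ` {..<2 * n}) \<and> y \<in> span (J ` b ` {..<2 * n})}"
      unfolding span_Un image_image ..
    ultimately show "x \<in> span (?b ` {..<2 * n + 2 * n})"
      unfolding image_append[of "2 * n" b "\<lambda>i. J (b i)"] ac(3) by blast
  qed
  ultimately show thesis using that[OF o] by auto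
qed

text \<open>Both members are given on \<open>S\<close> by the same skew involution \<open>k\<close>, which exchanges the positive and the
  negative vectors of an orthonormal basis, and on \<open>J S\<close> by \<open>\<plusminus> J k J\<^sup>-\<^sup>1\<close>. A covector has the form
  \<open>a - J a\<close> with \<open>a \<in> S\<close>. Its image is \<open>k a - J (k a)\<close>, again a covector, for the plus sign, and
  \<open>k a + J (k a)\<close>, with vector part twice that of \<open>k a\<close>, for the minus sign.\<close>

lemma paracomplex_pair:
  obtains K L :: "'e gend" where
    "gen_paracomplex K" "blinfun_apply K ` S \<subseteq> S" "gen_paracomplex L" "blinfun_apply L ` S \<subseteq> S"
    "\<And>\<gamma>. fst (K (0, \<gamma>)) = 0" "\<exists>\<gamma>. \<gamma> \<noteq> 0 \<and> K (0, \<gamma>) = (0, \<gamma>)" "\<exists>\<gamma>. fst (L (0, \<gamma>)) \<noteq> 0"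
proof -
  obtain b where b: "pairing.orthonormal sg (2 * n) b" "span (b ` {..<2 * n}) = S"
    by (rule signature_basis)
  obtain J where J: "linear J" "\<And>a. fst (J a) = fst a" "\<And>a. J a \<in> perp"
    "\<And>a b. a \<in> S \<Longrightarrow> b \<in> S \<Longrightarrow> pairing (J a) (J b) = - pairing a b"
    "\<And>y. y \<in> perp \<Longrightarrow> \<exists>c\<in>S. y = J c" "\<And>a. a \<in> S \<Longrightarrow> J a = a \<Longrightarrow> a = 0"
    by (rule reflection_exists) blast
  define e f where "e i = b i" and "f i = b (n + i)" for i
  have bS: "b i \<in> S" if "i < 2 * n" for i
    using span_base[of "b i" "b ` {..<2 * n}"] b(2) that by simp
  have eS: "e i \<in> S" and fS: "f i \<in> S" if "i < n" for i using bS that by (auto simp: e_def f_def)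
  have form: "pairing (e i) (e j) = (if i = j then 1 else 0)" "pairing (f i) (f j) = (if i = j then - 1 else 0)"
    "pairing (e i) (f j) = 0" "pairing (f i) (e j) = 0" if "i < n" "j < n" for i j
    using that pairing.orthonormal_form[OF b(1)] by (auto simp: e_def f_def sg_def)
  have basis: "\<forall>v\<in>b ` {..<2 * n}. p v = (q v :: 'e gtv)"
    if "\<And>i. i < n \<Longrightarrow> p (e i) = q (e i)" "\<And>i. i < n \<Longrightarrow> p (f i) = q (f i)" for p q
  proof
    fix v assume "v \<in> b ` {..<2 * n}"
    then obtain i where i: "i < 2 * n" "v = b i" by blast
    show "p v = q v"
    proof (cases "i < n")
      case False
      then have "v = f (i - n)" "i - n < n" using i by (auto simp: f_def)
      then show ?thesis using that(2) by simp
    qed (use that(1) i in \<open>simp add: e_def\<close>)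
  qed
  define swap where
    "swap u v = (\<Sum>i<n. pairing.rank_one (v i) (u i) - pairing.rank_one (u i) (v i))" for u v :: "nat \<Rightarrow> 'e gtv"
  have swap: "swap u v a = (\<Sum>i<n. pairing a (u i) *\<^sub>R v i - pairing a (v i) *\<^sub>R u i)" for u v a
    unfolding swap_def by (simp add: blinfun.sum_left blinfun.diff_left)
  have skew: "skew_end (swap u v)" for u v
    unfolding swap_def by (intro skew_end_sum skew_end_wedge)
  \<comment> \<open>\<open>J f\<^sub>i\<close> are the positive vectors of \<open>J S\<close>, whence the exchanged order in \<open>m = J k J\<^sup>-\<^sup>1\<close>\<close>
  define k m where "k = swap e f" and "m = swap (\<lambda>i. J (f i)) (\<lambda>i. J (e i))"
  have kS: "k a \<in> S" if "a \<in> S" for a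
    unfolding k_def swap using eS fS subspace by (intro subspace_sum subspace_diff subspace_scale) auto
  have ke: "k (e j) = f j" and kf: "k (f j) = e j" if "j < n" for j
  proof -
    have "k (e j) = (\<Sum>i<n. if i = j then f j else 0)" "k (f j) = (\<Sum>i<n. if i = j then e j else 0)"
      unfolding k_def swap by ((rule sum.cong[OF refl], (use form that in auto)[1])+)
    then show "k (e j) = f j" "k (f j) = e j" using that by simp_all
  qed
  have mJ: "m (J (e j)) = J (f j)" "m (J (f j)) = J (e j)" if "j < n" for j
  proof -
    have "m (J (e j)) = (\<Sum>i<n. if i = j then J (f j) else 0)" "m (J (f j)) = (\<Sum>i<n. if i = j then J (e j) else 0)"
      unfolding m_def swap by ((rule sum.cong[OF refl], (use form that in \<open>auto simp: J(4) eS fS\<close>)[1])+)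
    then show "m (J (e j)) = J (f j)" "m (J (f j)) = J (e j)" using that by simp_all
  qed
  have kk: "k (k a) = a" if "a \<in> S" for a
  proof (rule linear_eq_on_span[of "\<lambda>a. k (k a)" "\<lambda>a. a" "b ` {..<2 * n}"])
    show "linear (\<lambda>a. k (k a))"
      by (rule linearI) (simp_all add: blinfun.add_right blinfun.scaleR_right)
    show "linear (\<lambda>a :: 'e gtv. a)" by (rule linear_ident)
    show "k (k v) = v" if "v \<in> b ` {..<2 * n}" for v
      by (rule bspec[OF basis[of "\<lambda>a. k (k a)" "\<lambda>a. a"] that]) (simp_all add: ke kf)
  qed (use that b(2) in simp)
  have mk: "m (J a) = J (k a)" if "a \<in> S" for a
  proof (rule linear_eq_on_span[of "\<lambda>a. m (J a)" "\<lambda>a. J (k a)" "b ` {..<2 * n}"])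
    show "linear (\<lambda>a. m (J a))" "linear (\<lambda>a. J (k a))"
      by (rule linearI, simp_all add: blinfun.add_right blinfun.scaleR_right linear_add[OF J(1)]
          linear_scale[OF J(1)])+
    show "m (J v) = J (k v)" if "v \<in> b ` {..<2 * n}" for v
      by (rule bspec[OF basis[of "\<lambda>a. m (J a)" "\<lambda>a. J (k a)"] that]) (simp_all add: ke kf mJ)
  qed (use that b(2) in simp)
  have kJ: "k (J a) = 0" for a
  proof -
    have "pairing (J a) s = 0" if "s \<in> S" for s
      using J(3)[of a] that pairing.sym[of "J a" s] unfolding perp_def by simp
    then show ?thesis unfolding k_def swap using eS fS by simp
  qed
  have mS: "m a = 0" if "a \<in> S" for a
  proof -
    have "pairing a (J s) = 0" for s using J(3)[of s] that unfolding perp_def by simp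
    then show ?thesis unfolding m_def swap by simp
  qed
  define M where "M s = k + s *\<^sub>R m" for s :: real
  have M: "M s (a + J c) = k a + s *\<^sub>R J (k c)" if "a \<in> S" "c \<in> S" for s a c
    unfolding M_def by (simp add: blinfun.add_left blinfun.scaleR_left blinfun.add_right kJ mS mk that)
  have MS: "blinfun_apply (M s) ` S \<subseteq> S" for s
    unfolding M_def using mS kS by (auto simp: blinfun.add_left blinfun.scaleR_left)
  have pc: "gen_paracomplex (M s)" if s: "s * s = 1" for s
    unfolding gen_paracomplex_def
  proof
    show "skew_end (M s)" unfolding M_def k_def m_def
    proof (intro skew_end_add skew)
      show "skew_end (s *\<^sub>R swap u v)" for u v
        by (rule skew_endI) (simp add: blinfun.scaleR_left pairing.scaleR_left pairing.scaleR_right skew_endD[OF skew])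
    qed
    show "M s o\<^sub>L M s = id_blinfun"
    proof (rule blinfun_eqI)
      fix x
      obtain a y where "a \<in> S" "y \<in> perp" "x = a + y" by (rule split_exists)
      then obtain c where ac: "a \<in> S" "c \<in> S" "x = a + J c" using J(5) by blast
      have "M s (M s x) = M s (k a + J (s *\<^sub>R k c))" unfolding ac(3) M[OF ac(1,2)] by (simp add: linear_scale[OF J(1)])
      also have "\<dots> = k (k a) + s *\<^sub>R J (k (s *\<^sub>R k c))"
        using kS ac subspace by (intro M subspace_scale) auto
      also have "\<dots> = x" using ac s by (simp add: kk blinfun.scaleR_right linear_scale[OF J(1)])
      finally show "blinfun_apply (M s o\<^sub>L M s) x = id_blinfun x" by simp
    qed
  qed
  have cov: "\<exists>a\<in>S. (0, \<gamma>) = a + J (- a)" for \<gamma> :: "'e \<Rightarrow>\<^sub>L real"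
  proof -
    obtain a y where "a \<in> S" "y \<in> perp" "(0, \<gamma>) = a + y" by (rule split_exists)
    then obtain c where ac: "a \<in> S" "c \<in> S" "(0, \<gamma>) = a + J c" using J(5) by blast
    then have "fst (- a) = fst c" using J(2)[of c] by (metis add_eq_0_iff fst_add fst_conv fst_uminus minus_equation_iff)
    moreover have "- a \<in> S" using subspace_neg[OF subspace ac(1)] .
    ultimately have "c = - a" using inj_onD[OF inj_fst] ac(2) by metis
    then show ?thesis using ac by blast
  qed
  have neg: "- a \<in> S" if "a \<in> S" for a using subspace_neg[OF subspace that] .
  \<comment> \<open>an eigenvector of \<open>k\<close> for the eigenvalue \<open>1\<close>\<close>
  define a where "a = e 0 + f 0"
  have aS: "a \<in> S" unfolding a_def using eS fS n_pos subspace by (intro subspace_add) auto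
  have ka: "k a = a" unfolding a_def using ke kf n_pos by (simp add: blinfun.add_right)
  have "pairing a (e 0) = 1" unfolding a_def using form n_pos by (simp add: pairing.add_left)
  then have a0: "a \<noteq> 0" by (auto simp: pairing.zero_left)
  have aJ: "a + J (- a) = (0, snd (a + J (- a)))" using J(2)[of "- a"] by (simp add: prod_eq_iff)
  have M1: "M 1 (a + J (- a)) = a + J (- a)"
    unfolding M[OF aS neg[OF aS]] using ka by (simp add: blinfun.minus_right)
  have M2: "fst (M (- 1) (a + J (- a))) = 2 *\<^sub>R fst a"
    unfolding M[OF aS neg[OF aS]] using ka J(2)
    by (simp add: blinfun.minus_right linear_neg[OF J(1)] scaleR_2)
  show thesis
  proof (rule that[of "M 1" "M (- 1)"])
    show "fst (M 1 (0, \<gamma>)) = 0" for \<gamma>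
    proof -
      obtain c where c: "c \<in> S" "(0, \<gamma>) = c + J (- c)" using cov by blast
      show ?thesis unfolding c(2) M[OF c(1) neg[OF c(1)]]
        using J(2) by (simp add: blinfun.minus_right linear_neg[OF J(1)])
    qed
    have "a + J (- a) = a - J a" by (simp add: linear_neg[OF J(1)])
    then have "a + J (- a) \<noteq> 0" using J(6)[OF aS] a0 by auto
    then have "snd (a + J (- a)) \<noteq> 0" using aJ unfolding prod_eq_iff by simp
    moreover have "M 1 (0, snd (a + J (- a))) = (0, snd (a + J (- a)))"
      unfolding aJ[symmetric] by (rule M1)
    ultimately show "\<exists>\<gamma>. \<gamma> \<noteq> 0 \<and> M 1 (0, \<gamma>) = (0, \<gamma>)" by blast
    have "fst a \<noteq> 0"
    proof
      assume "fst a = 0"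
      then have "a \<in> S \<inter> {a. fst a = 0}" using aS by simp
      then show False using a0 unfolding transversal by simp
    qed
    then have "fst (M (- 1) (0, snd (a + J (- a)))) \<noteq> 0"
      using M2 unfolding aJ[symmetric] by (metis scaleR_eq_0_iff zero_neq_numeral)
    then show "\<exists>\<gamma>. fst (M (- 1) (0, \<gamma>)) \<noteq> 0" by (rule exI)
    show "gen_paracomplex (M 1)" "gen_paracomplex (M (- 1))" by (rule pc, simp)+
    show "blinfun_apply (M 1) ` S \<subseteq> S" "blinfun_apply (M (- 1)) ` S \<subseteq> S" by (rule MS)+
  qed
qed

end

section \<open>Coordinates on the generalized tangent bundle\<close>

lemma bounded_linear_gchange: "bounded_linear (gchange c d r)"
  unfolding gchange_def
  by (intro bounded_linear_Pair bounded_linear_compose[OF blinfun.bounded_linear_right] bounded_linear_fst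
      bounded_linear_compose[OF bounded_bilinear.bounded_linear_left[OF bounded_bilinear_blinfun_compose]]
      bounded_linear_snd)

lemma echange_apply:
  "blinfun_apply (echange c d r L) a = gchange c d r (L (gchange d c r a))"
  unfolding echange_def
  by (subst bounded_linear_Blinfun_apply)
    (intro bounded_linear_compose[OF bounded_linear_gchange]
      bounded_linear_compose[OF blinfun.bounded_linear_right] bounded_linear_gchange, rule refl)

locale manifold =
  fixes \<A> :: "('m::{t2_space, second_countable_topology}, 'e::euclidean_space) chart set"
  assumes smooth: "smooth_manifold \<A>"
begin

lemma chart_at: "chart_at \<A> p \<in> \<A>" "p \<in> fst (chart_at \<A> p)"
proof -
  have "p \<in> (\<Union>c\<in>\<A>. fst c)" using smooth unfolding smooth_manifold_def by simp
  then have "\<exists>c. c \<in> \<A> \<and> p \<in> fst c" by blast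
  from someI_ex[OF this] show "chart_at \<A> p \<in> \<A>" "p \<in> fst (chart_at \<A> p)"
    unfolding chart_at_def by blast+
qed

lemma chart:
  assumes "c \<in> \<A>"
  shows "open (fst c)" "open (snd c ` fst c)" "continuous_on (fst c) (snd c)"
    "continuous_on (snd c ` fst c) (chart_inv c)"
    "\<And>r. r \<in> fst c \<Longrightarrow> chart_inv c (snd c r) = r"
    "\<And>y. y \<in> snd c ` fst c \<Longrightarrow> snd c (chart_inv c y) = y"
    "\<And>y. y \<in> snd c ` fst c \<Longrightarrow> chart_inv c y \<in> fst c"
proof -
  have "open (fst c) \<and> open (snd c ` fst c) \<and>
      homeomorphism (fst c) (snd c ` fst c) (snd c) (chart_inv c)"
    using smooth assms unfolding smooth_manifold_def by blast
  then show "open (fst c)" "open (snd c ` fst c)" "continuous_on (fst c) (snd c)"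
    "continuous_on (snd c ` fst c) (chart_inv c)"
    "\<And>r. r \<in> fst c \<Longrightarrow> chart_inv c (snd c r) = r"
    "\<And>y. y \<in> snd c ` fst c \<Longrightarrow> snd c (chart_inv c y) = y"
    "\<And>y. y \<in> snd c ` fst c \<Longrightarrow> chart_inv c y \<in> fst c"
    unfolding homeomorphism_def by auto
qed

lemma inv_tendsto:
  assumes "c \<in> \<A>" "r \<in> fst c"
  shows "filterlim (chart_inv c) (nhds r) (nhds (snd c r))"
proof -
  have "isCont (chart_inv c) (snd c r)"
    using continuous_on_eq_continuous_at[OF chart(2)[OF assms(1)], THEN iffD1, OF chart(4)[OF assms(1)]]
      assms(2) by blast
  then show ?thesis
    using chart(5)[OF assms] unfolding isCont_def tendsto_at_iff_tendsto_nhds by simp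
qed

lemma coord_tendsto:
  assumes "c \<in> \<A>" "r \<in> fst c"
  shows "filterlim (snd c) (nhds (snd c r)) (nhds r)"
proof -
  have "isCont (snd c) r"
    using continuous_on_eq_continuous_at[OF chart(1)[OF assms(1)], THEN iffD1, OF chart(3)[OF assms(1)]]
      assms(2) by blast
  then show ?thesis unfolding isCont_def tendsto_at_iff_tendsto_nhds .
qed

lemma eventually_coord:
  assumes "c \<in> \<A>" "r \<in> fst c" "\<forall>\<^sub>F q in nhds r. P q"
  shows "\<forall>\<^sub>F y in nhds (snd c r). y \<in> snd c ` fst c \<and> P (chart_inv c y)"
proof -
  have "\<forall>\<^sub>F y in nhds (snd c r). y \<in> snd c ` fst c"
    using chart(2)[OF assms(1)] assms(2) eventually_nhds_in_open by blast
  moreover have "\<forall>\<^sub>F y in nhds (snd c r). P (chart_inv c y)"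
    by (rule eventually_compose_filterlim[OF assms(3) inv_tendsto[OF assms(1,2)]])
  ultimately show ?thesis by (rule eventually_conj)
qed

lemma eventually_point:
  assumes "c \<in> \<A>" "r \<in> fst c" "\<forall>\<^sub>F y in nhds (snd c r). P y"
  shows "\<forall>\<^sub>F q in nhds r. q \<in> fst c \<and> P (snd c q)"
proof -
  have "\<forall>\<^sub>F q in nhds r. q \<in> fst c"
    using chart(1)[OF assms(1)] assms(2) eventually_nhds_in_open by blast
  moreover have "\<forall>\<^sub>F q in nhds r. P (snd c q)"
    by (rule eventually_compose_filterlim[OF assms(3) coord_tendsto[OF assms(1,2)]])
  ultimately show ?thesis by (rule eventually_conj)
qed

text \<open>The transition maps are smooth on the overlap, whence the Jacobians obey the chain rule and those of
  inverse transitions are inverse to each other.\<close>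

lemma jac_has_derivative:
  assumes "c \<in> \<A>" "d \<in> \<A>" "r \<in> fst c" "r \<in> fst d"
  shows "((snd d \<circ> chart_inv c) has_derivative blinfun_apply (jac c d r)) (at (snd c r))"
proof -
  have "smooth_on (snd c ` (fst c \<inter> fst d)) (snd d \<circ> chart_inv c)"
    using smooth assms(1,2) unfolding smooth_manifold_def by blast
  then have "Ck_on (Suc 0) (snd c ` (fst c \<inter> fst d)) (snd d \<circ> chart_inv c)"
    unfolding smooth_on_def by blast
  moreover have "snd c r \<in> snd c ` (fst c \<inter> fst d)" using assms by blast
  ultimately have d: "((snd d \<circ> chart_inv c) has_derivative
      frechet_derivative (snd d \<circ> chart_inv c) (at (snd c r))) (at (snd c r))"
    by (rule Ck_on_has_derivative)
  then show ?thesis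
    unfolding jac_def using bounded_linear_Blinfun_apply[OF has_derivative_bounded_linear[OF d]] by simp
qed

lemma jac_self: "c \<in> \<A> \<Longrightarrow> r \<in> fst c \<Longrightarrow> jac c c r = id_blinfun"
proof -
  assume c: "c \<in> \<A>" "r \<in> fst c"
  have "frechet_derivative (snd c \<circ> chart_inv c) (at (snd c r)) = frechet_derivative (\<lambda>y. y) (at (snd c r))"
    by (rule frechet_derivative_transform_eventually)
      (rule eventually_mono[OF eventually_coord[OF c always_eventually[of "\<lambda>_. True"]]],
        use chart(6)[OF c(1)] in auto)
  then show ?thesis unfolding jac_def by (simp add: id_blinfun.abs_eq)
qed

lemma jac_inverse:
  assumes "c \<in> \<A>" "d \<in> \<A>" "r \<in> fst c" "r \<in> fst d"
  shows "jac d c r o\<^sub>L jac c d r = id_blinfun"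
proof -
  let ?f = "snd d \<circ> chart_inv c" and ?g = "snd c \<circ> chart_inv d"
  have fr: "?f (snd c r) = snd d r" using chart(5)[OF assms(1,3)] by simp
  have "((?g \<circ> ?f) has_derivative (blinfun_apply (jac d c r) \<circ> blinfun_apply (jac c d r))) (at (snd c r))"
    by (rule diff_chain_at[OF jac_has_derivative[OF assms]])
      (simp only: fr jac_has_derivative[OF assms(2,1,4,3)])
  moreover have "\<forall>\<^sub>F y in nhds (snd c r). y \<in> snd c ` fst c \<and> chart_inv c y \<in> fst d"
    by (rule eventually_coord[OF assms(1,3)])
      (rule eventually_nhds_in_open[OF chart(1)[OF assms(2)] assms(4)])
  then have "\<forall>\<^sub>F y in nhds (snd c r). (?g \<circ> ?f) y = y"
    by (rule eventually_mono) (use chart(5)[OF assms(2)] chart(6)[OF assms(1)] in auto)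
  then have "frechet_derivative (?g \<circ> ?f) (at (snd c r)) = frechet_derivative (\<lambda>y. y) (at (snd c r))"
    by (rule frechet_derivative_transform_eventually)
  ultimately have "blinfun_apply (jac d c r) \<circ> blinfun_apply (jac c d r) = (\<lambda>y. y)"
    using frechet_derivative_at by (metis frechet_derivative_ident)
  then show ?thesis by (intro blinfun_eqI) (simp add: fun_eq_iff)
qed

lemma gchange_self: "c \<in> \<A> \<Longrightarrow> r \<in> fst c \<Longrightarrow> gchange c c r a = a"
  by (simp add: gchange_def jac_self prod_eq_iff blinfun_eqI)

lemma gchange_inverse:
  assumes "c \<in> \<A>" "d \<in> \<A>" "r \<in> fst c" "r \<in> fst d"
  shows "gchange d c r (gchange c d r a) = a"
proof -
  have j: "jac d c r (jac c d r v) = v" for v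
    using jac_inverse[OF assms] by (metis blinfun_apply_blinfun_compose blinfun_apply_id_blinfun)
  show ?thesis by (simp add: gchange_def prod_eq_iff j blinfun_eqI)
qed

lemma pairing_gchange:
  assumes "c \<in> \<A>" "d \<in> \<A>" "r \<in> fst c" "r \<in> fst d"
  shows "pairing (gchange c d r a) (gchange c d r b) = pairing a b"
proof -
  have j: "jac d c r (jac c d r v) = v" for v
    using jac_inverse[OF assms] by (metis blinfun_apply_blinfun_compose blinfun_apply_id_blinfun)
  show ?thesis by (simp add: gchange_def pairing_def j)
qed

end

text \<open>Everything is computed in the preferred chart \<open>c\<close> of one point \<open>p\<close>, whose coordinates are \<open>x0\<close>; \<open>pt\<close>
  is the inverse of the chart. An element of \<open>T\<^sub>rM \<oplus> T\<^sub>r\<^sup>*M\<close> is stored in the preferred chart of \<open>r\<close>, so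
  \<open>to r\<close> and \<open>fr r\<close> translate into and out of the chart \<open>c\<close>; they preserve the pairing. By \<open>coord\<close> and
  \<open>sec\<close> sections near \<open>p\<close> become functions of the coordinates, for which smoothness is smoothness
  of the germ at \<open>x0\<close>.\<close>

locale manifold_point = manifold \<A>
  for \<A> :: "('m::{t2_space, second_countable_topology}, 'e::euclidean_space) chart set" +
  fixes p :: 'm
begin

definition c where "c = chart_at \<A> p"
definition x0 where "x0 = snd c p"
definition pt where "pt = chart_inv c"
definition to where "to r = gchange (chart_at \<A> r) c r"
definition fr where "fr r = gchange c (chart_at \<A> r) r"

definition coord :: "('m \<Rightarrow> 'e gtv) \<Rightarrow> 'e \<Rightarrow> 'e gtv" where
  "coord s y = to (pt y) (s (pt y))"

definition sec :: "('e \<Rightarrow> 'e gtv) \<Rightarrow> 'm \<Rightarrow> 'e gtv" where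
  "sec S r = fr r (S (snd c r))"

definition img where "img = snd c ` fst c"

lemma c: "c \<in> \<A>" "p \<in> fst c"
  unfolding c_def by (rule chart_at)+

lemma pt: "y \<in> img \<Longrightarrow> snd c (pt y) = y" "y \<in> img \<Longrightarrow> pt y \<in> fst c" "pt x0 = p" "x0 \<in> img" "open img"
  using chart[OF c(1)] c(2) unfolding pt_def img_def x0_def by auto

lemma near: "\<forall>\<^sub>F r in nhds p. P r \<Longrightarrow> \<forall>\<^sub>F y in nhds x0. y \<in> img \<and> P (pt y)"
  unfolding x0_def img_def pt_def by (rule eventually_coord[OF c])

lemma near_img: "\<forall>\<^sub>F y in nhds x0. y \<in> img"
  by (rule eventually_nhds_in_open[OF pt(5,4)])

lemma near_point: "\<forall>\<^sub>F y in nhds x0. P y \<Longrightarrow> \<forall>\<^sub>F r in nhds p. r \<in> fst c \<and> P (snd c r)"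
  unfolding x0_def by (rule eventually_point[OF c])

lemma at_point: "\<forall>\<^sub>F y in nhds x0. P y \<Longrightarrow> P x0"
  by (rule eventually_nhds_x_imp_x)

lemma to_fr: "r \<in> fst c \<Longrightarrow> to r (fr r a) = a" "r \<in> fst c \<Longrightarrow> fr r (to r a) = a"
  unfolding to_def fr_def using gchange_inverse chart_at c(1) by auto

lemma to_p: "to p a = a" "fr p a = a"
  unfolding to_def fr_def using gchange_self[OF c] c_def by simp_all

lemma pairing_to: "r \<in> fst c \<Longrightarrow> pairing (to r a) (to r b) = pairing a b"
  "r \<in> fst c \<Longrightarrow> pairing (fr r a) (fr r b) = pairing a b"
  unfolding to_def fr_def using pairing_gchange chart_at c(1) by auto

lemma bounded_linear_to: "bounded_linear (to r)" "bounded_linear (fr r)"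
  unfolding to_def fr_def by (rule bounded_linear_gchange)+

lemmas linear_to = bounded_linear_to[THEN bounded_linear.linear]

lemma smooth_near_iff: "smooth_near c p F \<longleftrightarrow> smooth_at x0 (\<lambda>y. F (pt y))"
proof
  assume "smooth_near c p F"
  then show "smooth_at x0 (\<lambda>y. F (pt y))"
    unfolding smooth_near_def smooth_at_def x0_def pt_def o_def by blast
next
  assume "smooth_at x0 (\<lambda>y. F (pt y))"
  then obtain W where W: "open W" "x0 \<in> W" "smooth_on W (\<lambda>y. F (pt y))" unfolding smooth_at_def by blast
  have "Ck_on k (W \<inter> img) (\<lambda>y. F (pt y))" for k
    using W(3) Ck_on_subset[of k W "\<lambda>y. F (pt y)" "W \<inter> img"] unfolding smooth_on_def by simp
  then have "smooth_on (W \<inter> img) (\<lambda>y. F (pt y))" unfolding smooth_on_def by blast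
  then show "smooth_near c p F"
    unfolding smooth_near_def x0_def[symmetric] pt_def[symmetric] o_def img_def[symmetric]
    using W(1,2) pt(4,5) by (intro exI[of _ "W \<inter> img"]) (simp add: open_Int)
qed

lemma smooth_sec_near_iff: "smooth_sec_near \<A> p s \<longleftrightarrow> smooth_at x0 (coord s)"
  unfolding smooth_sec_near_def c_def[symmetric] smooth_near_iff coord_def to_def ..

lemma smooth_fun_near_iff: "smooth_fun_near \<A> p f \<longleftrightarrow> smooth_at x0 (\<lambda>y. f (pt y))"
  unfolding smooth_fun_near_def c_def[symmetric] smooth_near_iff ..

lemma smooth_end_near_iff: "smooth_end_near \<A> p \<sigma> \<longleftrightarrow> smooth_at x0 (\<lambda>y. end_coord \<A> p \<sigma> (pt y))"
  unfolding smooth_end_near_def c_def[symmetric] smooth_near_iff ..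

lemma dir_deriv_eq: "dir_deriv c p X F = frechet_derivative (\<lambda>y. F (pt y)) (at x0) X"
  unfolding dir_deriv_def x0_def pt_def o_def ..

lemma coord_sec: "\<forall>\<^sub>F y in nhds x0. coord (sec S) y = S y"
  using near_img by (rule eventually_mono) (simp add: coord_def sec_def to_fr pt)

lemma sec_p: "sec S p = S x0"
  by (simp add: sec_def to_p x0_def)

lemma coord_x0: "coord s x0 = s p"
  by (simp add: coord_def pt to_p)

lemma smooth_sec: "smooth_at x0 S \<Longrightarrow> smooth_sec_near \<A> p (sec S)"
  unfolding smooth_sec_near_iff
  by (rule smooth_at_cong, assumption) (rule eventually_mono[OF coord_sec[of S]], simp)

lemma coord_add: "coord (\<lambda>r. s r + t r) y = coord s y + coord t y"
  by (simp add: coord_def linear_add[OF linear_to(1)])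

lemma coord_diff: "coord (\<lambda>r. s r - t r) y = coord s y - coord t y"
  by (simp add: coord_def linear_diff[OF linear_to(1)])

lemma coord_scaleR: "coord (\<lambda>r. f r *\<^sub>R s r) y = f (pt y) *\<^sub>R coord s y"
  by (simp add: coord_def linear_scale[OF linear_to(1)])

lemma smooth_sec_add: "smooth_sec_near \<A> p s \<Longrightarrow> smooth_sec_near \<A> p t \<Longrightarrow> smooth_sec_near \<A> p (\<lambda>r. s r + t r)"
  unfolding smooth_sec_near_iff using smooth_at_add[of x0 "coord s" "coord t"] by (simp add: coord_add[abs_def])

lemma smooth_sec_diff: "smooth_sec_near \<A> p s \<Longrightarrow> smooth_sec_near \<A> p t \<Longrightarrow> smooth_sec_near \<A> p (\<lambda>r. s r - t r)"
  unfolding smooth_sec_near_iff using smooth_at_diff[of x0 "coord s" "coord t"] by (simp add: coord_diff[abs_def])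

lemma smooth_sec_scaleR:
  "smooth_fun_near \<A> p f \<Longrightarrow> smooth_sec_near \<A> p s \<Longrightarrow> smooth_sec_near \<A> p (\<lambda>r. f r *\<^sub>R s r)"
  unfolding smooth_sec_near_iff smooth_fun_near_iff
  using smooth_at_scaleR[of x0 "\<lambda>y. f (pt y)" "coord s"] by (simp add: coord_scaleR[abs_def])

lemma end_coord_apply:
  "blinfun_apply (end_coord \<A> p \<sigma> (pt y)) a = to (pt y) (\<sigma> (pt y) (fr (pt y) a))"
  unfolding end_coord_def c_def[symmetric] echange_apply to_def fr_def ..

lemma coord_end:
  assumes "y \<in> img"
  shows "coord (\<lambda>r. blinfun_apply (\<sigma> r) (s r)) y = blinfun_apply (end_coord \<A> p \<sigma> (pt y)) (coord s y)"
  using to_fr(2)[OF pt(2)[OF assms]] by (simp add: coord_def end_coord_apply)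

text \<open>A section which vanishes near \<open>p\<close> is unchanged when multiplied by the function which is \<open>0\<close>
  near \<open>p\<close> and \<open>1\<close> elsewhere; so connections are local by the Leibniz rule.\<close>

lemma connection_zero_germ:
  assumes D: "connection \<A> F D" and s: "local_section \<A> F p s" and z: "\<forall>\<^sub>F r in nhds p. s r = 0"
  shows "D p X s = 0"
proof -
  define f :: "'m \<Rightarrow> real" where "f r = (if s r = 0 then 0 else 1)" for r
  have ev: "\<forall>\<^sub>F y in nhds x0. (0 :: real) = f (pt y)"
    using near[OF z] by (rule eventually_mono) (simp add: f_def)
  have "smooth_fun_near \<A> p f"
    unfolding smooth_fun_near_iff by (rule smooth_at_cong[OF smooth_at_const ev])
  then have "D p X (\<lambda>r. f r *\<^sub>R s r) = dir_deriv (chart_at \<A> p) p X f *\<^sub>R s p + f p *\<^sub>R D p X s"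
    using D s unfolding connection_def by blast
  moreover have "(\<lambda>r. f r *\<^sub>R s r) = s" by (rule ext) (simp add: f_def)
  moreover have "s p = 0" using z by (rule eventually_nhds_x_imp_x)
  ultimately show ?thesis by (simp add: f_def)
qed

end

section \<open>Adapted frames\<close>

lemma (in symmetric_form) orthonormal_mono:
  "orthonormal \<epsilon> m b \<Longrightarrow> k \<le> m \<Longrightarrow> orthonormal \<epsilon> k b"
  unfolding orthonormal_def by simp

text \<open>An isometry which matches two frames matches the spans of their initial segments; for adapted frames
  the first half spans \<open>E\<close>.\<close>

lemma (in symmetric_form) transport_span:
  assumes "orthonormal \<epsilon> m b" "k \<le> m" "a \<in> span (b ` {..<k})"
  shows "transport \<epsilon> m b u a \<in> span (u ` {..<k})"
proof -
  obtain d where d: "a = (\<Sum>i<k. d i *\<^sub>R b i)"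
    using in_span_image_imp_sum[OF finite_lessThan assms(3)] by blast
  have "transport \<epsilon> m b u a = (\<Sum>i<k. d i *\<^sub>R u i)"
    unfolding d using assms(2)
    by (simp add: blinfun.sum_right blinfun.scaleR_right transport_basis[OF assms(1)])
  also have "\<dots> \<in> span (u ` {..<k})" by (intro span_sum span_scale span_base) blast
  finally show ?thesis .
qed

locale metric_point = manifold_point \<A> p
  for \<A> :: "('m::{t2_space, second_countable_topology}, 'e::euclidean_space) chart set" and p :: 'm +
  fixes E :: "'m \<Rightarrow> 'e gtv set" and n :: nat
  assumes dim_base: "DIM('e) = 2 * n" and metric: "generalized_metric \<A> n E"
begin

lemma fibre: "metric_fibre (E r) n"
  using metric dim_base unfolding generalized_metric_def smooth_subbundle_def by unfold_locales simp_all

lemma perp_orth: "metric_fibre.perp (E r) = orth E r"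
  unfolding metric_fibre.perp_def[OF fibre] orth_def ..

lemmas subspace_E = metric_fibre.subspace[OF fibre]
lemmas subspace_orth = metric_fibre.subspace_perp[OF fibre, unfolded perp_orth]

lemma pr1_eqI:
  assumes "b \<in> E r" "a - b \<in> orth E r"
  shows "pr1 E r a = b"
  unfolding pr1_def
proof (rule the_equality)
  fix b' assume b': "b' \<in> E r \<and> a - b' \<in> orth E r"
  have "b' - b \<in> E r" using b' assms(1) subspace_diff[OF subspace_E] by blast
  moreover have "b' - b \<in> orth E r"
    using subspace_diff[OF subspace_orth assms(2), of "a - b'"] b' by simp
  ultimately have "b' - b = 0" using metric_fibre.disjoint_perp[OF fibre] unfolding perp_orth by blast
  then show "b' = b" by simp
qed (use assms in blast)

lemma pr1: "pr1 E r a \<in> E r" "a - pr1 E r a \<in> orth E r"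
proof -
  obtain b d where "b \<in> E r" "d \<in> orth E r" "a = b + d"
    using metric_fibre.split_exists[OF fibre[of r], where x = a] unfolding perp_orth by metis
  then show "pr1 E r a \<in> E r" "a - pr1 E r a \<in> orth E r" using pr1_eqI[of b r a] by simp_all
qed

lemma pr1_add: "pr1 E r (a + b) = pr1 E r a + pr1 E r b"
proof (rule pr1_eqI)
  show "pr1 E r a + pr1 E r b \<in> E r" using pr1 subspace_add[OF subspace_E] by blast
  have "a + b - (pr1 E r a + pr1 E r b) = (a - pr1 E r a) + (b - pr1 E r b)" by simp
  then show "a + b - (pr1 E r a + pr1 E r b) \<in> orth E r"
    using pr1(2) subspace_add[OF subspace_orth] by metis
qed

lemma pr1_scaleR: "pr1 E r (k *\<^sub>R a) = k *\<^sub>R pr1 E r a"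
proof (rule pr1_eqI)
  show "k *\<^sub>R pr1 E r a \<in> E r" using pr1 subspace_scale[OF subspace_E] by blast
  show "k *\<^sub>R a - k *\<^sub>R pr1 E r a \<in> orth E r"
    unfolding scaleR_diff_right[symmetric] using pr1(2) subspace_scale[OF subspace_orth] by blast
qed

lemma pr1_self: "a \<in> E r \<Longrightarrow> pr1 E r a = a"
  by (rule pr1_eqI) (simp_all add: subspace_0[OF subspace_orth])

text \<open>Because the two projections are orthogonal, the metric property of \<open>D\<close> follows from those of \<open>D'\<close> and
  \<open>D''\<close>.\<close>

lemma pairing_pr1:
  "pairing a b = pairing (pr1 E r a) (pr1 E r b) + pairing (a - pr1 E r a) (b - pr1 E r b)"
proof -
  have "pairing (pr1 E r a) (b - pr1 E r b) = 0" "pairing (pr1 E r b) (a - pr1 E r a) = 0"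
    using pr1 unfolding orth_def by blast+
  then show ?thesis
    using pairing.sym[of "pr1 E r b" a] pairing.sym[of "pr1 E r b" "pr1 E r a"]
    by (simp add: pairing.diff_left pairing.diff_right)
qed

text \<open>The first \<open>2n\<close> members span \<open>E\<close> (seen in the chart); the others are then orthogonal to it.\<close>

definition adapted :: "(nat \<Rightarrow> real) \<Rightarrow> (nat \<Rightarrow> 'e \<Rightarrow> 'e gtv) \<Rightarrow> 'e \<Rightarrow> bool" where
  "adapted \<epsilon> u y \<longleftrightarrow> y \<in> img \<and> pairing.orthonormal \<epsilon> (2 * n + 2 * n) (\<lambda>i. u i y) \<and>
     span ((\<lambda>i. u i y) ` {..<2 * n}) = to (pt y) ` E (pt y) \<and>
     span ((\<lambda>i. u i y) ` {..<2 * n + 2 * n}) = UNIV"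

text \<open>Start from an adapted orthonormal basis at \<open>p\<close>, extend its first half by combinations of
  sections spanning \<open>E\<close> and its second half by constants, and orthonormalize: the first half
  stays in \<open>E\<close>, hence spans it, and the second half becomes orthogonal to it.\<close>

lemma adapted_frame:
  obtains \<epsilon> u where
    "\<And>i. i < 2 * n + 2 * n \<Longrightarrow> smooth_at x0 (u i)" "\<forall>\<^sub>F y in nhds x0. adapted \<epsilon> u y"
proof -
  obtain \<epsilon> b where b: "pairing.orthonormal \<epsilon> (2 * n + 2 * n) b" "span (b ` {..<2 * n}) = E p"
    "span (b ` {..<2 * n + 2 * n}) = UNIV"
    by (rule metric_fibre.adapted_basis[OF fibre[of p]]) blast
  obtain s where s: "\<And>j. j < 2 * n \<Longrightarrow> smooth_sec_near \<A> p (s j)"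
    and spE: "\<forall>\<^sub>F r in nhds p. E r = span ((\<lambda>j. s j r) ` {..<2 * n})"
    using metric unfolding generalized_metric_def smooth_subbundle_def by blast
  have "\<exists>d. b i = (\<Sum>j<2 * n. d j *\<^sub>R s j p)" if "i < 2 * n" for i
  proof -
    have "b i \<in> span ((\<lambda>j. s j p) ` {..<2 * n})"
      using span_base[of "b i" "b ` {..<2 * n}"] that b(2) eventually_nhds_x_imp_x[OF spE] by simp
    then show ?thesis using in_span_image_imp_sum[OF finite_lessThan] by metis
  qed
  then obtain d where d: "\<And>i. i < 2 * n \<Longrightarrow> b i = (\<Sum>j<2 * n. d i j *\<^sub>R s j p)" by metis
  define w where "w i y = (if i < 2 * n then \<Sum>j<2 * n. d i j *\<^sub>R coord (s j) y else b i)" for i y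
  have w0: "w i x0 = b i" for i unfolding w_def using d by (simp add: coord_x0)
  have sw: "smooth_at x0 (w i)" for i
  proof (cases "i < 2 * n")
    case True
    then have "w i = (\<lambda>y. \<Sum>j<2 * n. d i j *\<^sub>R coord (s j) y)" by (simp add: w_def[abs_def])
    then show ?thesis
      using s by (auto simp: smooth_sec_near_iff intro!: smooth_at_sum smooth_at_scaleR smooth_at_const)
  qed (simp add: w_def[abs_def] smooth_at_const)
  have ow: "pairing.orthonormal \<epsilon> (2 * n + 2 * n) (\<lambda>i. w i x0)" using b(1) by (simp add: w0)
  obtain u where u: "\<And>i. i < 2 * n + 2 * n \<Longrightarrow> smooth_at x0 (u i)"
    and ev: "\<forall>\<^sub>F y in nhds x0. pairing.orthonormal \<epsilon> (2 * n + 2 * n) (\<lambda>i. u i y) \<and>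
        (\<forall>i<2 * n + 2 * n. u i y \<in> span ((\<lambda>j. w j y) ` {..i}))"
    using pairing.smooth_orthonormalization[OF ow sw] by blast
  have "\<forall>\<^sub>F y in nhds x0. adapted \<epsilon> u y"
    using ev near[OF spE]
  proof eventually_elim
    case (elim y)
    let ?r = "pt y" and ?u = "\<lambda>i. u i y" and ?T = "(\<lambda>j. coord (s j) y) ` {..<2 * n}"
    have y: "y \<in> img" and o: "pairing.orthonormal \<epsilon> (2 * n + 2 * n) ?u"
      and E: "E ?r = span ((\<lambda>j. s j ?r) ` {..<2 * n})" using elim by auto
    have "?T = to ?r ` (\<lambda>j. s j ?r) ` {..<2 * n}" unfolding image_image coord_def ..
    then have T: "span ?T = to ?r ` E ?r" unfolding E by (simp only: linear_span_image[OF linear_to(1)])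
    have "?u i \<in> span ?T" if i: "i < 2 * n" for i
    proof -
      have "(\<lambda>j. w j y) ` {..i} \<subseteq> span ?T"
      proof (intro image_subsetI)
        fix j assume "j \<in> {..i}"
        then have "w j y = (\<Sum>k<2 * n. d j k *\<^sub>R coord (s k) y)" using i by (simp add: w_def)
        also have "\<dots> \<in> span ?T" by (intro span_sum span_scale span_base) blast
        finally show "w j y \<in> span ?T" .
      qed
      from span_minimal[OF this subspace_span] show ?thesis using elim i by auto
    qed
    then have "span (?u ` {..<2 * n}) = span ?T"
      using card_image_le[of "{..<2 * n}" "\<lambda>j. coord (s j) y"]
      by (intro pairing.orthonormal_spans[OF pairing.orthonormal_mono[OF o]]) auto
    moreover have "span (?u ` {..<2 * n + 2 * n}) = span (b ` {..<2 * n + 2 * n})"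
      using card_image_le[of "{..<2 * n + 2 * n}" b] b(3)
      by (intro pairing.orthonormal_spans[OF o]) auto
    ultimately show ?case unfolding adapted_def using y o T b(3) by simp
  qed
  then show thesis using that[of u \<epsilon>] u by blast
qed

end

locale framed_point = metric_point \<A> p E n
  for \<A> :: "('m::{t2_space, second_countable_topology}, 'e::euclidean_space) chart set"
    and p :: 'm and E and n +
  fixes \<epsilon> :: "nat \<Rightarrow> real" and u :: "nat \<Rightarrow> 'e \<Rightarrow> 'e gtv"
  assumes smooth_u: "\<And>i. i < 2 * n + 2 * n \<Longrightarrow> smooth_at x0 (u i)"
    and near_adapted: "\<forall>\<^sub>F y in nhds x0. adapted \<epsilon> u y"
begin

abbreviation m where "m \<equiv> 2 * n + 2 * n"

definition b where "b i = u i x0"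

text \<open>\<open>\<Phi> y\<close> is the isometry from \<open>T\<^sub>pM \<oplus> T\<^sub>p\<^sup>*M\<close> to the generalized tangent space at the point
  with coordinates \<open>y\<close> which preserves the frame, and \<open>\<Psi> y\<close> is its inverse.\<close>

definition \<Phi> where "\<Phi> y = pairing.transport \<epsilon> m b (\<lambda>i. u i y)"
definition \<Psi> where "\<Psi> y = pairing.transport \<epsilon> m (\<lambda>i. u i y) b"

lemma adapted_x0: "adapted \<epsilon> u x0"
  using near_adapted by (rule at_point)

lemma ortho_b: "pairing.orthonormal \<epsilon> m b"
  using adapted_x0 unfolding adapted_def b_def by simp

lemma span_b: "span (b ` {..<2 * n}) = E p" "span (b ` {..<m}) = UNIV"
proof -
  have "to p ` E p = E p" by (simp add: to_p)
  then show "span (b ` {..<2 * n}) = E p" "span (b ` {..<m}) = UNIV"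
    using adapted_x0 pt(3) unfolding adapted_def b_def by simp_all
qed

lemma smooth_\<Phi>: "smooth_at x0 \<Phi>"
  unfolding \<Phi>_def[abs_def] by (intro pairing.smooth_at_transport smooth_at_const smooth_u)

lemma smooth_\<Psi>: "smooth_at x0 \<Psi>"
  unfolding \<Psi>_def[abs_def] by (intro pairing.smooth_at_transport smooth_at_const smooth_u)

lemma \<Psi>\<Phi>:
  assumes "adapted \<epsilon> u y"
  shows "\<Psi> y o\<^sub>L \<Phi> y = id_blinfun" "\<Phi> y o\<^sub>L \<Psi> y = id_blinfun"
    "\<Psi> y (\<Phi> y a) = a" "\<Phi> y (\<Psi> y a) = a"
proof -
  have o: "pairing.orthonormal \<epsilon> m (\<lambda>i. u i y)" "span ((\<lambda>i. u i y) ` {..<m}) = UNIV"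
    using assms unfolding adapted_def by auto
  show 1: "\<Psi> y o\<^sub>L \<Phi> y = id_blinfun" "\<Phi> y o\<^sub>L \<Psi> y = id_blinfun"
    unfolding \<Phi>_def \<Psi>_def
    using pairing.transport_inverse[OF ortho_b o(1) span_b(2)] pairing.transport_inverse[OF o(1) ortho_b o(2)]
    by simp_all
  show "\<Psi> y (\<Phi> y a) = a" "\<Phi> y (\<Psi> y a) = a"
    using 1 by (metis blinfun_apply_blinfun_compose blinfun_apply_id_blinfun)+
qed

lemma \<Phi>_x0: "\<Phi> x0 = id_blinfun"
proof (rule blinfun_eqI)
  fix a
  have "\<Phi> x0 a = (\<Sum>i<m. (\<epsilon> i * pairing a (b i)) *\<^sub>R b i)"
    unfolding \<Phi>_def pairing.transport_apply b_def ..
  then show "\<Phi> x0 a = id_blinfun a" using pairing.orthonormal_expand[OF ortho_b, of a] span_b(2) by simp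
qed

lemma \<Psi>_x0: "\<Psi> x0 = id_blinfun"
  using \<Phi>_x0 unfolding \<Phi>_def \<Psi>_def b_def by simp

lemma adjoint_\<Phi>: "pairing (\<Phi> y a) d = pairing a (\<Psi> y d)"
  unfolding \<Phi>_def \<Psi>_def by (rule pairing.transport_adjoint)

lemma \<Phi>_E:
  assumes y: "adapted \<epsilon> u y" and a: "a \<in> E p"
  shows "\<Phi> y a \<in> to (pt y) ` E (pt y)"
proof -
  have "a \<in> span (b ` {..<2 * n})" using a span_b(1) by simp
  from pairing.transport_span[OF ortho_b _ this, of "\<lambda>i. u i y"]
  show ?thesis using y unfolding \<Phi>_def adapted_def by simp
qed

lemma \<Psi>_E:
  assumes y: "adapted \<epsilon> u y" and a: "a \<in> to (pt y) ` E (pt y)"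
  shows "\<Psi> y a \<in> E p"
proof -
  have o: "pairing.orthonormal \<epsilon> m (\<lambda>i. u i y)" and s: "span ((\<lambda>i. u i y) ` {..<2 * n}) = to (pt y) ` E (pt y)"
    using y unfolding adapted_def by auto
  have "a \<in> span ((\<lambda>i. u i y) ` {..<2 * n})" using a s by simp
  from pairing.transport_span[OF o _ this, of b] show ?thesis unfolding \<Psi>_def span_b(1) by simp
qed

text \<open>The endomorphism \<open>\<Phi> L \<Phi>\<^sup>-\<^sup>1\<close> at the point with coordinates \<open>y\<close>, stored in the preferred chart of that
  point. Constant \<open>L\<close> gives the sections of the endomorphism bundle which are constant in the frame.\<close>

definition moved :: "'e \<Rightarrow> 'e gend \<Rightarrow> 'e gend" where
  "moved y L = echange c (chart_at \<A> (pt y)) (pt y) (\<Phi> y o\<^sub>L L o\<^sub>L \<Psi> y)"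

lemma moved_apply: "blinfun_apply (moved y L) a = fr (pt y) (\<Phi> y (L (\<Psi> y (to (pt y) a))))"
  unfolding moved_def echange_apply fr_def to_def by simp

lemma pt_adapted: "adapted \<epsilon> u y \<Longrightarrow> pt y \<in> fst c"
  unfolding adapted_def using pt(2) by blast

lemma moved_skew:
  assumes y: "adapted \<epsilon> u y" and L: "skew_end L"
  shows "skew_end (moved y L)"
proof (rule skew_endI)
  fix a d
  let ?r = "pt y"
  note r = pt_adapted[OF y]
  have "pairing (moved y L a) d = pairing (\<Phi> y (L (\<Psi> y (to ?r a)))) (to ?r d)"
    unfolding moved_apply using pairing_to(1)[OF r, of "fr ?r (\<Phi> y (L (\<Psi> y (to ?r a))))" d] to_fr(1)[OF r] by simp
  also have "\<dots> = - pairing (\<Psi> y (to ?r a)) (L (\<Psi> y (to ?r d)))"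
    unfolding adjoint_\<Phi> by (rule skew_endD[OF L])
  also have "\<dots> = - pairing (to ?r a) (\<Phi> y (L (\<Psi> y (to ?r d))))"
    using adjoint_\<Phi>[of y "L (\<Psi> y (to ?r d))" "to ?r a"] pairing.sym by metis
  also have "\<dots> = - pairing a (moved y L d)"
    unfolding moved_apply using pairing_to(1)[OF r, of a "fr ?r (\<Phi> y (L (\<Psi> y (to ?r d))))"] to_fr(1)[OF r] by simp
  finally show "pairing (moved y L a) d = - pairing a (moved y L d)" .
qed

lemma moved_E:
  assumes y: "adapted \<epsilon> u y" and L: "blinfun_apply L ` E p \<subseteq> E p"
  shows "blinfun_apply (moved y L) ` E (pt y) \<subseteq> E (pt y)"
proof
  fix x assume "x \<in> blinfun_apply (moved y L) ` E (pt y)"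
  then obtain a where a: "a \<in> E (pt y)" "x = fr (pt y) (\<Phi> y (L (\<Psi> y (to (pt y) a))))"
    unfolding moved_apply by blast
  have "L (\<Psi> y (to (pt y) a)) \<in> E p" using \<Psi>_E[OF y imageI[OF a(1)]] L by blast
  from \<Phi>_E[OF y this] obtain d where "d \<in> E (pt y)" "\<Phi> y (L (\<Psi> y (to (pt y) a))) = to (pt y) d" by blast
  then show "x \<in> E (pt y)" using a(2) to_fr(2)[OF pt_adapted[OF y]] by simp
qed

lemma moved_compose:
  assumes y: "adapted \<epsilon> u y"
  shows "moved y L o\<^sub>L moved y M = moved y (L o\<^sub>L M)"
  by (rule blinfun_eqI) (simp add: moved_apply to_fr(1)[OF pt_adapted[OF y]] \<Psi>\<Phi>[OF y])

lemma moved_id: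
  assumes y: "adapted \<epsilon> u y"
  shows "moved y id_blinfun = id_blinfun"
  by (rule blinfun_eqI) (simp add: moved_apply to_fr(2)[OF pt_adapted[OF y]] \<Psi>\<Phi>[OF y])

lemma moved_reflector:
  assumes y: "adapted \<epsilon> u y" and L: "(p, L) \<in> reflector_space E"
  shows "(pt y, moved y L) \<in> reflector_space E"
  using L moved_skew[OF y] moved_E[OF y] moved_compose[OF y, of L L] moved_id[OF y]
  unfolding reflector_space_def gen_paracomplex_def by auto

lemma moved_adjoint:
  assumes y: "adapted \<epsilon> u y" and L: "skew_end L" "blinfun_apply L ` E p \<subseteq> E p"
  shows "moved y L \<in> adjoint_fibre E (pt y)"
proof -
  have "blinfun_apply (moved y L) ` orth E (pt y) \<subseteq> orth E (pt y)"
    using skew_end_perp[OF moved_skew[OF y L(1)] moved_E[OF y L(2)]] unfolding orth_def by blast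
  then show ?thesis using moved_skew[OF y L(1)] moved_E[OF y L(2)] unfolding adjoint_fibre_def by blast
qed

lemma echange_moved:
  assumes y: "adapted \<epsilon> u y"
  shows "echange (chart_at \<A> (pt y)) c (pt y) (moved y L) = \<Phi> y o\<^sub>L L o\<^sub>L \<Psi> y"
  by (rule blinfun_eqI) (simp add: echange_apply moved_apply to_fr(1)[OF pt_adapted[OF y]] to_def[symmetric] fr_def[symmetric])

section \<open>The induced connection in an adapted frame\<close>

text \<open>Orthogonal expansion in the first half of the frame expresses the projection to \<open>E\<close> by smooth
  functions.\<close>

lemma smooth_pr1:
  assumes s: "smooth_sec_near \<A> p s"
  shows "smooth_sec_near \<A> p (\<lambda>r. pr1 E r (s r))"
  unfolding smooth_sec_near_iff
proof (rule smooth_at_cong)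
  have "smooth_at x0 (coord s)" using s unfolding smooth_sec_near_iff .
  then show "smooth_at x0 (\<lambda>y. \<Sum>i<2 * n. (\<epsilon> i * pairing (coord s y) (u i y)) *\<^sub>R u i y)"
    using smooth_u
    by (intro smooth_at_sum smooth_at_scaleR smooth_at_bilinear[OF bounded_bilinear_mult] smooth_at_const
        smooth_at_bilinear[OF bounded_bilinear_pairing]) auto
  show "\<forall>\<^sub>F y in nhds x0. (\<Sum>i<2 * n. (\<epsilon> i * pairing (coord s y) (u i y)) *\<^sub>R u i y)
      = coord (\<lambda>r. pr1 E r (s r)) y"
    using near_adapted
  proof eventually_elim
    case (elim y)
    let ?r = "pt y" and ?a = "pr1 E (pt y) (s (pt y))"
    have o: "pairing.orthonormal \<epsilon> (2 * n) (\<lambda>i. u i y)"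
      and sp: "span ((\<lambda>i. u i y) ` {..<2 * n}) = to ?r ` E ?r"
      using elim pairing.orthonormal_mono[of \<epsilon> m _ "2 * n"] unfolding adapted_def by auto
    have "pairing (to ?r ?a) (u i y) = pairing (coord s y) (u i y)" if "i < 2 * n" for i
    proof -
      have "u i y \<in> span ((\<lambda>i. u i y) ` {..<2 * n})" using that by (intro span_base) auto
      then obtain e where e: "e \<in> E ?r" "u i y = to ?r e" using sp by auto
      have "pairing e (s ?r - ?a) = 0" using pr1(2) e(1) unfolding orth_def by blast
      then have "pairing e (s ?r) = pairing e ?a" by (simp add: pairing.diff_right)
      then show ?thesis
        unfolding e(2) coord_def pairing_to(1)[OF pt_adapted[OF elim]] using pairing.sym by metis
    qed
    moreover have "to ?r ?a \<in> span ((\<lambda>i. u i y) ` {..<2 * n})" unfolding sp using pr1(1) by blast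
    ultimately show ?case
      using pairing.orthonormal_expand[OF o, of "to ?r ?a"] by (simp add: coord_def)
  qed
qed

lemma local_section_pr1:
  assumes "smooth_sec_near \<A> p s"
  shows "local_section \<A> E p (\<lambda>r. pr1 E r (s r))" "local_section \<A> (orth E) p (\<lambda>r. s r - pr1 E r (s r))"
  unfolding local_section_def
  using smooth_pr1[OF assms] smooth_sec_diff[OF assms smooth_pr1[OF assms]] pr1 by simp_all

end

locale connected_point = framed_point \<A> p E n \<epsilon> u
  for \<A> :: "('m::{t2_space, second_countable_topology}, 'e::euclidean_space) chart set"
    and p :: 'm and E and n and \<epsilon> and u +
  fixes D' D'' :: "('m, 'e) conn"
  assumes metric': "metric_connection \<A> E pairing D'"
    and metric'': "metric_connection \<A> (orth E) (\<lambda>a b. - pairing a b) D''"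
begin

abbreviation D where "D \<equiv> sum_conn E D' D''"

abbreviation s' where "s' s \<equiv> \<lambda>r. pr1 E r (s r)"
abbreviation s'' where "s'' s \<equiv> \<lambda>r. s r - pr1 E r (s r)"

lemma conn': "connection \<A> E D'" and conn'': "connection \<A> (orth E) D''"
  using metric' metric'' unfolding metric_connection_def by blast+

lemma connD:
  assumes "connection \<A> F K" "local_section \<A> F p s"
  shows "linear (\<lambda>X. K p X s)" "K p X s \<in> F p"
    "local_section \<A> F p t \<Longrightarrow> K p X (\<lambda>r. s r + t r) = K p X s + K p X t"
    "smooth_fun_near \<A> p f \<Longrightarrow>
      K p X (\<lambda>r. f r *\<^sub>R s r) = dir_deriv c p X f *\<^sub>R s p + f p *\<^sub>R K p X s"
  using assms unfolding connection_def c_def by blast+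

lemma D_linear:
  assumes "smooth_sec_near \<A> p s"
  shows "linear (\<lambda>X. D p X s)"
  unfolding sum_conn_def
  using connD(1)[OF conn' local_section_pr1(1)[OF assms]] connD(1)[OF conn'' local_section_pr1(2)[OF assms]]
  by (rule linear_compose_add)

lemma D_add:
  assumes s: "smooth_sec_near \<A> p s" and t: "smooth_sec_near \<A> p t"
  shows "D p X (\<lambda>r. s r + t r) = D p X s + D p X t"
proof -
  have "s' (\<lambda>r. s r + t r) = (\<lambda>r. s' s r + s' t r)" "s'' (\<lambda>r. s r + t r) = (\<lambda>r. s'' s r + s'' t r)"
    by (simp_all add: pr1_add algebra_simps)
  then show ?thesis
    unfolding sum_conn_def
    using connD(3)[OF conn' local_section_pr1(1)[OF s] local_section_pr1(1)[OF t]]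
      connD(3)[OF conn'' local_section_pr1(2)[OF s] local_section_pr1(2)[OF t]] by simp
qed

lemma D_scaleR:
  assumes s: "smooth_sec_near \<A> p s" and f: "smooth_fun_near \<A> p f"
  shows "D p X (\<lambda>r. f r *\<^sub>R s r) = dir_deriv c p X f *\<^sub>R s p + f p *\<^sub>R D p X s"
proof -
  have "s' (\<lambda>r. f r *\<^sub>R s r) = (\<lambda>r. f r *\<^sub>R s' s r)" "s'' (\<lambda>r. f r *\<^sub>R s r) = (\<lambda>r. f r *\<^sub>R s'' s r)"
    by (simp_all add: pr1_scaleR scaleR_diff_right)
  then have "D p X (\<lambda>r. f r *\<^sub>R s r) = (dir_deriv c p X f *\<^sub>R s' s p + f p *\<^sub>R D' p X (s' s))
      + (dir_deriv c p X f *\<^sub>R s'' s p + f p *\<^sub>R D'' p X (s'' s))"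
    unfolding sum_conn_def
    using connD(4)[OF conn' local_section_pr1(1)[OF s] f] connD(4)[OF conn'' local_section_pr1(2)[OF s] f]
    by simp
  then show ?thesis unfolding sum_conn_def by (simp add: algebra_simps)
qed

text \<open>Only the values of a section near \<open>p\<close> matter. This allows expanding a section in the frame, which
  is possible near \<open>p\<close> only.\<close>

lemma D_zero_germ:
  assumes s: "smooth_sec_near \<A> p s" and z: "\<forall>\<^sub>F r in nhds p. s r = 0"
  shows "D p X s = 0"
proof -
  have pr0: "pr1 E r 0 = 0" for r by (rule pr1_self) (rule subspace_0[OF subspace_E])
  have "D' p X (s' s) = 0"
    by (rule connection_zero_germ[OF conn' local_section_pr1(1)[OF s] eventually_mono[OF z]]) (simp add: pr0)
  moreover have "D'' p X (s'' s) = 0"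
    by (rule connection_zero_germ[OF conn'' local_section_pr1(2)[OF s] eventually_mono[OF z]]) (simp add: pr0)
  ultimately show ?thesis unfolding sum_conn_def by simp
qed

lemma D_cong:
  assumes s: "smooth_sec_near \<A> p s" and t: "smooth_sec_near \<A> p t" and e: "\<forall>\<^sub>F r in nhds p. s r = t r"
  shows "D p X s = D p X t"
proof -
  have "D p X (\<lambda>r. t r + (s r - t r)) = D p X t + D p X (\<lambda>r. s r - t r)"
    by (rule D_add[OF t smooth_sec_diff[OF s t]])
  moreover have "D p X (\<lambda>r. s r - t r) = 0"
    by (rule D_zero_germ[OF smooth_sec_diff[OF s t]]) (rule eventually_mono[OF e], simp)
  ultimately show ?thesis by simp
qed

lemma smooth_zero: "smooth_sec_near \<A> p (\<lambda>r. 0)"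
  unfolding smooth_sec_near_iff coord_def[abs_def]
  by (simp add: linear_0[OF linear_to(1)] smooth_at_const)

lemma D_sum:
  assumes "\<And>i. i < k \<Longrightarrow> smooth_sec_near \<A> p (s i)"
  shows "smooth_sec_near \<A> p (\<lambda>r. \<Sum>i<k. s i r) \<and> D p X (\<lambda>r. \<Sum>i<(k::nat). s i r) = (\<Sum>i<k. D p X (s i))"
  using assms
proof (induction k)
  case 0
  then show ?case using smooth_zero D_zero_germ[OF smooth_zero] by simp
next
  case (Suc k)
  then have "smooth_sec_near \<A> p (\<lambda>r. \<Sum>i<k. s i r)" "smooth_sec_near \<A> p (s k)"
    "D p X (\<lambda>r. \<Sum>i<k. s i r) = (\<Sum>i<k. D p X (s i))" by auto
  then show ?case using D_add smooth_sec_add by simp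
qed

text \<open>Near \<open>p\<close> the component of \<open>s\<close> in \<open>E\<^sup>\<bottom>\<close> vanishes, so \<open>D''\<close> contributes nothing.\<close>

lemma D_E:
  assumes s: "smooth_sec_near \<A> p s" and e: "\<forall>\<^sub>F r in nhds p. s r \<in> E r"
  shows "D p X s \<in> E p"
proof -
  have "D'' p X (s'' s) = 0"
    by (rule connection_zero_germ[OF conn'' local_section_pr1(2)[OF s] eventually_mono[OF e]])
      (simp add: pr1_self)
  then show ?thesis
    unfolding sum_conn_def using connD(2)[OF conn' local_section_pr1(1)[OF s]] by simp
qed

lemma frechet_pairing_to:
  "frechet_derivative (\<lambda>y. pairing (s (pt y)) (t (pt y))) (at x0)
    = frechet_derivative (\<lambda>y. pairing (coord s y) (coord t y)) (at x0)"
  by (rule frechet_derivative_transform_eventually)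
    (rule eventually_mono[OF near_img], simp add: coord_def pairing_to(1)[OF pt(2)])

lemma D_metric:
  assumes s: "smooth_sec_near \<A> p s" and t: "smooth_sec_near \<A> p t"
  shows "frechet_derivative (\<lambda>y. pairing (coord s y) (coord t y)) (at x0) X
    = pairing (D p X s) (t p) + pairing (s p) (D p X t)"
proof -
  note ls = local_section_pr1[OF s] local_section_pr1[OF t]
  have smp: "smooth_at x0 (\<lambda>y. pairing (coord s y) (coord t y))"
    if "smooth_sec_near \<A> p s" "smooth_sec_near \<A> p t" for s t
    using that unfolding smooth_sec_near_iff by (rule smooth_at_bilinear[OF bounded_bilinear_pairing])
  let ?f' = "\<lambda>y. pairing (coord (s' s) y) (coord (s' t) y)"
  let ?f'' = "\<lambda>y. pairing (coord (s'' s) y) (coord (s'' t) y)"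
  have sm: "smooth_at x0 ?f'" "smooth_at x0 ?f''"
    using ls unfolding local_section_def by (blast intro: smp)+
  have "dir_deriv c p X (\<lambda>r. pairing (s' s r) (s' t r))
      = pairing (D' p X (s' s)) (s' t p) + pairing (s' s p) (D' p X (s' t))"
    using metric' ls(1,3) unfolding metric_connection_def c_def by blast
  then have 1: "frechet_derivative ?f' (at x0) X
      = pairing (D' p X (s' s)) (s' t p) + pairing (s' s p) (D' p X (s' t))"
    unfolding dir_deriv_eq frechet_pairing_to[of "s' s" "s' t"] .
  have "dir_deriv c p X (\<lambda>r. - pairing (s'' s r) (s'' t r))
      = - pairing (D'' p X (s'' s)) (s'' t p) + - pairing (s'' s p) (D'' p X (s'' t))"
    using metric'' ls(2,4) unfolding metric_connection_def c_def by blast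
  moreover have "dir_deriv c p X (\<lambda>r. - pairing (s'' s r) (s'' t r)) = - frechet_derivative ?f'' (at x0) X"
  proof -
    have d: "(\<lambda>X. - frechet_derivative ?f'' (at x0) X) = frechet_derivative (\<lambda>y. - ?f'' y) (at x0)"
      by (rule frechet_derivative_at[OF has_derivative_minus[OF smooth_at_has_derivative[OF sm(2)]]])
    have "frechet_derivative (\<lambda>y. - pairing (s'' s (pt y)) (s'' t (pt y))) (at x0)
        = frechet_derivative (\<lambda>y. - ?f'' y) (at x0)"
      by (rule frechet_derivative_transform_eventually)
        (rule eventually_mono[OF near_img], simp add: coord_def pairing_to(1)[OF pt(2)])
    then show ?thesis unfolding dir_deriv_eq d[symmetric] by (rule fun_cong)
  qed
  ultimately have 2: "frechet_derivative ?f'' (at x0) X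
      = pairing (D'' p X (s'' s)) (s'' t p) + pairing (s'' s p) (D'' p X (s'' t))" by simp
  have "frechet_derivative (\<lambda>y. pairing (coord s y) (coord t y)) (at x0)
      = frechet_derivative (\<lambda>y. ?f' y + ?f'' y) (at x0)"
  proof (rule frechet_derivative_transform_eventually, rule eventually_mono[OF near_img])
    fix y assume "y \<in> img"
    then show "pairing (coord s y) (coord t y) = ?f' y + ?f'' y"
      using pairing_pr1[of "s (pt y)" "t (pt y)" "pt y"] by (simp only: coord_def pairing_to(1)[OF pt(2)])
  qed
  also have "\<dots> = (\<lambda>X. frechet_derivative ?f' (at x0) X + frechet_derivative ?f'' (at x0) X)"
    by (rule frechet_derivative_at[symmetric])
      (intro has_derivative_add smooth_at_has_derivative sm)
  finally have *: "frechet_derivative (\<lambda>y. pairing (coord s y) (coord t y)) (at x0) X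
      = pairing (D' p X (s' s)) (s' t p) + pairing (s' s p) (D' p X (s' t))
      + (pairing (D'' p X (s'' s)) (s'' t p) + pairing (s'' s p) (D'' p X (s'' t)))"
    using 1 2 by simp
  have in': "D' p X (s' s) \<in> E p" "D' p X (s' t) \<in> E p"
    and in'': "D'' p X (s'' s) \<in> orth E p" "D'' p X (s'' t) \<in> orth E p"
    using connD(2)[OF conn' ls(1)] connD(2)[OF conn' ls(3)] connD(2)[OF conn'' ls(2)] connD(2)[OF conn'' ls(4)] by auto
  have perp: "pairing a d = 0" "pairing d a = 0" if "a \<in> E p" "d \<in> orth E p" for a d
    using that pairing.sym[of d a] unfolding orth_def by auto
  have "pairing (D' p X (s' s)) (s'' t p) = 0" "pairing (s'' s p) (D' p X (s' t)) = 0"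
    "pairing (D'' p X (s'' s)) (s' t p) = 0" "pairing (s' s p) (D'' p X (s'' t)) = 0"
    by (rule perp[OF in'(1) pr1(2)] perp[OF in'(2) pr1(2)] perp[OF pr1(1) in''(1)] perp[OF pr1(1) in''(2)])+
  then show ?thesis
    unfolding * sum_conn_def
    by (simp add: pairing.add_left pairing.add_right pairing.diff_left pairing.diff_right)
qed

definition frame :: "nat \<Rightarrow> 'm \<Rightarrow> 'e gtv" where "frame i = sec (u i)"

lemma smooth_frame: "i < m \<Longrightarrow> smooth_sec_near \<A> p (frame i)"
  unfolding frame_def by (rule smooth_sec[OF smooth_u])

lemma frame_p: "frame i p = b i"
  unfolding frame_def b_def by (rule sec_p)

text \<open>The connection form in the frame: the difference between \<open>D\<close> and the flat connection for
  which the frame is parallel.\<close>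

definition A :: "'e \<Rightarrow> 'e gend" where
  "A X = (\<Sum>i<m. \<epsilon> i *\<^sub>R pairing.rank_one (D p X (frame i)) (b i))"

lemma A_apply: "A X a = (\<Sum>i<m. (\<epsilon> i * pairing a (b i)) *\<^sub>R D p X (frame i))"
  unfolding A_def by (simp add: blinfun.sum_left blinfun.scaleR_left)

lemma linear_A: "linear A"
proof (rule linearI)
  note lin = D_linear[OF smooth_frame]
  show "A (X + Y) = A X + A Y" for X Y
    by (rule blinfun_eqI)
      (simp add: A_apply blinfun.add_left linear_add[OF lin] scaleR_add_right sum.distrib)
  show "A (k *\<^sub>R X) = k *\<^sub>R A X" for k X
    by (rule blinfun_eqI)
      (simp add: A_apply blinfun.scaleR_left linear_scale[OF lin] scaleR_sum_right mult_ac)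
qed

text \<open>Expand \<open>s = \<Sum> f\<^sub>i e\<^sub>i\<close> in the frame; the Leibniz rule gives \<open>\<Sum> df\<^sub>i(X) e\<^sub>i(p)\<close>, which is the derivative
  of \<open>\<Psi> s\<close>, and \<open>\<Sum> f\<^sub>i(p) D\<^sub>X e\<^sub>i\<close>, which is \<open>A X (s p)\<close>.\<close>

lemma D_formula:
  assumes s: "smooth_sec_near \<A> p s"
  shows "D p X s = frechet_derivative (\<lambda>y. \<Psi> y (coord s y)) (at x0) X + A X (s p)"
proof -
  define f where "f i r = \<epsilon> i * pairing (coord s (snd c r)) (u i (snd c r))" for i r
  define g where "g i y = \<epsilon> i * pairing (coord s y) (u i y)" for i y
  have sg: "smooth_at x0 (g i)" if "i < m" for i
    unfolding g_def using s that unfolding smooth_sec_near_iff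
    by (intro smooth_at_bilinear[OF bounded_bilinear_mult] smooth_at_const
        smooth_at_bilinear[OF bounded_bilinear_pairing] smooth_u) auto
  have fg: "\<forall>\<^sub>F y in nhds x0. g i y = f i (pt y)" for i
    using near_img by (rule eventually_mono) (simp add: f_def g_def pt)
  have sf: "smooth_fun_near \<A> p (f i)" if "i < m" for i
    unfolding smooth_fun_near_iff by (rule smooth_at_cong[OF sg[OF that] fg])
  have fp: "f i p = \<epsilon> i * pairing (s p) (b i)" for i
    unfolding f_def x0_def[symmetric] coord_x0 b_def ..
  have df: "dir_deriv c p X (f i) = frechet_derivative (g i) (at x0) X" for i
    unfolding dir_deriv_eq using frechet_derivative_transform_eventually[OF fg] by simp
  have sfe: "smooth_sec_near \<A> p (\<lambda>r. f i r *\<^sub>R frame i r)" if "i < m" for i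
    using smooth_sec_scaleR[OF sf[OF that] smooth_frame[OF that]] .
  have sums: "smooth_sec_near \<A> p (\<lambda>r. \<Sum>i<m. f i r *\<^sub>R frame i r)"
    "D p X (\<lambda>r. \<Sum>i<m. f i r *\<^sub>R frame i r) = (\<Sum>i<m. D p X (\<lambda>r. f i r *\<^sub>R frame i r))"
    using D_sum[of m "\<lambda>i r. f i r *\<^sub>R frame i r" X] sfe by simp_all
  have "\<forall>\<^sub>F r in nhds p. s r = (\<Sum>i<m. f i r *\<^sub>R frame i r)"
    using near_point[OF near_adapted]
  proof eventually_elim
    case (elim r)
    then have r: "r \<in> fst c" "pt (snd c r) = r" using chart(5)[OF c(1)] unfolding pt_def by auto
    have o: "pairing.orthonormal \<epsilon> m (\<lambda>i. u i (snd c r))"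
      and sp: "span ((\<lambda>i. u i (snd c r)) ` {..<m}) = UNIV" using elim unfolding adapted_def by auto
    have w: "to r (s r) = (\<Sum>i<m. f i r *\<^sub>R u i (snd c r))"
      unfolding f_def coord_def r(2) by (rule pairing.orthonormal_expand[OF o]) (simp only: sp UNIV_I)
    have e: "fr r (\<Sum>i<m. f i r *\<^sub>R u i (snd c r)) = (\<Sum>i<m. f i r *\<^sub>R frame i r)"
      unfolding frame_def sec_def linear_sum[OF linear_to(2)] linear_scale[OF linear_to(2)] ..
    have "s r = fr r (to r (s r))" using to_fr(2)[OF r(1)] by simp
    also have "\<dots> = (\<Sum>i<m. f i r *\<^sub>R frame i r)" unfolding w by (rule e)
    finally show ?case .
  qed
  then have "D p X s = D p X (\<lambda>r. \<Sum>i<m. f i r *\<^sub>R frame i r)"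
    by (rule D_cong[OF s sums(1)])
  also have "\<dots> = (\<Sum>i<m. D p X (\<lambda>r. f i r *\<^sub>R frame i r))" by (rule sums(2))
  also have "\<dots> = (\<Sum>i<m. frechet_derivative (g i) (at x0) X *\<^sub>R b i
      + (\<epsilon> i * pairing (s p) (b i)) *\<^sub>R D p X (frame i))"
    by (rule sum.cong[OF refl]) (simp add: D_scaleR[OF smooth_frame sf] df fp frame_p)
  also have "\<dots> = (\<Sum>i<m. frechet_derivative (g i) (at x0) X *\<^sub>R b i) + A X (s p)"
    by (simp add: sum.distrib A_apply)
  also have "(\<Sum>i<m. frechet_derivative (g i) (at x0) X *\<^sub>R b i)
      = frechet_derivative (\<lambda>y. \<Psi> y (coord s y)) (at x0) X"
  proof -
    have e: "(\<lambda>y. \<Psi> y (coord s y)) = (\<lambda>y. \<Sum>i<m. g i y *\<^sub>R b i)"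
      unfolding \<Psi>_def pairing.transport_apply g_def ..
    have "(\<lambda>X. \<Sum>i<m. frechet_derivative (g i) (at x0) X *\<^sub>R b i)
        = frechet_derivative (\<lambda>y. \<Sum>i<m. g i y *\<^sub>R b i) (at x0)"
      by (rule frechet_derivative_at)
        (intro has_derivative_sum has_derivative_scaleR_left smooth_at_has_derivative sg, simp)
    then show ?thesis unfolding e by (rule fun_cong)
  qed
  finally show ?thesis .
qed

text \<open>The first half of the frame lies in \<open>E\<close>, which \<open>D\<close> preserves.\<close>

lemma A_E: "blinfun_apply (A X) ` E p \<subseteq> E p"
proof
  fix x assume "x \<in> blinfun_apply (A X) ` E p"
  then obtain a where a: "a \<in> E p" "x = A X a" by blast
  have perp: "pairing a (b i) = 0" if i: "2 * n \<le> i" "i < m" for i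
  proof -
    have "E p \<subseteq> {a. pairing a (b i) = 0}"
      unfolding span_b(1)[symmetric]
    proof (rule span_minimal)
      show "b ` {..<2 * n} \<subseteq> {a. pairing a (b i) = 0}"
        using pairing.orthonormal_form[OF ortho_b] i by auto
      show "subspace {a. pairing a (b i) = 0}"
        by (rule subspaceI) (simp_all add: pairing.zero_left pairing.add_left pairing.scaleR_left)
    qed
    then show ?thesis using a(1) by blast
  qed
  have DE: "D p X (frame i) \<in> E p" if i: "i < 2 * n" for i
  proof (rule D_E[OF smooth_frame])
    show "\<forall>\<^sub>F r in nhds p. frame i r \<in> E r"
      using near_point[OF near_adapted]
    proof eventually_elim
      case (elim r)
      then have r: "r \<in> fst c" "pt (snd c r) = r" using chart(5)[OF c(1)] unfolding pt_def by auto
      have "u i (snd c r) \<in> span ((\<lambda>i. u i (snd c r)) ` {..<2 * n})" using i by (intro span_base) auto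
      then obtain d where "d \<in> E r" "u i (snd c r) = to r d" using elim r(2) unfolding adapted_def by auto
      then show ?case unfolding frame_def sec_def using to_fr(2)[OF r(1)] by simp
    qed
  qed (use i in simp)
  have "(\<epsilon> i * pairing a (b i)) *\<^sub>R D p X (frame i) \<in> E p" if "i < m" for i
    using perp[of i] DE[of i] that subspace_0[OF subspace_E] subspace_scale[OF subspace_E]
    by (cases "i < 2 * n") auto
  then show "x \<in> E p" unfolding a(2) A_apply by (intro subspace_sum[OF subspace_E]) simp
qed

text \<open>The pairings of the frame vectors are constant, so \<open>D\<close> being metric says that the matrix of \<open>A X\<close> is
  skew with respect to the frame.\<close>

lemma A_skew: "skew_end (A X)"
proof (rule skew_endI)
  fix a d
  let ?w = "\<lambda>i. D p X (frame i)"
  have w: "pairing (?w i) (b j) = - pairing (b i) (?w j)" if "i < m" "j < m" for i j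
  proof -
    have "\<forall>\<^sub>F y in nhds x0. pairing (coord (frame i) y) (coord (frame j) y) = (if i = j then \<epsilon> i else 0)"
      using near_adapted coord_sec[of "u i"] coord_sec[of "u j"]
    proof eventually_elim
      case (elim y)
      then have "pairing.orthonormal \<epsilon> m (\<lambda>i. u i y)" unfolding adapted_def by blast
      from pairing.orthonormal_form[OF this that] show ?case unfolding frame_def elim(2,3) .
    qed
    from frechet_derivative_transform_eventually[OF this]
    have "frechet_derivative (\<lambda>y. pairing (coord (frame i) y) (coord (frame j) y)) (at x0) X = 0"
      by simp
    then show ?thesis
      using D_metric[OF smooth_frame[OF that(1)] smooth_frame[OF that(2)], of X] frame_p by simp
  qed
  have ex: "z = (\<Sum>i<m. (\<epsilon> i * pairing z (b i)) *\<^sub>R b i)" for z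
    by (rule pairing.orthonormal_expand[OF ortho_b]) (simp only: span_b(2) UNIV_I)
  define f where "f z i = \<epsilon> i * pairing z (b i)" for z i
  note expand = ex[folded f_def]
  have l: "pairing z d = (\<Sum>j<m. f d j * pairing z (b j))" for z
    by (subst expand[of d]) (simp add: pairing.sum_right pairing.scaleR_right)
  have r: "pairing a z = (\<Sum>i<m. f a i * pairing (b i) z)" for z
    by (subst expand[of a]) (simp add: pairing.sum_left pairing.scaleR_left)
  have "pairing (A X a) d = (\<Sum>i<m. f a i * pairing (?w i) d)"
    by (simp add: A_apply f_def pairing.sum_left pairing.scaleR_left)
  also have "\<dots> = (\<Sum>i<m. \<Sum>j<m. f a i * (f d j * pairing (?w i) (b j)))"
    by (subst l) (simp only: sum_distrib_left)
  also have "\<dots> = (\<Sum>i<m. \<Sum>j<m. - (f d j * (f a i * pairing (b i) (?w j))))"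
    by (intro sum.cong refl) (simp add: w)
  also have "\<dots> = - (\<Sum>j<m. \<Sum>i<m. f d j * (f a i * pairing (b i) (?w j)))"
    by (subst sum.swap) (simp only: sum_negf)
  also have "\<dots> = - (\<Sum>j<m. f d j * pairing a (?w j))"
    by (subst r) (simp only: sum_distrib_left)
  also have "\<dots> = - pairing a (A X d)"
    by (simp add: A_apply f_def pairing.sum_right pairing.scaleR_right)
  finally show "pairing (A X a) d = - pairing a (A X d)" .
qed

end

section \<open>Horizontal lifts\<close>

lemma blinfun_compose_id [simp]: "id_blinfun o\<^sub>L L = L" "L o\<^sub>L id_blinfun = L"
  by (rule blinfun_eqI, simp)+

context connected_point
begin

lemma derivative_\<Psi>: "frechet_derivative \<Psi> (at x0) X = - frechet_derivative \<Phi> (at x0) X"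
proof -
  have "((\<lambda>y. \<Psi> y o\<^sub>L \<Phi> y) has_derivative
      (\<lambda>X. (\<Psi> x0 o\<^sub>L frechet_derivative \<Phi> (at x0) X) + (frechet_derivative \<Psi> (at x0) X o\<^sub>L \<Phi> x0))) (at x0)"
    by (rule bounded_bilinear.FDERIV[OF bounded_bilinear_blinfun_compose
          smooth_at_has_derivative[OF smooth_\<Psi>] smooth_at_has_derivative[OF smooth_\<Phi>]])
  from frechet_derivative_at[OF this]
  have "(\<Psi> x0 o\<^sub>L frechet_derivative \<Phi> (at x0) X) + (frechet_derivative \<Psi> (at x0) X o\<^sub>L \<Phi> x0)
      = frechet_derivative (\<lambda>y. \<Psi> y o\<^sub>L \<Phi> y) (at x0) X" by (rule fun_cong)
  also have "frechet_derivative (\<lambda>y. \<Psi> y o\<^sub>L \<Phi> y) (at x0) = frechet_derivative (\<lambda>y. id_blinfun) (at x0)"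
    by (rule frechet_derivative_transform_eventually) (rule eventually_mono[OF near_adapted \<Psi>\<Phi>(1)])
  finally have "frechet_derivative \<Phi> (at x0) X + frechet_derivative \<Psi> (at x0) X = 0"
    unfolding \<Phi>_x0 \<Psi>_x0 by simp
  then show ?thesis by (metis add.commute eq_neg_iff_add_eq_0)
qed

lemma end_coord_x0: "end_coord \<A> p \<sigma> (pt x0) = \<sigma> p"
  by (rule blinfun_eqI) (use end_coord_apply[of \<sigma> x0] in \<open>simp only: pt(3) to_p\<close>)

text \<open>The defining condition of \<open>end_conn\<close> determines it, since every element over \<open>p\<close> is the value of a
  smooth section. In the frame \<open>D = d + A\<close> on sections induces \<open>d + [A, -]\<close> on endomorphisms.\<close>

lemma end_conn_formula:
  assumes \<sigma>: "smooth_end_near \<A> p \<sigma>"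
  defines "S \<equiv> \<lambda>y. end_coord \<A> p \<sigma> (pt y)"
  shows "end_conn \<A> D p X \<sigma>
    = frechet_derivative (\<lambda>y. \<Psi> y o\<^sub>L S y o\<^sub>L \<Phi> y) (at x0) X + ((A X o\<^sub>L \<sigma> p) - (\<sigma> p o\<^sub>L A X))"
    (is "_ = ?L")
proof -
  have S: "smooth_at x0 S" using \<sigma> unfolding smooth_end_near_iff S_def .
  have S0: "S x0 = \<sigma> p" unfolding S_def by (rule end_coord_x0)
  have exists: "\<forall>s. smooth_sec_near \<A> p s \<longrightarrow>
      blinfun_apply ?L (s p) = D p X (\<lambda>r. \<sigma> r (s r)) - \<sigma> p (D p X s)"
  proof (intro allI impI)
    fix s assume s: "smooth_sec_near \<A> p s"
    let ?T = "\<lambda>y. \<Psi> y o\<^sub>L S y o\<^sub>L \<Phi> y" and ?s = "\<lambda>y. \<Psi> y (coord s y)"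
    have cs: "smooth_at x0 (coord s)" using s unfolding smooth_sec_near_iff .
    have sT: "smooth_at x0 ?T"
      by (intro smooth_at_bilinear[OF bounded_bilinear_blinfun_compose] smooth_\<Psi> smooth_\<Phi> S)
    have ss: "smooth_at x0 ?s"
      by (rule smooth_at_bilinear[OF bounded_bilinear_blinfun_apply smooth_\<Psi> cs])
    have e: "\<forall>\<^sub>F y in nhds x0. blinfun_apply (S y) (coord s y) = coord (\<lambda>r. \<sigma> r (s r)) y"
      using near_img by (rule eventually_mono) (simp add: coord_end S_def)
    have s\<sigma>: "smooth_sec_near \<A> p (\<lambda>r. \<sigma> r (s r))"
      unfolding smooth_sec_near_iff
      by (rule smooth_at_cong[OF smooth_at_bilinear[OF bounded_bilinear_blinfun_apply S cs] e])
    have "frechet_derivative (\<lambda>y. \<Psi> y (coord (\<lambda>r. \<sigma> r (s r)) y)) (at x0)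
        = frechet_derivative (\<lambda>y. ?T y (?s y)) (at x0)"
    proof (rule frechet_derivative_transform_eventually)
      show "\<forall>\<^sub>F y in nhds x0. blinfun_apply (\<Psi> y) (coord (\<lambda>r. \<sigma> r (s r)) y) = ?T y (?s y)"
        using e near_adapted
      proof eventually_elim
        case (elim y)
        then show ?case by (simp add: \<Psi>\<Phi>(4)[OF elim(2)] flip: elim(1))
      qed
    qed
    also have "\<dots> = (\<lambda>X. ?T x0 (frechet_derivative ?s (at x0) X) + frechet_derivative ?T (at x0) X (?s x0))"
      by (rule frechet_derivative_at[symmetric])
        (rule bounded_bilinear.FDERIV[OF bounded_bilinear_blinfun_apply
          smooth_at_has_derivative[OF sT] smooth_at_has_derivative[OF ss]])
    finally show "blinfun_apply ?L (s p) = D p X (\<lambda>r. \<sigma> r (s r)) - \<sigma> p (D p X s)"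
      unfolding D_formula[OF s] D_formula[OF s\<sigma>]
      by (simp add: \<Psi>_x0 \<Phi>_x0 S0 coord_x0 blinfun.add_left blinfun.diff_left blinfun.add_right algebra_simps)
  qed
  show ?thesis
    unfolding end_conn_def
  proof (rule the_equality[where P = "\<lambda>L. \<forall>s. smooth_sec_near \<A> p s \<longrightarrow>
      blinfun_apply L (s p) = D p X (\<lambda>r. \<sigma> r (s r)) - \<sigma> p (D p X s)", OF exists])
    fix L assume L: "\<forall>s. smooth_sec_near \<A> p s \<longrightarrow>
      blinfun_apply L (s p) = D p X (\<lambda>r. \<sigma> r (s r)) - \<sigma> p (D p X s)"
    show "L = ?L"
    proof (rule blinfun_eqI)
      fix a
      have sa: "smooth_sec_near \<A> p (sec (\<lambda>y. a))" by (rule smooth_sec[OF smooth_at_const])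
      show "L a = ?L a"
        using L[rule_format, OF sa] exists[rule_format, OF sa] unfolding sec_p by simp
    qed
  qed
qed

text \<open>The lift of \<open>X\<close> at \<open>K\<close> will be \<open>(X, [F X, K])\<close>: moving along with the frame contributes \<open>d\<Phi>(X)\<close>, and
  \<open>- A X\<close> corrects for the frame not being parallel.\<close>

definition F :: "'e \<Rightarrow> 'e gend" where "F X = frechet_derivative \<Phi> (at x0) X - A X"

lemma linear_F: "linear F"
  unfolding F_def
  using has_derivative_linear[OF smooth_at_has_derivative[OF smooth_\<Phi>]] linear_A by (rule linear_compose_sub)

text \<open>The derivative of \<open>\<sigma>\<close> also occurs in that of \<open>\<Psi> \<sigma> \<Phi>\<close> and cancels in the difference. What is left depends
  on \<open>\<sigma>\<close> only through \<open>\<sigma> p = K\<close>, which makes the lift well defined.\<close>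

lemma lift_of_section:
  assumes \<sigma>: "smooth_end_near \<A> p \<sigma>" "\<sigma> p = K"
  shows "dir_deriv (chart_at \<A> p) p X (end_coord \<A> p \<sigma>) - end_conn \<A> D p X \<sigma>
    = (F X o\<^sub>L K) - (K o\<^sub>L F X)"
proof -
  let ?S = "\<lambda>y. end_coord \<A> p \<sigma> (pt y)"
  let ?d = "\<lambda>f :: 'e \<Rightarrow> 'e gend. frechet_derivative f (at x0) X"
  note bil = bounded_bilinear_blinfun_compose
  have S: "smooth_at x0 ?S" using \<sigma>(1) unfolding smooth_end_near_iff .
  have S0: "?S x0 = K" using end_coord_x0[of \<sigma>] \<sigma>(2) by simp
  have "((\<lambda>y. \<Psi> y o\<^sub>L ?S y o\<^sub>L \<Phi> y) has_derivative
      (\<lambda>X. ((\<Psi> x0 o\<^sub>L ?S x0) o\<^sub>L frechet_derivative \<Phi> (at x0) X) +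
        (((\<Psi> x0 o\<^sub>L frechet_derivative ?S (at x0) X) + (frechet_derivative \<Psi> (at x0) X o\<^sub>L ?S x0)) o\<^sub>L \<Phi> x0)))
      (at x0)"
    by (rule bounded_bilinear.FDERIV[OF bil bounded_bilinear.FDERIV[OF bil
          smooth_at_has_derivative[OF smooth_\<Psi>] smooth_at_has_derivative[OF S]]
        smooth_at_has_derivative[OF smooth_\<Phi>]])
  from fun_cong[OF frechet_derivative_at[OF this], of X]
  have "?d (\<lambda>y. \<Psi> y o\<^sub>L ?S y o\<^sub>L \<Phi> y) = (K o\<^sub>L ?d \<Phi>) + (?d ?S + (?d \<Psi> o\<^sub>L K))"
    unfolding \<Psi>_x0 \<Phi>_x0 S0 by simp
  moreover have "dir_deriv (chart_at \<A> p) p X (end_coord \<A> p \<sigma>) = ?d ?S"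
    unfolding c_def[symmetric] dir_deriv_eq ..
  ultimately show ?thesis
    unfolding end_conn_formula[OF \<sigma>(1)] F_def derivative_\<Psi> \<sigma>(2)
    by (simp add: bounded_bilinear.diff_left[OF bil] bounded_bilinear.diff_right[OF bil]
        bounded_bilinear.minus_left[OF bil])
qed

lemma moved_x0: "moved x0 K = K"
  by (rule blinfun_eqI) (simp add: moved_apply \<Phi>_x0 \<Psi>_x0 pt(3) to_p)

lemma hlift_formula:
  assumes K: "(p, K) \<in> reflector_space E"
  shows "hlift \<A> E D (p, K) X = (X, (F X o\<^sub>L K) - (K o\<^sub>L F X))"
  unfolding hlift_def
proof (rule the_equality)
  \<comment> \<open>the extension of \<open>K\<close> which is constant in the frame\<close>
  define \<sigma> where "\<sigma> r = moved (snd c r) K" for r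
  have \<sigma>p: "\<sigma> p = K" unfolding \<sigma>_def x0_def[symmetric] by (rule moved_x0)
  have "\<forall>\<^sub>F y in nhds x0. \<Phi> y o\<^sub>L K o\<^sub>L \<Psi> y = end_coord \<A> p \<sigma> (pt y)"
    using near_adapted
  proof eventually_elim
    case (elim y)
    then have y: "y \<in> img" unfolding adapted_def by blast
    show ?case unfolding end_coord_def \<sigma>_def c_def[symmetric] pt(1)[OF y] echange_moved[OF elim] ..
  qed
  then have sm: "smooth_end_near \<A> p \<sigma>"
    unfolding smooth_end_near_iff
    by (rule smooth_at_cong[rotated])
      (intro smooth_at_bilinear[OF bounded_bilinear_blinfun_compose] smooth_\<Phi> smooth_\<Psi> smooth_at_const)
  have "\<forall>\<^sub>F r in nhds p. \<sigma> r \<in> adjoint_fibre E r"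
    using near_point[OF near_adapted]
  proof eventually_elim
    case (elim r)
    then have "pt (snd c r) = r" using chart(5)[OF c(1)] unfolding pt_def by blast
    moreover have "moved (snd c r) K \<in> adjoint_fibre E (pt (snd c r))"
      using elim K unfolding reflector_space_def gen_paracomplex_def by (intro moved_adjoint) auto
    ultimately show ?case unfolding \<sigma>_def by simp
  qed
  then have "adjoint_section \<A> E p \<sigma>" using sm unfolding adjoint_section_def by blast
  then show "\<exists>\<sigma>. adjoint_section \<A> E (fst (p, K)) \<sigma> \<and> \<sigma> (fst (p, K)) = snd (p, K) \<and>
      (X, (F X o\<^sub>L K) - (K o\<^sub>L F X)) = (X, dir_deriv (chart_at \<A> (fst (p, K))) (fst (p, K)) X
        (end_coord \<A> (fst (p, K)) \<sigma>) - end_conn \<A> D (fst (p, K)) X \<sigma>)"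
    using \<sigma>p lift_of_section[OF sm \<sigma>p] by (intro exI[of _ \<sigma>]) simp
next
  fix w
  assume "\<exists>\<sigma>. adjoint_section \<A> E (fst (p, K)) \<sigma> \<and> \<sigma> (fst (p, K)) = snd (p, K) \<and>
      w = (X, dir_deriv (chart_at \<A> (fst (p, K))) (fst (p, K)) X
        (end_coord \<A> (fst (p, K)) \<sigma>) - end_conn \<A> D (fst (p, K)) X \<sigma>)"
  then show "w = (X, (F X o\<^sub>L K) - (K o\<^sub>L F X))"
    unfolding adjoint_section_def using lift_of_section by auto
qed

lemma linear_hlift:
  assumes K: "(p, K) \<in> reflector_space E"
  shows "linear (hlift \<A> E D (p, K))"
  unfolding hlift_formula[OF K, abs_def]
  by (rule linearI)
    (simp_all add: linear_add[OF linear_F] linear_scale[OF linear_F] algebra_simps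
      bounded_bilinear.add_left[OF bounded_bilinear_blinfun_compose]
      bounded_bilinear.add_right[OF bounded_bilinear_blinfun_compose]
      bounded_bilinear.scaleR_left[OF bounded_bilinear_blinfun_compose]
      bounded_bilinear.scaleR_right[OF bounded_bilinear_blinfun_compose])

end

section \<open>Horizontal vectors are tangent to the reflector space\<close>

text \<open>Tangent vectors only depend on the germ of the curve at \<open>0\<close>, which may therefore be described by its
  coordinate expression \<open>g\<close> near \<open>0\<close>.\<close>

lemma tangentI:
  assumes g: "smooth_at 0 g" "(g has_vector_derivative w) (at 0)"
    and \<gamma>: "\<gamma> 0 = x" "\<forall>\<^sub>F t in nhds (0::real). \<gamma> t \<in> S \<and> \<gamma> t \<in> fst (ch x) \<and> snd (ch x) (\<gamma> t) = g t"
  shows "w \<in> tangent ch S x"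
proof -
  obtain V where V: "open V" "0 \<in> V" "smooth_on V g" using g(1) unfolding smooth_at_def by blast
  obtain W where W: "open W" "0 \<in> W"
    "\<And>t. t \<in> W \<Longrightarrow> \<gamma> t \<in> S \<and> \<gamma> t \<in> fst (ch x) \<and> snd (ch x) (\<gamma> t) = g t"
    using \<gamma>(2) unfolding eventually_nhds by blast
  have "open (V \<inter> W)" "0 \<in> V \<inter> W" using V W by (simp_all add: open_Int)
  then obtain e where e: "e > 0" "ball 0 e \<subseteq> V \<inter> W" unfolding open_contains_ball by blast
  have ball: "ball 0 e = {-e<..<e}" by (auto simp: dist_real_def)
  have eq: "\<And>t. t \<in> {-e<..<e} \<Longrightarrow> g t = (snd (ch x) \<circ> \<gamma>) t" using W(3) e(2) unfolding ball by auto
  have "Ck_on k {-e<..<e} (snd (ch x) \<circ> \<gamma>)" for k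
  proof (rule Ck_on_cong[OF open_greaterThanLessThan eq])
    show "Ck_on k {-e<..<e} g"
      using V(3) Ck_on_subset[of k V g "{-e<..<e}"] e(2) unfolding ball smooth_on_def by simp
  qed
  then have "smooth_on {-e<..<e} (snd (ch x) \<circ> \<gamma>)" unfolding smooth_on_def by blast
  moreover have "((snd (ch x) \<circ> \<gamma>) has_vector_derivative w) (at 0)"
    unfolding has_vector_derivative_def
    by (rule has_derivative_transform_within_open[OF g(2)[unfolded has_vector_derivative_def]
        open_greaterThanLessThan _ eq]) (use e(1) in auto)
  then have "vector_derivative (snd (ch x) \<circ> \<gamma>) (at 0) = w" by (rule vector_derivative_at)
  moreover have "\<forall>t\<in>{-e<..<e}. \<gamma> t \<in> S \<inter> fst (ch x)" using W(3) e(2) unfolding ball by auto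
  ultimately show ?thesis unfolding tangent_def using \<gamma>(1) e(1) by blast
qed

text \<open>If \<open>W\<close> has square zero, then \<open>1 - t W\<close> is the inverse of \<open>1 + t W\<close>, and if it is also skew, then both
  are isometries; conjugation by them then preserves the fibre.\<close>

definition unipotent_conj :: "'e::real_normed_vector gend \<Rightarrow> real \<Rightarrow> 'e gend \<Rightarrow> 'e gend" where
  "unipotent_conj W t K = (id_blinfun + t *\<^sub>R W) o\<^sub>L K o\<^sub>L (id_blinfun - t *\<^sub>R W)"

lemma unipotent_conj_apply:
  "blinfun_apply (unipotent_conj W t K) a = K (a - t *\<^sub>R W a) + t *\<^sub>R W (K (a - t *\<^sub>R W a))"
  by (simp add: unipotent_conj_def blinfun.add_left blinfun.diff_left blinfun.scaleR_left)

lemma unipotent_conj_reflector: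
  assumes K: "(p, K) \<in> reflector_space E" and W: "skew_end W" "W o\<^sub>L W = 0" "blinfun_apply W ` E p \<subseteq> E p"
    and E: "subspace (E p)"
  shows "(p, unipotent_conj W t K) \<in> reflector_space E"
proof -
  have K': "K o\<^sub>L K = id_blinfun" "skew_end K" "blinfun_apply K ` E p \<subseteq> E p"
    using K unfolding reflector_space_def gen_paracomplex_def by auto
  have WW: "W (W a) = 0" for a
    using W(2) by (metis blinfun_apply_blinfun_compose zero_blinfun.rep_eq)
  have KK: "K (K a) = a" for a
    using K'(1) by (metis blinfun_apply_blinfun_compose blinfun_apply_id_blinfun)
  let ?U = "unipotent_conj W t K"
  have cancel: "(a + t *\<^sub>R W a) - t *\<^sub>R W (a + t *\<^sub>R W a) = a"
    "(a - t *\<^sub>R W a) + t *\<^sub>R W (a - t *\<^sub>R W a) = a" for a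
    by (simp_all add: blinfun.add_right blinfun.diff_right blinfun.scaleR_right WW)
  have "?U (?U a) = a" for a
    unfolding unipotent_conj_apply[of W t K a] unipotent_conj_apply[of W t K "_ + _"] cancel(1) KK cancel(2) ..
  then have "?U o\<^sub>L ?U = id_blinfun" by (intro blinfun_eqI) simp
  moreover have "skew_end ?U"
  proof (rule skew_endI)
    fix a d
    have adj: "pairing (z + t *\<^sub>R W z) y = pairing z (y - t *\<^sub>R W y)"
      "pairing (z - t *\<^sub>R W z) y = pairing z (y + t *\<^sub>R W y)" for z y
      by (simp_all add: pairing.add_left pairing.diff_left pairing.scaleR_left pairing.add_right
          pairing.diff_right pairing.scaleR_right skew_endD[OF W(1)])
    show "pairing (?U a) d = - pairing a (?U d)"
      unfolding unipotent_conj_apply adj(1) skew_endD[OF K'(2)] adj(2) ..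
  qed
  moreover have "blinfun_apply ?U ` E p \<subseteq> E p"
  proof
    fix x assume "x \<in> blinfun_apply ?U ` E p"
    then obtain a where a: "a \<in> E p" "x = ?U a" by blast
    have "a - t *\<^sub>R W a \<in> E p" using a(1) W(3) E by (intro subspace_diff subspace_scale) auto
    then have "K (a - t *\<^sub>R W a) \<in> E p" using K'(3) by blast
    then show "x \<in> E p" unfolding a(2) unipotent_conj_apply
      using W(3) E by (intro subspace_add subspace_scale) auto
  qed
  ultimately show ?thesis unfolding reflector_space_def gen_paracomplex_def by simp
qed

lemma smooth_at_unipotent_conj:
  "smooth_at z K \<Longrightarrow> smooth_at z (\<lambda>t. unipotent_conj W t (K t))"
  unfolding unipotent_conj_def
  by (intro smooth_at_bilinear[OF bounded_bilinear_blinfun_compose] smooth_at_add smooth_at_diff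
      smooth_at_scaleR smooth_at_const smooth_at_ident)

lemma unipotent_conj_derivative:
  assumes "(K has_vector_derivative K') (at 0)"
  shows "((\<lambda>t. unipotent_conj W t (K t)) has_vector_derivative
    ((W o\<^sub>L K 0) + K' - (K 0 o\<^sub>L W))) (at 0)"
proof -
  note bil = bounded_bilinear_blinfun_compose
  have 1: "((\<lambda>t. id_blinfun + t *\<^sub>R W) has_vector_derivative W) (at 0)"
    "((\<lambda>t. id_blinfun - t *\<^sub>R W) has_vector_derivative - W) (at 0)"
    by (auto intro!: derivative_eq_intros)
  show ?thesis
    unfolding unipotent_conj_def
    using bounded_bilinear.has_vector_derivative[OF bil bounded_bilinear.has_vector_derivative[OF bil 1(1) assms] 1(2)]
    by (simp add: bounded_bilinear.minus_right[OF bil] bounded_bilinear.add_left[OF bil] add.commute)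
qed

context connected_point
begin

text \<open>The curve lies over the line \<open>l\<close> with velocity \<open>X\<close>. It moves \<open>K\<close> along with the frame, which contributes
  \<open>[d\<Phi>(X), K]\<close>, and at the same time inside the fibre over \<open>p\<close>, which contributes \<open>[K, A X]\<close>.\<close>

lemma hlift_tangent:
  assumes K: "(p, K) \<in> reflector_space E"
  shows "hlift \<A> E D (p, K) X \<in> tangent (end_chart_at \<A>) (reflector_space E) (p, K)"
proof -
  note bil = bounded_bilinear_blinfun_compose
  have K': "gen_paracomplex K" "blinfun_apply K ` E p \<subseteq> E p"
    using K unfolding reflector_space_def by auto
  obtain W1 W2 where W: "skew_end W1" "skew_end W2" "W1 o\<^sub>L W1 = 0" "W2 o\<^sub>L W2 = 0"
    "blinfun_apply W1 ` E p \<subseteq> E p" "blinfun_apply W2 ` E p \<subseteq> E p"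
    "((W1 + W2) o\<^sub>L K) - (K o\<^sub>L (W1 + W2)) = (K o\<^sub>L A X) - (A X o\<^sub>L K)"
    by (rule commutator_nilpotent_split[OF K' A_skew A_E subspace_E])
  \<comment> \<open>a polynomial curve in the fibre over \<open>p\<close> with velocity \<open>[K, A X]\<close> at \<open>K\<close>\<close>
  define k where "k t = unipotent_conj W1 t (unipotent_conj W2 t K)" for t
  have k_refl: "(p, k t) \<in> reflector_space E" for t
    unfolding k_def
    by (intro unipotent_conj_reflector K W(1-6) subspace_E)
  have k_smooth: "smooth_at 0 k"
    unfolding k_def[abs_def] by (intro smooth_at_unipotent_conj smooth_at_const)
  have u0: "unipotent_conj W 0 L = L" for W L :: "'e gend"
    by (simp add: unipotent_conj_def)
  have k0: "k 0 = K" by (simp add: k_def u0)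
  have kd: "(k has_vector_derivative ((K o\<^sub>L A X) - (A X o\<^sub>L K))) (at 0)"
  proof -
    have "(k has_vector_derivative ((W1 o\<^sub>L K) + ((W2 o\<^sub>L K) + 0 - (K o\<^sub>L W2)) - (K o\<^sub>L W1))) (at 0)"
      unfolding k_def[abs_def]
      using unipotent_conj_derivative[OF unipotent_conj_derivative[OF has_vector_derivative_const], of W1 W2 K]
      by (simp only: u0)
    moreover have "(W1 o\<^sub>L K) + ((W2 o\<^sub>L K) + 0 - (K o\<^sub>L W2)) - (K o\<^sub>L W1) = (K o\<^sub>L A X) - (A X o\<^sub>L K)"
      unfolding W(7)[symmetric] bounded_bilinear.add_left[OF bil] bounded_bilinear.add_right[OF bil] by simp
    ultimately show ?thesis by simp
  qed
  define l where "l t = x0 + t *\<^sub>R X" for t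
  have l0: "l 0 = x0" by (simp add: l_def)
  define g where "g t = (l t, \<Phi> (l t) o\<^sub>L k t o\<^sub>L \<Psi> (l t))" for t
  have line_derivative: "((\<lambda>t. f (l t)) has_vector_derivative frechet_derivative f (at x0) X) (at 0)"
    if "smooth_at x0 f" for f :: "'e \<Rightarrow> 'e gend"
  proof -
    have d: "(f has_derivative frechet_derivative f (at x0)) (at (l 0))"
      unfolding l0 by (rule smooth_at_has_derivative[OF that])
    have "(l has_derivative (\<lambda>s. s *\<^sub>R X)) (at 0)"
      unfolding l_def[abs_def] by (auto intro!: derivative_eq_intros)
    from has_derivative_compose[OF this d]
    show ?thesis
      unfolding has_vector_derivative_def by (simp add: linear_scale[OF has_derivative_linear[OF d]])
  qed
  have "smooth_at 0 g"
    unfolding g_def[abs_def] l_def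
    by (intro smooth_at_Pair smooth_at_bilinear[OF bil] k_smooth smooth_at_line[OF smooth_\<Phi>]
        smooth_at_line[OF smooth_\<Psi>] smooth_at_add smooth_at_scaleR smooth_at_const smooth_at_ident)
  moreover have "(g has_vector_derivative hlift \<A> E D (p, K) X) (at 0)"
  proof -
    have "(l has_vector_derivative X) (at 0)"
      unfolding l_def[abs_def] by (auto intro!: derivative_eq_intros)
    moreover have "((\<lambda>t. \<Phi> (l t) o\<^sub>L k t o\<^sub>L \<Psi> (l t)) has_vector_derivative
        ((\<Phi> (l 0) o\<^sub>L k 0) o\<^sub>L frechet_derivative \<Psi> (at x0) X) +
        (((\<Phi> (l 0) o\<^sub>L ((K o\<^sub>L A X) - (A X o\<^sub>L K))) + (frechet_derivative \<Phi> (at x0) X o\<^sub>L k 0)) o\<^sub>L \<Psi> (l 0))) (at 0)"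
      by (intro bounded_bilinear.has_vector_derivative[OF bil] kd line_derivative smooth_\<Phi> smooth_\<Psi>)
    moreover have "((\<Phi> (l 0) o\<^sub>L k 0) o\<^sub>L frechet_derivative \<Psi> (at x0) X) +
        (((\<Phi> (l 0) o\<^sub>L ((K o\<^sub>L A X) - (A X o\<^sub>L K))) + (frechet_derivative \<Phi> (at x0) X o\<^sub>L k 0)) o\<^sub>L \<Psi> (l 0))
        = (F X o\<^sub>L K) - (K o\<^sub>L F X)"
      unfolding l0 \<Phi>_x0 \<Psi>_x0 k0 derivative_\<Psi> F_def
      by (simp add: bounded_bilinear.diff_left[OF bil] bounded_bilinear.diff_right[OF bil]
          bounded_bilinear.minus_right[OF bil])
    ultimately show ?thesis
      unfolding g_def[abs_def] hlift_formula[OF K] by (auto intro: has_vector_derivative_Pair)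
  qed
  moreover have "(pt (l 0), moved (l 0) (k 0)) = (p, K)" by (simp add: l0 k0 pt(3) moved_x0)
  moreover have "\<forall>\<^sub>F t in nhds 0. (pt (l t), moved (l t) (k t)) \<in> reflector_space E \<and>
      (pt (l t), moved (l t) (k t)) \<in> fst (end_chart_at \<A> (p, K)) \<and>
      snd (end_chart_at \<A> (p, K)) (pt (l t), moved (l t) (k t)) = g t"
  proof -
    have "isCont l 0" unfolding l_def[abs_def] by (intro continuous_intros)
    then have "filterlim l (nhds x0) (nhds 0)"
      using tendsto_at_iff_tendsto_nhds[of l 0] unfolding isCont_def l0 by simp
    from eventually_compose_filterlim[OF near_adapted this] show ?thesis
    proof eventually_elim
      case (elim t)
      then have "l t \<in> img" unfolding adapted_def by blast
      then show ?case
        using moved_reflector[OF elim k_refl] pt_adapted[OF elim]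
        by (simp add: end_chart_at_def Let_def c_def[symmetric] pt(1) echange_moved[OF elim] g_def)
    qed
  qed
  ultimately show ?thesis
    by (rule tangentI[where \<gamma> = "\<lambda>t. (pt (l t), moved (l t) (k t))"])
qed

end

section \<open>Comparison with the special structures\<close>

text \<open>A 2-form is only constrained on tangent vectors; the local smooth extension, evaluated at the point, is
  bilinear on the whole ambient space.\<close>

lemma two_form_bilinear:
  assumes "two_form ch S B" "x \<in> S" "x \<in> fst (ch x)"
  obtains q where "bilinear q" "\<forall>u\<in>tangent ch S x. \<forall>v\<in>tangent ch S x. B x u v = q u v"
proof -
  obtain W and q :: "'b \<Rightarrow> ('b \<Rightarrow>\<^sub>L 'b \<Rightarrow>\<^sub>L real)" where "snd (ch x) x \<in> W"
    "\<forall>y\<in>S \<inter> fst (ch x). snd (ch x) y \<in> W \<longrightarrow>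
           (\<forall>u\<in>tangent ch S y. \<forall>v\<in>tangent ch S y.
              B y u v = blinfun_apply (blinfun_apply (q (snd (ch x) y)) (jac (ch y) (ch x) y u))
                (jac (ch y) (ch x) y v))"
    using assms unfolding two_form_def by blast
  then have "\<forall>u\<in>tangent ch S x. \<forall>v\<in>tangent ch S x.
      B x u v = blinfun_apply (blinfun_apply (q (snd (ch x) x)) (jac (ch x) (ch x) x u)) (jac (ch x) (ch x) x v)"
    using assms(2,3) by blast
  then show thesis
    by (intro that[of "\<lambda>u v. blinfun_apply (blinfun_apply (q (snd (ch x) x)) (jac (ch x) (ch x) x u))
        (jac (ch x) (ch x) x v)"])
      (simp_all add: bilinear_def linear_iff blinfun.add_left blinfun.add_right blinfun.scaleR_left
        blinfun.scaleR_right)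
qed

text \<open>All the geometry that the comparison uses: at the point \<open>(p, K)\<close> the horizontal lift is a linear section of
  the projection to the tangent space of \<open>M\<close>, with values tangent to the reflector space.\<close>

locale horizontal_point =
  fixes \<A> :: "('m::{t2_space, second_countable_topology}, 'e::euclidean_space) chart set"
    and E :: "'m \<Rightarrow> 'e gtv set" and D :: "('m, 'e) conn" and p :: 'm and K :: "'e gend" and \<epsilon> :: nat
  assumes refl: "(p, K) \<in> reflector_space E"
    and p_chart: "p \<in> fst (chart_at \<A> p)"
    and linear_hl: "linear (hlift \<A> E D (p, K))"
    and fst_hl: "\<And>X. fst (hlift \<A> E D (p, K) X) = X"
    and hl_tangent: "\<And>X. hlift \<A> E D (p, K) X \<in> tangent (end_chart_at \<A>) (reflector_space E) (p, K)"
begin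

abbreviation hl where "hl \<equiv> hlift \<A> E D (p, K)"
abbreviation T where "T \<equiv> tangent (end_chart_at \<A>) (reflector_space E) (p, K)"

lemma hl_0: "hl 0 = 0"
  by (rule linear_0[OF linear_hl])

lemma zero_T: "0 \<in> T"
  using hl_tangent[of 0] hl_0 by simp

lemma hl_eq_0: "hl X = 0 \<Longrightarrow> X = 0"
  using fst_hl[of X] by simp

lemma in_chart: "(p, K) \<in> fst (end_chart_at \<A> (p, K))"
  using p_chart by (simp add: end_chart_at_def Let_def)

lemma P_eps_0: "P_eps E \<epsilon> x 0 = 0"
proof -
  have "Blinfun (\<lambda>a :: 'e gtv. (0 :: 'e gtv)) = 0" by (simp add: zero_blinfun.abs_eq)
  moreover have "L o\<^sub>L 0 = 0" for L :: "'e gend" by (rule blinfun_eqI) simp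
  ultimately show ?thesis unfolding P_eps_def by simp
qed

text \<open>The parts of \<open>\<K>\<^sub>\<epsilon>\<close> which involve \<open>P_eps\<close> vanish, because a horizontal vector has vertical part \<open>0\<close>; so
  the index \<open>\<epsilon>\<close> disappears. A form which is not pulled back from \<open>M\<close> is allowed: the image is only
  evaluated on horizontal vectors.\<close>

lemma K_eps_horizontal:
  assumes \<xi>: "\<And>Y. \<xi> (hl Y) = blinfun_apply \<alpha> Y"
  shows "fst (K_eps \<A> E D \<epsilon> (p, K) (hl X, \<xi>)) = hl (fst (K (X, \<alpha>)))"
    "snd (K_eps \<A> E D \<epsilon> (p, K) (hl X, \<xi>)) (hl Y) = snd (K (X, \<alpha>)) Y"
proof -
  have "Blinfun (\<lambda>Y. \<xi> (hl Y)) = \<alpha>" by (simp add: \<xi> blinfun_apply_inverse)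
  moreover have "\<xi> (0, 0) = 0" using \<xi>[of 0] hl_0 by (simp add: zero_prod_def)
  ultimately show "fst (K_eps \<A> E D \<epsilon> (p, K) (hl X, \<xi>)) = hl (fst (K (X, \<alpha>)))"
    "snd (K_eps \<A> E D \<epsilon> (p, K) (hl X, \<xi>)) (hl Y) = snd (K (X, \<alpha>)) Y"
    unfolding K_eps_def by (simp_all add: Let_def fst_hl P_eps_0 hl_tangent flip: zero_prod_def)
qed

definition pullback :: "('e \<Rightarrow>\<^sub>L real) \<Rightarrow> 'e \<times> 'e gend \<Rightarrow> real" where
  "pullback \<gamma> = restrict (\<lambda>w. \<gamma> (fst w)) T"

lemma pullback_hl: "pullback \<gamma> (hl Y) = blinfun_apply \<gamma> Y"
  unfolding pullback_def by (simp add: hl_tangent fst_hl)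

lemma pullback_dual: "pullback \<gamma> \<in> dual_space T"
  unfolding dual_space_def pullback_def
  by (auto intro!: exI[of _ "\<lambda>w. \<gamma> (fst w)"] linearI simp: blinfun.add_right blinfun.scaleR_right)

lemma B_transform_at:
  assumes "B_transform_of (end_chart_at \<A>) (reflector_space E) (K_eps \<A> E D \<epsilon>) \<K>"
  obtains q B where "bilinear q" "\<forall>u\<in>T. \<forall>v\<in>T. B u v = q u v"
    "\<forall>w\<in>T. \<forall>\<xi>\<in>dual_space T. K_eps \<A> E D \<epsilon> (p, K) (w, \<xi>)
      = exp_form T B (\<K> (p, K) (exp_form T (\<lambda>u v. - B u v) (w, \<xi>)))"
proof -
  obtain B where B: "two_form (end_chart_at \<A>) (reflector_space E) B"
    "\<forall>x\<in>reflector_space E. \<forall>a\<in>gen_tangent (end_chart_at \<A>) (reflector_space E) x.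
           K_eps \<A> E D \<epsilon> x a = exp_form (tangent (end_chart_at \<A>) (reflector_space E) x) (B x)
             (\<K> x (exp_form (tangent (end_chart_at \<A>) (reflector_space E) x) (\<lambda>u v. - B x u v) a))"
    using assms unfolding B_transform_of_def by blast
  obtain q where "bilinear q" "\<forall>u\<in>T. \<forall>v\<in>T. B (p, K) u v = q u v"
    by (rule two_form_bilinear[OF B(1) refl in_chart])
  moreover have "\<forall>w\<in>T. \<forall>\<xi>\<in>dual_space T. K_eps \<A> E D \<epsilon> (p, K) (w, \<xi>)
      = exp_form T (B (p, K)) (\<K> (p, K) (exp_form T (\<lambda>u v. - B (p, K) u v) (w, \<xi>)))"
    using bspec[OF B(2) refl] unfolding gen_tangent_def by blast
  ultimately show thesis by (rule that)
qed

lemma exp_zero: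
  assumes "bilinear q" "\<And>u v. u \<in> T \<Longrightarrow> v \<in> T \<Longrightarrow> B u v = q u v" "\<xi> \<in> dual_space T"
  shows "exp_form T (\<lambda>u v. - B u v) (0, \<xi>) = (0, \<xi>)"
proof -
  have "(\<lambda>v\<in>T. \<xi> v + - B 0 v) = \<xi>"
  proof
    fix v
    show "(\<lambda>v\<in>T. \<xi> v + - B 0 v) v = \<xi> v"
      using assms(2)[OF zero_T, of v] bilinear_lzero[OF assms(1)] assms(3)
      by (cases "v \<in> T") (auto simp: dual_space_def)
  qed
  then show ?thesis unfolding exp_form_def by simp
qed

lemma fst_exp_form: "fst (exp_form T' B a) = fst a"
  by (simp add: exp_form_def case_prod_beta)

text \<open>The hypothesis on \<open>\<K>\<close> holds for the trivial structure and for that of a product structure, where the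
  image of the 1-form \<open>\<xi>\<close> has vector part \<open>0\<close> and \<open>P 0\<close>, respectively. As \<open>e\<^sup>B\<close> fixes 1-forms and
  preserves vector parts, the property passes to \<open>B\<close>-transforms; comparing the pullbacks of \<open>\<gamma>\<close> and
  \<open>0\<close> gives a contradiction.\<close>

lemma not_covector_independent:
  assumes \<gamma>: "fst (K (0, \<gamma>)) \<noteq> 0" and indep: "\<And>\<xi> \<xi>'. fst (\<K> (p, K) (0, \<xi>)) = fst (\<K> (p, K) (0, \<xi>'))"
  shows "\<not> B_transform_of (end_chart_at \<A>) (reflector_space E) (K_eps \<A> E D \<epsilon>) \<K>"
proof
  assume bt: "B_transform_of (end_chart_at \<A>) (reflector_space E) (K_eps \<A> E D \<epsilon>) \<K>"
  obtain q B where b: "bilinear q" "\<forall>u\<in>T. \<forall>v\<in>T. B u v = q u v"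
    "\<forall>w\<in>T. \<forall>\<xi>\<in>dual_space T. K_eps \<A> E D \<epsilon> (p, K) (w, \<xi>)
      = exp_form T B (\<K> (p, K) (exp_form T (\<lambda>u v. - B u v) (w, \<xi>)))"
    by (rule B_transform_at[OF bt])
  note B = b(1) b(2)[rule_format] b(3)[rule_format]
  have val: "hl (fst (K (0, \<beta>))) = fst (\<K> (p, K) (0, pullback \<beta>))" for \<beta>
    using K_eps_horizontal(1)[of "pullback \<beta>" \<beta> 0, OF pullback_hl]
      B(3)[OF zero_T pullback_dual] exp_zero[OF B(1,2) pullback_dual]
    by (simp add: hl_0 fst_exp_form)
  have "hl (fst (K (0, \<gamma>))) = hl (fst (K (0, 0)))" unfolding val by (rule indep)
  then have "hl (fst (K (0, \<gamma>))) = 0" using hl_0 by (simp add: blinfun.zero_right flip: zero_prod_def)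
  then show False using \<gamma> hl_eq_0 by blast
qed

text \<open>The test element is \<open>X\<^sup>h + \<iota> B\<close> with \<open>\<iota> B = B(X\<^sup>h, -)\<close>: it is \<open>e\<^sup>B X\<^sup>h\<close>, so its image under the transform is
  \<open>e\<^sup>B\<close> of a 1-form and has no vector part. Hence \<open>K\<close> maps \<open>X + \<beta>\<close>, where \<open>\<beta>(Y) = B(X\<^sup>h, Y\<^sup>h)\<close>, to a
  covector, and applying \<open>K\<close> once more gives \<open>X = 0\<close>.\<close>

lemma not_symplectic:
  assumes \<gamma>: "\<And>\<gamma>. fst (K (0, \<gamma>)) = 0"
    and \<omega>: "pre_symplectic (end_chart_at \<A>) (reflector_space E) \<omega>"
  shows "\<not> B_transform_of (end_chart_at \<A>) (reflector_space E) (K_eps \<A> E D \<epsilon>)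
    (\<lambda>x. K_omega (tangent (end_chart_at \<A>) (reflector_space E) x) (\<omega> x))"
proof
  assume bt: "B_transform_of (end_chart_at \<A>) (reflector_space E) (K_eps \<A> E D \<epsilon>)
    (\<lambda>x. K_omega (tangent (end_chart_at \<A>) (reflector_space E) x) (\<omega> x))"
  obtain q B where b: "bilinear q" "\<forall>u\<in>T. \<forall>v\<in>T. B u v = q u v"
    "\<forall>w\<in>T. \<forall>\<xi>\<in>dual_space T. K_eps \<A> E D \<epsilon> (p, K) (w, \<xi>)
      = exp_form T B (K_omega T (\<omega> (p, K)) (exp_form T (\<lambda>u v. - B u v) (w, \<xi>)))"
    by (rule B_transform_at[OF bt])
  note B = b(1) b(2)[rule_format] b(3)[rule_format]
  have tf: "two_form (end_chart_at \<A>) (reflector_space E) \<omega>"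
    using \<omega> unfolding pre_symplectic_def by blast
  obtain q' where q': "bilinear q'" "\<forall>u\<in>T. \<forall>v\<in>T. \<omega> (p, K) u v = q' u v"
    by (rule two_form_bilinear[OF tf refl in_chart])
  have the0: "(THE Y. Y \<in> T \<and> (\<forall>v\<in>T. \<omega> (p, K) Y v = 0)) = 0"
  proof (rule the_equality)
    show "0 \<in> T \<and> (\<forall>v\<in>T. \<omega> (p, K) 0 v = 0)"
      using zero_T q'(2) bilinear_lzero[OF q'(1)] by simp
    show "Y = 0" if "Y \<in> T \<and> (\<forall>v\<in>T. \<omega> (p, K) Y v = 0)" for Y
      using that \<omega> refl unfolding pre_symplectic_def by blast
  qed
  obtain X :: 'e where X: "X \<noteq> 0" using nonempty_Basis nonzero_Basis by blast
  define \<xi> where "\<xi> = (\<lambda>v\<in>T. q (hl X) v)"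
  define \<beta> where "\<beta> = Blinfun (\<lambda>Y. q (hl X) (hl Y))"
  have linq: "linear (q (hl X))" using B(1) unfolding bilinear_def by blast
  have "linear (\<lambda>Y. q (hl X) (hl Y))"
    using linear_compose[OF linear_hl linq] by (simp add: o_def)
  then have \<beta>: "blinfun_apply \<beta> = (\<lambda>Y. q (hl X) (hl Y))"
    unfolding \<beta>_def by (simp add: bounded_linear_Blinfun_apply linear_conv_bounded_linear)
  have \<xi>\<beta>: "\<xi> (hl Y) = blinfun_apply \<beta> Y" for Y
    unfolding \<xi>_def \<beta> by (simp add: hl_tangent)
  have \<xi>: "\<xi> \<in> dual_space T" unfolding dual_space_def \<xi>_def using linq by blast
  have "exp_form T (\<lambda>u v. - B u v) (hl X, \<xi>) = (hl X, \<lambda>v\<in>T. 0)"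
    unfolding exp_form_def \<xi>_def by (auto simp: B(2) hl_tangent fun_eq_iff)
  moreover have "fst (K_omega T (\<omega> (p, K)) (hl X, \<lambda>v\<in>T. 0)) = 0"
    unfolding K_omega_def using the0 by (simp cong: conj_cong ball_cong)
  ultimately have "hl (fst (K (X, \<beta>))) = 0"
    using K_eps_horizontal(1)[of \<xi> \<beta> X, OF \<xi>\<beta>] B(3)[OF hl_tangent \<xi>] by (simp add: fst_exp_form)
  then have "fst (K (X, \<beta>)) = 0" by (rule hl_eq_0)
  moreover define \<delta> where "\<delta> = snd (K (X, \<beta>))"
  ultimately have K\<delta>: "K (X, \<beta>) = (0, \<delta>)" by (simp add: prod_eq_iff)
  have "K o\<^sub>L K = id_blinfun" using refl unfolding reflector_space_def gen_paracomplex_def by simp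
  then have "K (K (X, \<beta>)) = (X, \<beta>)" by (metis blinfun_apply_blinfun_compose blinfun_apply_id_blinfun)
  then show False using \<gamma>[of \<delta>] X unfolding K\<delta> by simp
qed

text \<open>The transform maps a 1-form \<open>\<xi>\<close> to \<open>e\<^sup>B(- \<iota>\<^sub>\<xi> \<pi> - \<xi>)\<close>. For the pullback of \<open>\<gamma>\<close> the vector part must be \<open>0\<close>, so
  \<open>e\<^sup>B\<close> has no effect and the image is \<open>- \<xi>\<close>, whereas \<open>K\<close> fixes \<open>\<gamma>\<close>.\<close>

lemma not_bivector:
  assumes \<gamma>: "\<gamma> \<noteq> 0" "K (0, \<gamma>) = (0, \<gamma>)"
  shows "\<not> B_transform_of (end_chart_at \<A>) (reflector_space E) (K_eps \<A> E D \<epsilon>)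
    (\<lambda>x. K_pi (tangent (end_chart_at \<A>) (reflector_space E) x) (\<pi> x))"
proof
  assume bt: "B_transform_of (end_chart_at \<A>) (reflector_space E) (K_eps \<A> E D \<epsilon>)
    (\<lambda>x. K_pi (tangent (end_chart_at \<A>) (reflector_space E) x) (\<pi> x))"
  obtain q B where b: "bilinear q" "\<forall>u\<in>T. \<forall>v\<in>T. B u v = q u v"
    "\<forall>w\<in>T. \<forall>\<xi>\<in>dual_space T. K_eps \<A> E D \<epsilon> (p, K) (w, \<xi>)
      = exp_form T B (K_pi T (\<pi> (p, K)) (exp_form T (\<lambda>u v. - B u v) (w, \<xi>)))"
    by (rule B_transform_at[OF bt])
  note B = b(1) b(2)[rule_format] b(3)[rule_format]
  let ?k = "contr T (\<pi> (p, K)) (pullback \<gamma>)"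
  have val: "K_eps \<A> E D \<epsilon> (p, K) (0, pullback \<gamma>)
      = (- ?k, \<lambda>v\<in>T. - pullback \<gamma> v + B (- ?k) v)"
  proof -
    have "exp_form T (\<lambda>u v. - B u v) (0, pullback \<gamma>) = (0, pullback \<gamma>)"
      by (rule exp_zero[OF B(1,2) pullback_dual])
    then have "K_eps \<A> E D \<epsilon> (p, K) (0, pullback \<gamma>) = exp_form T B (K_pi T (\<pi> (p, K)) (0, pullback \<gamma>))"
      using B(3)[OF zero_T pullback_dual] by simp
    then show ?thesis unfolding K_pi_def exp_form_def by (auto simp: fun_eq_iff)
  qed
  have "- ?k = 0"
    using K_eps_horizontal(1)[of "pullback \<gamma>" \<gamma> 0, OF pullback_hl] unfolding hl_0 val \<gamma>(2)
    by (simp add: hl_0)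
  then have "?k = 0" by simp
  have "blinfun_apply \<gamma> Y = 0" for Y
    using K_eps_horizontal(2)[of "pullback \<gamma>" \<gamma> 0 Y, OF pullback_hl] B(2)[OF zero_T hl_tangent]
      bilinear_lzero[OF B(1)]
    unfolding hl_0 val \<gamma>(2) \<open>?k = 0\<close> by (simp add: hl_tangent pullback_hl)
  then have "\<gamma> = 0" by (intro blinfun_eqI) simp
  then show False using \<gamma>(1) by blast
qed

end

context metric_point
begin

lemma horizontal_point_at:
  assumes "metric_connection \<A> E pairing D'" "metric_connection \<A> (orth E) (\<lambda>a b. - pairing a b) D''"
    and K: "gen_paracomplex K" "blinfun_apply K ` E p \<subseteq> E p"
  shows "horizontal_point \<A> E (sum_conn E D' D'') p K"
proof -
  obtain \<epsilon> u where "\<And>i. i < 2 * n + 2 * n \<Longrightarrow> smooth_at x0 (u i)" "\<forall>\<^sub>F y in nhds x0. adapted \<epsilon> u y"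
    by (rule adapted_frame) blast
  then interpret connected_point \<A> p E n \<epsilon> u D' D'' by unfold_locales (use assms in auto)
  have refl: "(p, K) \<in> reflector_space E" using K unfolding reflector_space_def by simp
  show ?thesis
    by (rule horizontal_point.intro[OF refl chart_at(2) linear_hlift[OF refl] _ hlift_tangent[OF refl]])
      (simp add: hlift_formula[OF refl])
qed

end

theorem proposition4:
  fixes \<A> :: "('m::{t2_space, second_countable_topology}, 'e::euclidean_space) chart set"
    and E :: "'m \<Rightarrow> 'e gtv set"
    and D' D'' :: "('m, 'e) conn"
    and n \<epsilon> :: nat
  assumes "smooth_manifold \<A>" and "DIM('e) = 2 * n"
    and "generalized_metric \<A> n E"
    and "metric_connection \<A> E pairing D'"
    and "metric_connection \<A> (orth E) (\<lambda>a b. - pairing a b) D''"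
    and "\<epsilon> \<in> {1, 2, 3, 4}"
  shows "let \<G> = reflector_space E;
             ch = end_chart_at \<A>;
             T = tangent ch \<G>;
             \<K> = K_eps \<A> E (sum_conn E D' D'') \<epsilon>
         in \<not> B_transform_of ch \<G> \<K> (\<lambda>x. K_triv (T x)) \<and>
            (\<forall>\<omega>. pre_symplectic ch \<G> \<omega> \<longrightarrow> \<not> B_transform_of ch \<G> \<K> (\<lambda>x. K_omega (T x) (\<omega> x))) \<and>
            (\<forall>\<pi>. two_vector_field ch \<G> \<pi> \<longrightarrow> \<not> B_transform_of ch \<G> \<K> (\<lambda>x. K_pi (T x) (\<pi> x))) \<and>
            (\<forall>P. product_structure ch \<G> P \<longrightarrow> \<not> B_transform_of ch \<G> \<K> (\<lambda>x. K_prod (T x) (P x)))"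
proof -
  \<comment> \<open>the underlying type is nonempty, and any point will do\<close>
  define p :: 'm where "p = undefined"
  interpret metric_point \<A> p E n by unfold_locales (use assms in auto)
  obtain K L where K: "gen_paracomplex K" "blinfun_apply K ` E p \<subseteq> E p"
    and L: "gen_paracomplex L" "blinfun_apply L ` E p \<subseteq> E p"
    and K0: "\<And>\<gamma>. fst (K (0, \<gamma>)) = 0" and K1: "\<exists>\<gamma>. \<gamma> \<noteq> 0 \<and> K (0, \<gamma>) = (0, \<gamma>)"
    and L1: "\<exists>\<gamma>. fst (L (0, \<gamma>)) \<noteq> 0"
    using metric_fibre.paracomplex_pair[OF fibre[of p]] by metis
  interpret K: horizontal_point \<A> E "sum_conn E D' D''" p K \<epsilon>
    by (rule horizontal_point_at[OF assms(4,5) K])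
  interpret L: horizontal_point \<A> E "sum_conn E D' D''" p L \<epsilon>
    by (rule horizontal_point_at[OF assms(4,5) L])
  obtain \<gamma> where \<gamma>: "\<gamma> \<noteq> 0" "K (0, \<gamma>) = (0, \<gamma>)" using K1 by blast
  obtain \<delta> where \<delta>: "fst (L (0, \<delta>)) \<noteq> 0" using L1 by blast
  show ?thesis
    unfolding Let_def
  proof (intro conjI allI impI)
    show "\<not> B_transform_of (end_chart_at \<A>) (reflector_space E) (K_eps \<A> E (sum_conn E D' D'') \<epsilon>)
        (\<lambda>x. K_triv (tangent (end_chart_at \<A>) (reflector_space E) x))"
      by (rule L.not_covector_independent[OF \<delta>]) (simp add: K_triv_def)
    show "\<not> B_transform_of (end_chart_at \<A>) (reflector_space E) (K_eps \<A> E (sum_conn E D' D'') \<epsilon>)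
        (\<lambda>x. K_prod (tangent (end_chart_at \<A>) (reflector_space E) x) (P x))" for P
      by (rule L.not_covector_independent[OF \<delta>]) (simp add: K_prod_def)
    show "\<not> B_transform_of (end_chart_at \<A>) (reflector_space E) (K_eps \<A> E (sum_conn E D' D'') \<epsilon>)
        (\<lambda>x. K_omega (tangent (end_chart_at \<A>) (reflector_space E) x) (\<omega> x))"
      if "pre_symplectic (end_chart_at \<A>) (reflector_space E) \<omega>" for \<omega>
      by (rule K.not_symplectic[OF K0 that])
    show "\<not> B_transform_of (end_chart_at \<A>) (reflector_space E) (K_eps \<A> E (sum_conn E D' D'') \<epsilon>)
        (\<lambda>x. K_pi (tangent (end_chart_at \<A>) (reflector_space E) x) (\<pi> x))" for \<pi>
      by (rule K.not_bivector[OF \<gamma>])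
  qed
qed

end
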